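(* Let $\Delta(x)=\sum_{d\ge0}\delta_dx^d/d!$ with nonnegative $\delta_d$ and $\delta_0>0$, and define $\mu(j)=\min\{d\ge j:\delta_d>0\}$ for $j\ge0$. For a tree $T$ let $\gamma_\Delta(T)=\sum_{v\in V(T)}\mu(\deg(v))$. Let $T$ be a given tree with $k$ vertices. Let $\epsilon_n\to0$, $m=m(n)=\Theta(n\epsilon_n)$, let $\chi=\chi(n)$ be the positive solution of $\chi\Delta'(\chi)/\Delta(\chi)=2m/n$, and suppose that for all $0<\varepsilon<\pi/2$, \[ \int_{-\pi}^{\pi}\frac{\Delta(\chi e^{i\theta})^n}{e^{2mi\theta}}\,\mathrm d\theta\sim\int_{-\varepsilon}^{\varepsilon}\frac{\Delta(\chi e^{i\theta})^n}{e^{2mi\theta}}\,\mathrm d\theta\quad(n\to\infty). \] Let $G$ be a random $(n,m,\Delta)$-multigraph. Then \[ \mathbb E(G[T])=\Theta\!\left(n\,\epsilon_n^{-(k-1)+\gamma_\Delta(T)/\mu(1)}\right). \] Consequently, when $\epsilon_n=o(n^{\lambda})$ with $\lambda=\frac{\mu(1)}{(k-1)\mu(1)-\gamma_\Delta(T)}$, $G[T]=0$ almost surely.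
   Context: A multigraph has vertices labeled by distinct integers and edges given as triples $(v,w,e)$ (oriented from $v$ to $w$, loops and multiple edges allowed, $e$ a distinct integer edge label). An $(n,m)$-multigraph has vertex labels $1,\dots,n$ and edge labels $1,\dots,m$. $\deg(v)$ counts edge endpoints at $v$ (loops twice); in $\gamma_\Delta(T)$, $\deg(v)$ is the degree in $T$. $\omega_\Delta(G)=\prod_v\delta_{\deg(v)}$; a random $(n,m,\Delta)$-multigraph is chosen with probability proportional to $\omega_\Delta$. $G[T]$ is the number of subgraphs of $G$ isomorphic to $T$ (ignoring labels).
   Formalization: The lower bound in Θ is proved only if the integral condition also holds with 2m replaced by 2m−γ_Δ(T) (false without it, by cancelling peaks); the O-bound and the "almost surely" part need no such condition; λ's denominator is assumed nonzero. *)

theory Defs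
  imports "HOL-Probability.Probability" "HOL-Library.Landau_Symbols"
begin

section \<open>Multigraphs with labelled vertices and labelled, oriented edges\<close>

text \<open>The triple \<open>(v, w, e)\<close> is the edge with label \<open>e\<close> that is oriented from \<open>v\<close> to \<open>w\<close>.\<close>

type_synonym edge = "int \<times> int \<times> int"
type_synonym multigraph = "int set \<times> edge set"

abbreviation vertices :: "multigraph \<Rightarrow> int set" where "vertices G \<equiv> fst G"
abbreviation edges :: "multigraph \<Rightarrow> edge set" where "edges G \<equiv> snd G"

definition source :: "edge \<Rightarrow> int" where "source a = fst a"
definition target :: "edge \<Rightarrow> int" where "target a = fst (snd a)"
definition label :: "edge \<Rightarrow> int" where "label a = snd (snd a)"

definition multigraph :: "multigraph \<Rightarrow> bool" where
  "multigraph G \<longleftrightarrow> finite (vertices G) \<and> finite (edges G) \<and>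
     source ` edges G \<subseteq> vertices G \<and> target ` edges G \<subseteq> vertices G \<and> inj_on label (edges G)"

definition nm_multigraphs :: "nat \<Rightarrow> nat \<Rightarrow> multigraph set" where
  "nm_multigraphs n m =
     {G. multigraph G \<and> vertices G = {1..int n} \<and> label ` edges G = {1..int m}}"

text \<open>A loop at \<open>v\<close> is counted in both summands.\<close>

definition deg :: "multigraph \<Rightarrow> int \<Rightarrow> nat" where
  "deg G v = card {a \<in> edges G. source a = v} + card {a \<in> edges G. target a = v}"

definition subgraph :: "multigraph \<Rightarrow> multigraph \<Rightarrow> bool" where
  "subgraph H G \<longleftrightarrow> multigraph H \<and> vertices H \<subseteq> vertices G \<and> edges H \<subseteq> edges G"

text \<open>
  Isomorphism up to the names of vertices and edges. If \<open>ori\<close> holds, the orientation of the edges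
  has to be preserved, otherwise an edge may also be mapped to an edge of opposite orientation.
\<close>

definition isomorphic :: "bool \<Rightarrow> multigraph \<Rightarrow> multigraph \<Rightarrow> bool" where
  "isomorphic ori G H \<longleftrightarrow>
     (\<exists>f g. bij_betw f (vertices G) (vertices H) \<and> bij_betw g (edges G) (edges H) \<and>
        (\<forall>a\<in>edges G.
           (source (g a) = f (source a) \<and> target (g a) = f (target a)) \<or>
           (\<not> ori \<and> source (g a) = f (target a) \<and> target (g a) = f (source a))))"

definition subgraph_count :: "bool \<Rightarrow> multigraph \<Rightarrow> multigraph \<Rightarrow> nat" where
  "subgraph_count ori G T = card {H. subgraph H G \<and> isomorphic ori H T}"

text \<open>Trees: connected and without cycles as undirected graphs.\<close>

definition adjacent :: "multigraph \<Rightarrow> (int \<times> int) set" where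
  "adjacent G = (\<Union>a\<in>edges G. {(source a, target a), (target a, source a)})"

definition connected_multigraph :: "multigraph \<Rightarrow> bool" where
  "connected_multigraph G \<longleftrightarrow> (\<forall>u\<in>vertices G. \<forall>v\<in>vertices G. (u, v) \<in> (adjacent G)\<^sup>*)"

text \<open>
  The edge \<open>es ! i\<close> joins \<open>vs ! i\<close> to its cyclic successor. A loop is a cycle of length 1,
  and a pair of parallel edges is a cycle of length 2.
\<close>

definition cycle :: "multigraph \<Rightarrow> int list \<Rightarrow> edge list \<Rightarrow> bool" where
  "cycle G vs es \<longleftrightarrow> es \<noteq> [] \<and> length vs = length es \<and> distinct vs \<and> distinct es \<and>
     set es \<subseteq> edges G \<and>
     (\<forall>i<length es.
        {source (es ! i), target (es ! i)} = {vs ! i, vs ! (Suc i mod length es)})"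

definition tree :: "multigraph \<Rightarrow> bool" where
  "tree T \<longleftrightarrow> multigraph T \<and> vertices T \<noteq> {} \<and> connected_multigraph T \<and> (\<nexists>vs es. cycle T vs es)"


section \<open>Weights on the degrees\<close>

definition degree_gf :: "(nat \<Rightarrow> real) \<Rightarrow> 'a::real_normed_field fps" where
  "degree_gf \<delta> = Abs_fps (\<lambda>d. of_real (\<delta> d / fact d))"

definition weight :: "(nat \<Rightarrow> real) \<Rightarrow> multigraph \<Rightarrow> real" where
  "weight \<delta> G = (\<Prod>v\<in>vertices G. \<delta> (deg G v))"

definition total_weight :: "(nat \<Rightarrow> real) \<Rightarrow> nat \<Rightarrow> nat \<Rightarrow> real" where
  "total_weight \<delta> n m = (\<Sum>G\<in>nm_multigraphs n m. weight \<delta> G)"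

text \<open>Meaningful only if the total weight is positive, see \<open>pmf_random_multigraph\<close> below.\<close>

definition random_multigraph :: "(nat \<Rightarrow> real) \<Rightarrow> nat \<Rightarrow> nat \<Rightarrow> multigraph pmf" where
  "random_multigraph \<delta> n m =
     embed_pmf (\<lambda>G. if G \<in> nm_multigraphs n m then weight \<delta> G / total_weight \<delta> n m else 0)"

definition expected_count :: "(nat \<Rightarrow> real) \<Rightarrow> nat \<Rightarrow> nat \<Rightarrow> bool \<Rightarrow> multigraph \<Rightarrow> real" where
  "expected_count \<delta> n m ori T =
     measure_pmf.expectation (random_multigraph \<delta> n m) (\<lambda>G. real (subgraph_count ori G T))"

definition \<mu> :: "(nat \<Rightarrow> real) \<Rightarrow> nat \<Rightarrow> nat" where
  "\<mu> \<delta> j = (LEAST d. j \<le> d \<and> \<delta> d > 0)"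

definition \<gamma> :: "(nat \<Rightarrow> real) \<Rightarrow> multigraph \<Rightarrow> nat" where
  "\<gamma> \<delta> T = (\<Sum>v\<in>vertices T. \<mu> \<delta> (deg T v))"

definition arc_integral :: "(nat \<Rightarrow> real) \<Rightarrow> nat \<Rightarrow> int \<Rightarrow> real \<Rightarrow> real \<Rightarrow> complex" where
  "arc_integral \<delta> n N x r =
     integral {-r..r}
       (\<lambda>\<theta>. eval_fps (degree_gf \<delta>) (of_real x * exp (\<i> * of_real \<theta>)) ^ n
             / exp (of_int N * \<i> * of_real \<theta>))"

text \<open>
  The integral over the full circle is asymptotically the one over an arbitrarily small arc
  around 0. By Cauchy's formula, the integral over the full circle is
  \<open>2 * pi * x ^ N\<close> times the coefficient of order \<open>N\<close> in the \<open>n\<close>-th power of the generating function.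

  Concentration for one sequence \<open>N\<close> does not imply concentration for a shifted sequence
  \<open>N - c\<close>: contributions from far away arcs may cancel for one and not for the other. For
  the generating function \<open>1 + x^4 + x^6 + x^9 + ...\<close>, with odd \<open>m\<close> such that the
  weight ratio \<open>(m/2) powr (3/2) / sqrt n\<close> tends to \<open>ln 2 / 2\<close>, it holds for \<open>N = 2 * m\<close>, but
  the full integrals for \<open>N = 2 * m - 37\<close> are asymptotically negligible.
\<close>

definition concentrated ::
    "(nat \<Rightarrow> real) \<Rightarrow> (nat \<Rightarrow> int) \<Rightarrow> (nat \<Rightarrow> real) \<Rightarrow> bool" where
  "concentrated \<delta> N \<rho> \<longleftrightarrow>
     (\<forall>r. 0 < r \<and> r < pi / 2 \<longrightarrow>
        (\<lambda>n. arc_integral \<delta> n (N n) (\<rho> n) pi) \<sim>[sequentially]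
        (\<lambda>n. arc_integral \<delta> n (N n) (\<rho> n) r))"


section \<open>The random multigraph is well defined\<close>

lemma finite_nm_multigraphs: "finite (nm_multigraphs n m)"
proof (rule finite_subset)
  let ?A = "{1..int n} \<times> {1..int n} \<times> {1..int m}"
  show "nm_multigraphs n m \<subseteq> {{1..int n}} \<times> Pow ?A"
  proof
    fix G assume "G \<in> nm_multigraphs n m"
    then have V: "vertices G = {1..int n}" and L: "label ` edges G = {1..int m}"
      and S: "source ` edges G \<subseteq> vertices G" and T: "target ` edges G \<subseteq> vertices G"
      unfolding nm_multigraphs_def multigraph_def by blast+
    have "edges G \<subseteq> ?A"
    proof
      fix a assume a: "a \<in> edges G"
      have "source a \<in> {1..int n}" using imageI[OF a, of source] S V by blast
      moreover have "target a \<in> {1..int n}" using imageI[OF a, of target] T V by blast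
      moreover have "label a \<in> {1..int m}" using imageI[OF a, of label] L by blast
      ultimately show "a \<in> ?A"
        unfolding source_def target_def label_def mem_Times_iff by (intro conjI)
    qed
    then show "G \<in> {{1..int n}} \<times> Pow ?A"
      by (intro SigmaI[of "fst G" _ "snd G", unfolded prod.collapse]) (simp_all only: V singleton_iff Pow_iff)
  qed
qed simp

lemma weight_nonneg: "(\<And>d. \<delta> d \<ge> 0) \<Longrightarrow> weight \<delta> G \<ge> 0"
  by (simp add: weight_def prod_nonneg)

lemma pmf_random_multigraph:
  assumes "\<And>d. \<delta> d \<ge> 0" and "total_weight \<delta> n m > 0"
  shows "pmf (random_multigraph \<delta> n m) G =
    (if G \<in> nm_multigraphs n m then weight \<delta> G / total_weight \<delta> n m else 0)"
  unfolding random_multigraph_def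
proof (rule pmf_embed_pmf)
  let ?f = "\<lambda>G. if G \<in> nm_multigraphs n m then weight \<delta> G / total_weight \<delta> n m else 0"
  show nonneg: "0 \<le> ?f G" for G
    using weight_nonneg[of \<delta> G] assms by simp
  have "(\<integral>\<^sup>+G. ennreal (?f G) \<partial>count_space UNIV) = (\<Sum>G\<in>nm_multigraphs n m. ennreal (?f G))"
    by (rule nn_integral_count_space'[OF finite_nm_multigraphs]) simp_all
  also have "\<dots> = ennreal (\<Sum>G\<in>nm_multigraphs n m. ?f G)"
    by (rule sum_ennreal) (rule nonneg)
  also have "(\<Sum>G\<in>nm_multigraphs n m. ?f G) = (\<Sum>G\<in>nm_multigraphs n m. weight \<delta> G / total_weight \<delta> n m)"
    by (rule sum.cong) simp_all
  also have "\<dots> = total_weight \<delta> n m / total_weight \<delta> n m"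
    unfolding total_weight_def by (rule sum_divide_distrib[symmetric])
  finally show "(\<integral>\<^sup>+G. ennreal (?f G) \<partial>count_space UNIV) = 1"
    using assms(2) by simp
qed

end

theory Submission
  imports Defs
begin

text \<open>
  The expected count is the number of possible copies of \<open>T\<close> times the weight of the multigraphs
  that contain a given copy, divided by the total weight. A multigraph is a map from the ends
  of its edges to the vertices, so both weights are coefficients of power series: the total weight
  is \<open>(2 * m)!\<close> times the coefficient of order \<open>2 * m\<close> in \<open>\<Delta> ^ n\<close>, and fixing the \<open>k - 1\<close> edges of a
  copy replaces \<open>k\<close> of the factors by the derivatives of \<open>\<Delta>\<close> of orders \<open>deg T v\<close> and lowers the
  order to \<open>2 * m - 2 * (k - 1)\<close>.

  By Cauchy's formula on the circle of radius \<open>\<rho>\<close>, the ratio of the two coefficients is the ratio of two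
  integrals of powers of \<open>\<phi> \<theta> = \<Delta> (\<rho> * exp (\<i> * \<theta>)) / \<Delta> \<rho>\<close>, the characteristic function of a random degree
  with mean \<open>2 * m / n\<close>. As \<open>\<rho>\<close> tends to 0 and the derivative of order \<open>j\<close> has leading exponent \<open>\<mu> j - j\<close>, this
  ratio has order \<open>\<rho> ^ \<gamma>\<close>, while the saddle point equation makes \<open>\<rho> ^ \<mu> 1\<close> of order \<open>m / n\<close>. The integrals
  themselves are of order \<open>1 / sqrt m\<close>: the upper bound holds on the full circle without any hypothesis since
  \<open>\<phi>\<close> is dominated by its contributions of the degrees 0 and \<open>\<mu> 1\<close>; the lower bound is the Gaussian limit on a
  short arc, transferred to the full circle by concentration, which also forces \<open>m\<close> to tend to infinity.
\<close>

section \<open>Counting supergraphs\<close>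

text \<open>The shift by \<open>\<gamma> \<delta> T\<close> in the second concentration hypothesis
  is where the frequency of the numerator ends up. Close to 0 the product of the derivatives of the
  generating function behaves like a multiple of \<open>z ^ s\<close> with
  \<open>s = \<gamma> \<delta> T - 2 * (k - 1)\<close>. Its phase is moved into the Fourier kernel,
  which turns the order \<open>2 * m - 2 * (k - 1)\<close> into the frequency
  \<open>2 * m - \<gamma> \<delta> T\<close>. The obstacle is that a random degree is nearly
  supported on 0 and \<open>\<mu> \<delta> 1\<close>, so the power of its characteristic function
  may have peaks near all multiples of \<open>2 * pi / \<mu> \<delta> 1\<close>. Peaks away from 0
  can cancel the one at 0 at one frequency and not at another. Bounds on the modulus control all
  peaks at once and give the upper estimate of the numerator, whereas a lower estimate at a given
  frequency comes from concentration at that frequency. The denominator has frequency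
  \<open>2 * m\<close>. The upper estimate is all that the probabilistic conclusion requires, by the
  first moment method.\<close>

lemma fps_deriv_prod:
  fixes f :: "'v \<Rightarrow> 'a::field_char_0 fps"
  assumes "finite V"
  shows "fps_deriv (\<Prod>v\<in>V. f v) = (\<Sum>y\<in>V. \<Prod>v\<in>V. if v = y then fps_deriv (f v) else f v)"
  using assms
proof (induction V)
  case (insert x V)
  have "(\<Prod>v\<in>V. if v = x then fps_deriv (f v) else f v) = (\<Prod>v\<in>V. f v)"
    using insert.hyps by (intro prod.cong) auto
  moreover have "(\<Sum>y\<in>V. \<Prod>v\<in>insert x V. if v = y then fps_deriv (f v) else f v) =
      (\<Sum>y\<in>V. f x * (\<Prod>v\<in>V. if v = y then fps_deriv (f v) else f v))"
    using insert.hyps by (intro sum.cong refl, subst prod.insert) auto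
  ultimately show ?case
    using insert by (simp add: sum_distrib_left)
qed simp

text \<open>A weighted multinomial theorem. Sending one more point to \<open>y\<close> shifts the
  weights of \<open>y\<close> by one, which differentiates the factor of \<open>y\<close>. Summing
  over \<open>y\<close> is the product rule, and the coefficient of a derivative supplies the next
  factor of the factorial.\<close>

lemma sum_prod_fibre_cards:
  fixes c :: "'v \<Rightarrow> nat \<Rightarrow> 'a::field_char_0"
  assumes "finite A" and "finite V"
  shows "(\<Sum>h\<in>A \<rightarrow>\<^sub>E V. \<Prod>v\<in>V. c v (card {a\<in>A. h a = v})) =
    fact (card A) * fps_nth (\<Prod>v\<in>V. Abs_fps (\<lambda>d. c v d / fact d)) (card A)"
  using assms(1)
proof (induction A arbitrary: c)
  case empty
  have "fps_nth (\<Prod>v\<in>V. Abs_fps (\<lambda>d. c v d / fact d)) 0 = (\<Prod>v\<in>V. c v 0)"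
    using assms(2) by (induction V) auto
  then show ?case by simp
next
  case (insert a A)
  define F where "F v = Abs_fps (\<lambda>d. c v d / fact d)" for v
  define c' where "c' y v = (if v = y then (\<lambda>d. c v (Suc d)) else c v)" for y v
  have F': "Abs_fps (\<lambda>d. c' y v d / fact d) = (if v = y then fps_deriv (F v) else F v)" for y v
    by (auto simp: F_def c'_def fps_eq_iff field_simps simp del: of_nat_Suc)
  have cards: "(\<Prod>v\<in>V. c v (card {b\<in>insert a A. (g(a := y)) b = v})) =
      (\<Prod>v\<in>V. c' y v (card {b\<in>A. g b = v}))" for g y
  proof (intro prod.cong refl)
    fix v
    have "{b\<in>insert a A. (g(a := y)) b = v} =
        (if v = y then insert a {b\<in>A. g b = v} else {b\<in>A. g b = v})"
      using insert.hyps by auto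
    then show "c v (card {b\<in>insert a A. (g(a := y)) b = v}) = c' y v (card {b\<in>A. g b = v})"
      using insert.hyps by (auto simp: c'_def)
  qed
  have "(\<Sum>h\<in>insert a A \<rightarrow>\<^sub>E V. \<Prod>v\<in>V. c v (card {b\<in>insert a A. h b = v})) =
      (\<Sum>(y, g)\<in>V \<times> (A \<rightarrow>\<^sub>E V). \<Prod>v\<in>V. c' y v (card {b\<in>A. g b = v}))"
    unfolding PiE_insert_eq
    by (subst sum.reindex[OF inj_combinator[OF insert.hyps(2)]])
      (auto simp: cards[symmetric] intro!: sum.cong)
  also have "\<dots> = (\<Sum>y\<in>V. \<Sum>g\<in>A \<rightarrow>\<^sub>E V. \<Prod>v\<in>V. c' y v (card {b\<in>A. g b = v}))"
    by (simp add: sum.cartesian_product)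
  also have "\<dots> = fact (card A) * fps_nth (fps_deriv (\<Prod>v\<in>V. F v)) (card A)"
    by (simp add: insert.IH F' fps_deriv_prod[OF assms(2)] fps_sum_nth sum_distrib_left)
  also have "\<dots> = fact (card (insert a A)) * fps_nth (\<Prod>v\<in>V. F v) (card (insert a A))"
    using insert.hyps by (simp add: algebra_simps)
  finally show ?case by (simp add: F_def)
qed

text \<open>A multigraph containing \<open>H\<close> is determined by the vertices that it assigns to the two
  ends of each edge whose label does not occur in \<open>H\<close>.\<close>

definition extend_multigraph ::
    "nat \<Rightarrow> nat \<Rightarrow> multigraph \<Rightarrow> (int \<times> bool \<Rightarrow> int) \<Rightarrow> multigraph" where
  "extend_multigraph n m H h = ({1..int n},
     edges H \<union> (\<lambda>e. (h (e, True), h (e, False), e)) ` ({1..int m} - label ` edges H))"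

lemma deg_extend_multigraph:
  assumes "multigraph H"
  shows "deg (extend_multigraph n m H h) v =
    deg H v + card {p \<in> ({1..int m} - label ` edges H) \<times> UNIV. h p = v}"
proof -
  let ?L = "{1..int m} - label ` edges H"
  let ?g = "\<lambda>e. (h (e, True), h (e, False), e)"
  have fin: "finite (edges H)" using assms by (simp add: multigraph_def)
  have split: "card {a \<in> edges (extend_multigraph n m H h). P a} =
      card {a \<in> edges H. P a} + card {e \<in> ?L. P (?g e)}" for P
  proof -
    have "{a \<in> edges (extend_multigraph n m H h). P a} =
        {a \<in> edges H. P a} \<union> ?g ` {e \<in> ?L. P (?g e)}"
      by (auto simp: extend_multigraph_def)
    moreover have "{a \<in> edges H. P a} \<inter> ?g ` {e \<in> ?L. P (?g e)} = {}"
      by (force simp: label_def)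
    moreover have "finite {a \<in> edges H. P a}" using fin by simp
    moreover have "finite {e \<in> ?L. P (?g e)}" by (rule finite_subset[of _ ?L]) auto
    ultimately have "card {a \<in> edges (extend_multigraph n m H h). P a} =
        card {a \<in> edges H. P a} + card (?g ` {e \<in> ?L. P (?g e)})"
      using card_Un_disjoint[of "{a \<in> edges H. P a}" "?g ` {e \<in> ?L. P (?g e)}"]
      by (simp only: finite_imageI simp_thms)
    moreover have "card (?g ` {e \<in> ?L. P (?g e)}) = card {e \<in> ?L. P (?g e)}"
      by (rule card_image) (auto simp: inj_on_def)
    ultimately show ?thesis by simp
  qed
  have finL: "finite ((\<lambda>e. (e, b)) ` {e \<in> ?L. P e})" for b :: bool and P
    by (intro finite_imageI finite_subset[of "{e \<in> ?L. P e}" ?L]) auto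
  have "{p \<in> ?L \<times> UNIV. h p = v} =
      (\<lambda>e. (e, True)) ` {e \<in> ?L. h (e, True) = v} \<union> (\<lambda>e. (e, False)) ` {e \<in> ?L. h (e, False) = v}"
    by (auto simp: image_iff) (metis (full_types))+
  then have "card {p \<in> ?L \<times> UNIV. h p = v} =
      card ((\<lambda>e. (e, True)) ` {e \<in> ?L. h (e, True) = v}) +
      card ((\<lambda>e. (e, False)) ` {e \<in> ?L. h (e, False) = v})"
    by (simp only:) (rule card_Un_disjoint[OF finL finL], fast)
  also have "\<dots> = card {e \<in> ?L. h (e, True) = v} + card {e \<in> ?L. h (e, False) = v}"
    by (intro arg_cong2[where f="(+)"] card_image) (auto simp: inj_on_def)
  finally show ?thesis
    unfolding deg_def split by (simp add: source_def target_def)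
qed

text \<open>Since \<open>label\<close> is injective on the edges of a multigraph containing
  \<open>H\<close>, an edge whose label occurs in \<open>H\<close> is the edge of \<open>H\<close>
  itself, and every other edge is recovered from its label and its two ends.\<close>

lemma bij_betw_extend_multigraph:
  assumes H: "multigraph H" and "vertices H \<subseteq> {1..int n}" and "label ` edges H \<subseteq> {1..int m}"
  shows "bij_betw (extend_multigraph n m H)
    ((({1..int m} - label ` edges H) \<times> UNIV) \<rightarrow>\<^sub>E {1..int n})
    {G \<in> nm_multigraphs n m. subgraph H G}"
proof -
  let ?L = "{1..int m} - label ` edges H"
  let ?A = "?L \<times> (UNIV :: bool set)"
  have "inj_on (extend_multigraph n m H) (?A \<rightarrow>\<^sub>E {1..int n})"
  proof (rule inj_onI)
    fix h h' assume h: "h \<in> ?A \<rightarrow>\<^sub>E {1..int n}" and h': "h' \<in> ?A \<rightarrow>\<^sub>E {1..int n}"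
      and eq: "extend_multigraph n m H h = extend_multigraph n m H h'"
    show "h = h'"
    proof (rule PiE_ext[OF h h'])
      fix p assume "p \<in> ?A"
      then obtain e b where p: "p = (e, b)" "e \<in> ?L" by auto
      then have "(h (e, True), h (e, False), e) \<in> edges (extend_multigraph n m H h')"
        unfolding eq[symmetric] by (simp add: extend_multigraph_def)
      then have "h (e, True) = h' (e, True) \<and> h (e, False) = h' (e, False)"
        using p(2) by (force simp: extend_multigraph_def label_def)
      then show "h p = h' p" using p by (cases b) auto
    qed
  qed
  moreover have "extend_multigraph n m H ` (?A \<rightarrow>\<^sub>E {1..int n}) =
      {G \<in> nm_multigraphs n m. subgraph H G}"
  proof (intro equalityI subsetI)
    fix G assume "G \<in> extend_multigraph n m H ` (?A \<rightarrow>\<^sub>E {1..int n})"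
    then obtain h where h: "h \<in> ?A \<rightarrow>\<^sub>E {1..int n}" and G: "G = extend_multigraph n m H h" by auto
    have lab: "label (v, w, e) = e" for v w e by (simp add: label_def)
    have hr: "h p \<in> {1..int n}" if "p \<in> ?A" for p using h that by auto
    have "multigraph G"
      unfolding multigraph_def
    proof (intro conjI)
      show "finite (vertices G)" "finite (edges G)"
        using H by (auto simp: G extend_multigraph_def multigraph_def)
      have "source a \<in> vertices G \<and> target a \<in> vertices G" if "a \<in> edges G" for a
        using that assms hr
        by (auto simp: G extend_multigraph_def multigraph_def source_def target_def subset_iff image_subset_iff)
      then show "source ` edges G \<subseteq> vertices G" "target ` edges G \<subseteq> vertices G" by auto
      show "inj_on label (edges G)"
      proof (rule inj_onI)
        fix a b assume ab: "a \<in> edges G" "b \<in> edges G" "label a = label b"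
        have new: "a = (h (label a, True), h (label a, False), label a) \<and>
            label a \<notin> label ` edges H" if "a \<in> edges G" "a \<notin> edges H" for a
        proof -
          have "a \<in> (\<lambda>e. (h (e, True), h (e, False), e)) ` ?L"
            using that unfolding G extend_multigraph_def snd_conv Un_iff by blast
          then obtain e where "a = (h (e, True), h (e, False), e)" "e \<in> ?L" by (rule imageE)
          then show ?thesis by (simp add: lab)
        qed
        show "a = b"
        proof (cases "label a \<in> label ` edges H")
          case True
          then have "a \<in> edges H" "b \<in> edges H" using new[of a] new[of b] ab by auto
          then show ?thesis using H ab(3) by (auto simp: multigraph_def dest: inj_onD)
        next
          case False
          then have "a \<notin> edges H" "b \<notin> edges H" using ab(3) by (metis imageI)+
          then show ?thesis using new[of a] new[of b] ab by simp
        qed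
      qed
    qed
    moreover have "label ` edges G = {1..int m}"
      using assms(3) by (auto simp: G extend_multigraph_def label_def image_Un image_image)
    ultimately show "G \<in> {G \<in> nm_multigraphs n m. subgraph H G}"
      using assms by (auto simp: nm_multigraphs_def subgraph_def G extend_multigraph_def)
  next
    fix G assume "G \<in> {G \<in> nm_multigraphs n m. subgraph H G}"
    then have G: "multigraph G" "vertices G = {1..int n}" "label ` edges G = {1..int m}"
      and HG: "edges H \<subseteq> edges G"
      by (auto simp: nm_multigraphs_def subgraph_def)
    define ed where "ed = inv_into (edges G) label"
    have inj: "inj_on label (edges G)" using G(1) by (simp add: multigraph_def)
    have ed: "ed e \<in> edges G" "label (ed e) = e" if "e \<in> {1..int m}" for e
      using that G(3) by (auto simp: ed_def inv_into_into f_inv_into_f)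
    have ed': "ed (label a) = a" if "a \<in> edges G" for a
      using that inj by (simp add: ed_def)
    define h where "h = (\<lambda>p\<in>?A. if snd p then source (ed (fst p)) else target (ed (fst p)))"
    have "h \<in> ?A \<rightarrow>\<^sub>E {1..int n}"
    proof (rule PiE_I)
      fix p assume p: "p \<in> ?A"
      then have "ed (fst p) \<in> edges G" using ed(1)[of "fst p"] by auto
      then have "source (ed (fst p)) \<in> {1..int n}" "target (ed (fst p)) \<in> {1..int n}"
        using G(1) unfolding multigraph_def G(2) by blast+
      then show "h p \<in> {1..int n}" unfolding h_def using p by simp
    qed (simp add: h_def)
    moreover have "G = extend_multigraph n m H h"
    proof -
      have hd: "(h (e, True), h (e, False), e) = ed e" if "e \<in> ?L" for e
        using that ed(2)[of e] by (simp add: h_def source_def target_def label_def prod_eq_iff)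
      have "edges G = edges H \<union> ed ` ?L"
      proof (intro equalityI subsetI)
        fix a assume a: "a \<in> edges G"
        show "a \<in> edges H \<union> ed ` ?L"
        proof (cases "label a \<in> label ` edges H")
          case True
          then obtain b where "label a = label b" "b \<in> edges H" by (rule imageE)
          then show ?thesis using inj_onD[OF inj _ a, of b] HG by auto
        next
          case False
          then have "label a \<in> ?L" using a G(3) by blast
          then show ?thesis using ed'[OF a] by (metis UnI2 imageI)
        qed
      next
        fix a assume "a \<in> edges H \<union> ed ` ?L"
        then show "a \<in> edges G" using HG ed(1) by blast
      qed
      also have "ed ` ?L = (\<lambda>e. (h (e, True), h (e, False), e)) ` ?L"
        using hd by (intro image_cong) auto
      finally show ?thesis using G(2) by (simp add: extend_multigraph_def prod_eq_iff)
    qed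
    ultimately show "G \<in> extend_multigraph n m H ` (?A \<rightarrow>\<^sub>E {1..int n})" by blast
  qed
  ultimately show ?thesis by (simp add: bij_betw_def)
qed

text \<open>Each label outside \<open>H\<close> leaves two ends to be placed, hence the order
  \<open>2 * m - 2 * card (edges H)\<close>. The identity is stated over any real normed field so
  that it yields complex coefficients, as Cauchy's formula requires.\<close>

lemma sum_weight_supergraphs:
  assumes H: "multigraph H" and V: "vertices H \<subseteq> {1..int n}" and L: "label ` edges H \<subseteq> {1..int m}"
  shows "of_real (\<Sum>G | G \<in> nm_multigraphs n m \<and> subgraph H G. weight \<delta> G) =
    (fact (2 * m - 2 * card (edges H)) :: 'a :: real_normed_field) *
    fps_nth (\<Prod>v\<in>{1..int n}. Abs_fps (\<lambda>d. of_real (\<delta> (d + deg H v) / fact d)))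
      (2 * m - 2 * card (edges H))"
proof -
  let ?A = "({1..int m} - label ` edges H) \<times> (UNIV :: bool set)"
  define c where "c v d = (of_real (\<delta> (d + deg H v)) :: 'a)" for v d
  have "card (label ` edges H) = card (edges H)"
    using H by (intro card_image) (simp add: multigraph_def)
  then have card: "card ?A = 2 * m - 2 * card (edges H)"
    using L H by (simp add: card_cartesian_product card_Diff_subset multigraph_def)
  have "(of_real (\<Sum>G | G \<in> nm_multigraphs n m \<and> subgraph H G. weight \<delta> G) :: 'a) =
      (\<Sum>h\<in>?A \<rightarrow>\<^sub>E {1..int n}. of_real (weight \<delta> (extend_multigraph n m H h)))"
    unfolding of_real_sum by (rule sum.reindex_bij_betw[OF bij_betw_extend_multigraph[OF assms], symmetric])
  also have "\<dots> = (\<Sum>h\<in>?A \<rightarrow>\<^sub>E {1..int n}. \<Prod>v\<in>{1..int n}. c v (card {a\<in>?A. h a = v}))"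
    unfolding weight_def c_def deg_extend_multigraph[OF H]
    by (simp add: extend_multigraph_def add.commute)
  also have "\<dots> = fact (card ?A) *
      fps_nth (\<Prod>v\<in>{1..int n}. Abs_fps (\<lambda>d. c v d / fact d)) (card ?A)"
    by (rule sum_prod_fibre_cards) auto
  finally show ?thesis by (simp add: card c_def)
qed

section \<open>Trees\<close>

text \<open>There is one more vertex than edges: appending a single edge from the last vertex back
  to the head gives lists of equal length, the shape that \<open>cycle\<close> asks for.\<close>

definition simple_path :: "edge set \<Rightarrow> int list \<Rightarrow> edge list \<Rightarrow> bool" where
  "simple_path F vs es \<longleftrightarrow> distinct vs \<and> distinct es \<and> length vs = Suc (length es) \<and> set es \<subseteq> F \<and>
     (\<forall>i<length es. {source (es ! i), target (es ! i)} = {vs ! i, vs ! Suc i})"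

lemma simple_path_Cons:
  assumes "simple_path F vs es" and "x \<notin> set vs" and "b \<notin> F"
    and "{source b, target b} = {x, hd vs}"
  shows "simple_path (insert b F) (x # vs) (b # es)"
proof -
  have "hd vs = vs ! 0"
    using assms(1) by (metis hd_conv_nth list.size(3) nat.distinct(1) simple_path_def)
  then show ?thesis
    using assms by (auto simp: simple_path_def nth_Cons split: nat.splits)
qed

lemma simple_path_snoc:
  assumes "simple_path F vs es" and "x \<notin> set vs" and "b \<notin> F"
    and "{source b, target b} = {last vs, x}"
  shows "simple_path (insert b F) (vs @ [x]) (es @ [b])"
proof -
  have len: "length vs = Suc (length es)" using assms(1) by (simp add: simple_path_def)
  have "{source ((es @ [b]) ! i), target ((es @ [b]) ! i)} = {(vs @ [x]) ! i, (vs @ [x]) ! Suc i}"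
    if "i < length (es @ [b])" for i
  proof (cases "i = length es")
    case True
    moreover have "last vs = vs ! length es" using len by (simp add: last_conv_nth flip: length_0_conv)
    ultimately show ?thesis using assms(4) len by (simp add: nth_append)
  next
    case False
    then show ?thesis using that assms(1) len by (simp add: nth_append simple_path_def)
  qed
  then show ?thesis using assms by (auto simp: simple_path_def)
qed

text \<open>Connectedness is recorded through simple paths because these close up to cycles. The
  clause \<open>set vs \<subseteq> W\<close> keeps a path away from vertices that are attached
  later.\<close>

definition simply_connected_on :: "int set \<Rightarrow> edge set \<Rightarrow> bool" where
  "simply_connected_on W F \<longleftrightarrow> (\<forall>u\<in>W. \<forall>v\<in>W. \<exists>vs es.
     simple_path F vs es \<and> set vs \<subseteq> W \<and> hd vs = u \<and> last vs = v)"

lemma simple_path_mono: "simple_path F vs es \<Longrightarrow> F \<subseteq> F' \<Longrightarrow> simple_path F' vs es"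
  by (auto simp: simple_path_def)

text \<open>\<open>x\<close> is attached as a leaf: a path from or to \<open>x\<close> is one from
  or to \<open>w\<close> prolonged by \<open>b\<close>, and it remains simple because the old path
  stays in \<open>W\<close> and uses edges of \<open>F\<close>.\<close>

lemma simply_connected_on_insert:
  assumes conn: "simply_connected_on W F" and w: "w \<in> W" and x: "x \<notin> W" and b: "b \<notin> F"
    and bx: "{source b, target b} = {x, w}"
  shows "simply_connected_on (insert x W) (insert b F)"
  unfolding simply_connected_on_def
proof (intro ballI)
  fix u v assume u: "u \<in> insert x W" and v: "v \<in> insert x W"
  show "\<exists>vs es. simple_path (insert b F) vs es \<and> set vs \<subseteq> insert x W \<and> hd vs = u \<and> last vs = v"
  proof (cases "u = x"; cases "v = x")
    assume "u = x" "v = x"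
    then show ?thesis by (intro exI[of _ "[x]"] exI[of _ "[]"]) (simp add: simple_path_def)
  next
    assume *: "u = x" "v \<noteq> x"
    then obtain vs es where p: "simple_path F vs es" "set vs \<subseteq> W" "hd vs = w" "last vs = v"
      using conn w v by (auto simp: simply_connected_on_def) blast
    have "vs \<noteq> []" using p(1) by (auto simp: simple_path_def)
    moreover have "simple_path (insert b F) (x # vs) (b # es)"
      using p x b bx by (intro simple_path_Cons) auto
    ultimately show ?thesis using p * by (intro exI[of _ "x # vs"] exI[of _ "b # es"]) auto
  next
    assume *: "u \<noteq> x" "v = x"
    then obtain vs es where p: "simple_path F vs es" "set vs \<subseteq> W" "hd vs = u" "last vs = w"
      using conn w u by (auto simp: simply_connected_on_def) blast
    have "vs \<noteq> []" using p(1) by (auto simp: simple_path_def)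
    moreover have "simple_path (insert b F) (vs @ [x]) (es @ [b])"
      using p x b bx by (intro simple_path_snoc) auto
    ultimately show ?thesis using p * by (intro exI[of _ "vs @ [x]"] exI[of _ "es @ [b]"]) auto
  next
    assume *: "u \<noteq> x" "v \<noteq> x"
    then obtain vs es where p: "simple_path F vs es" "set vs \<subseteq> W" "hd vs = u" "last vs = v"
      using conn u v by (auto simp: simply_connected_on_def) blast
    moreover have "simple_path (insert b F) vs es" by (rule simple_path_mono[OF p(1)]) auto
    ultimately show ?thesis by blast
  qed
qed

lemma rtrancl_leaves_set:
  assumes "(u, v) \<in> r\<^sup>*" and "u \<in> W" and "v \<notin> W"
  shows "\<exists>w x. (w, x) \<in> r \<and> w \<in> W \<and> x \<notin> W"
  using assms by (induction rule: rtrancl_induct) auto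

text \<open>The subtree is grown from a single vertex: as long as \<open>W\<close> is not
  everything, connectedness provides an edge leaving \<open>W\<close>. Every step adds one vertex
  and one edge.\<close>

lemma spanning_subset:
  assumes T: "multigraph T" and conn: "connected_multigraph T" and "1 \<le> j" and "j \<le> card (vertices T)"
  shows "\<exists>W F. W \<subseteq> vertices T \<and> F \<subseteq> edges T \<and> card W = j \<and> Suc (card F) = j \<and>
    source ` F \<subseteq> W \<and> target ` F \<subseteq> W \<and> simply_connected_on W F"
  using assms(3,4)
proof (induction j rule: dec_induct)
  case base
  then obtain v where "v \<in> vertices T" by fastforce
  then show ?case
    by (intro exI[of _ "{v}"] exI[of _ "{}"])
      (auto simp: simply_connected_on_def simple_path_def intro!: exI[of _ "[v]"])
next
  case (step j)
  then obtain W F where WF: "W \<subseteq> vertices T" "F \<subseteq> edges T" "card W = j" "Suc (card F) = j"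
    "source ` F \<subseteq> W" "target ` F \<subseteq> W" "simply_connected_on W F" by auto
  have fin: "finite (vertices T)" "finite (edges T)" using T by (auto simp: multigraph_def)
  have "W \<noteq> vertices T" using WF(3) step.prems by auto
  then obtain y where y: "y \<in> vertices T" "y \<notin> W" using WF(1) by auto
  obtain u where u: "u \<in> W" using WF(3) step.hyps by fastforce
  have "(u, y) \<in> (adjacent T)\<^sup>*" using conn u y WF(1) by (auto simp: connected_multigraph_def)
  from rtrancl_leaves_set[OF this u y(2)] obtain w x where
    wx: "(w, x) \<in> adjacent T" "w \<in> W" "x \<notin> W" by auto
  then obtain b where b: "b \<in> edges T" "{source b, target b} = {x, w}"
    by (auto simp: adjacent_def)
  have "x \<in> source ` edges T \<union> target ` edges T" using b by (auto simp: doubleton_eq_iff)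
  then have xV: "x \<in> vertices T" using T by (auto simp: multigraph_def)
  have bF: "b \<notin> F" using b(2) wx(3) WF(5,6) by (auto simp: doubleton_eq_iff)
  have "simply_connected_on (insert x W) (insert b F)"
    by (rule simply_connected_on_insert[OF WF(7) wx(2,3) bF b(2)])
  moreover have "card (insert x W) = Suc j"
    using WF(1,3) fin(1) wx(3) by (simp add: finite_subset)
  moreover have "card (insert b F) = Suc (card F)"
    using WF(2) fin(2) bF by (simp add: finite_subset)
  moreover have "source ` insert b F \<subseteq> insert x W" "target ` insert b F \<subseteq> insert x W"
    using WF(5,6) b(2) wx(2) by (auto simp: doubleton_eq_iff)
  ultimately show ?case
    using WF(1,2,4) b(1) xV by (intro exI[of _ "insert x W"] exI[of _ "insert b F"]) auto
qed

text \<open>An edge outside the spanning set \<open>F\<close> would close the simple path in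
  \<open>F\<close> between its ends to a cycle, so \<open>F\<close> contains all edges. A loop is
  covered as well: its path is a single vertex.\<close>

lemma tree_card_edges:
  assumes "tree T"
  shows "Suc (card (edges T)) = card (vertices T)"
proof -
  have T: "multigraph T" "vertices T \<noteq> {}" "connected_multigraph T" "\<nexists>vs es. cycle T vs es"
    using assms by (auto simp: tree_def)
  have fin: "finite (vertices T)" using T by (auto simp: multigraph_def)
  then have "1 \<le> card (vertices T)" using T(2) by (simp add: Suc_le_eq card_gt_0_iff)
  from spanning_subset[OF T(1,3) this order.refl] obtain W F where
    WF: "W \<subseteq> vertices T" "F \<subseteq> edges T" "card W = card (vertices T)"
      "Suc (card F) = card (vertices T)" "simply_connected_on W F" by auto
  have W: "W = vertices T" using card_subset_eq[OF fin WF(1,3)] .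
  have "edges T \<subseteq> F"
  proof
    fix a assume a: "a \<in> edges T"
    show "a \<in> F"
    proof (rule ccontr)
      assume aF: "a \<notin> F"
      have "source a \<in> W" "target a \<in> W" using a T(1) W by (auto simp: multigraph_def)
      then obtain vs es where p: "simple_path F vs es" "hd vs = target a" "last vs = source a"
        using WF(5) by (auto simp: simply_connected_on_def) blast
      have len: "length vs = Suc (length es)" and d: "distinct vs" "distinct es" and es: "set es \<subseteq> F"
        using p(1) by (auto simp: simple_path_def)
      have "{source ((es @ [a]) ! i), target ((es @ [a]) ! i)} =
          {vs ! i, vs ! (Suc i mod length (es @ [a]))}" if "i < length (es @ [a])" for i
      proof (cases "i = length es")
        case True
        moreover have "vs ! length es = source a" "vs ! 0 = target a"
          using p(2,3) len by (metis diff_Suc_1 last_conv_nth length_0_conv nat.distinct(1),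
            metis hd_conv_nth length_0_conv nat.distinct(1))
        ultimately show ?thesis by simp
      next
        case False
        then show ?thesis using that p(1) by (simp add: nth_append simple_path_def)
      qed
      then have "cycle T vs (es @ [a])"
        using len d es aF a WF(2) by (auto simp: cycle_def)
      then show False using T(4) by blast
    qed
  qed
  then have "edges T = F" using WF(2) by auto
  then show ?thesis using WF(4) by simp
qed

lemma tree_deg_pos:
  assumes "tree T" and "card (vertices T) \<ge> 2" and v: "v \<in> vertices T"
  shows "deg T v > 0"
proof -
  have T: "multigraph T" "connected_multigraph T" using assms by (auto simp: tree_def)
  have "\<not> vertices T \<subseteq> {v}"
    using assms(2) card_mono[of "{v}" "vertices T"] by auto
  then obtain u where u: "u \<in> vertices T" "u \<noteq> v" by auto
  then have "(v, u) \<in> (adjacent T)\<^sup>*" using T v by (auto simp: connected_multigraph_def)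
  then obtain w where "(v, w) \<in> adjacent T" using u(2) by (metis converse_rtranclE)
  then obtain a where a: "a \<in> edges T" "source a = v \<or> target a = v" by (auto simp: adjacent_def)
  have pos: "card {a \<in> edges T. P a} > 0" if "P a" for P
  proof -
    have "finite {a \<in> edges T. P a}" using T by (simp add: multigraph_def)
    moreover have "a \<in> {a \<in> edges T. P a}" using a that by simp
    ultimately show ?thesis unfolding card_gt_0_iff by blast
  qed
  show ?thesis
    using pos[of "\<lambda>a. source a = v"] pos[of "\<lambda>a. target a = v"] a unfolding deg_def by linarith
qed

lemma sum_deg:
  assumes "multigraph T"
  shows "(\<Sum>v\<in>vertices T. deg T v) = 2 * card (edges T)"
proof -
  have fin: "finite (vertices T)" "finite (edges T)" using assms by (auto simp: multigraph_def)
  have "(\<Sum>v\<in>vertices T. card {a \<in> edges T. g a = v}) = card (edges T)"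
    if "g ` edges T \<subseteq> vertices T" for g
    using sum.group[OF fin(2,1) that, of "\<lambda>_. 1 :: nat"] by simp
  then show ?thesis
    using assms by (simp add: deg_def sum.distrib multigraph_def)
qed

section \<open>Copies of a multigraph\<close>

text \<open>The copies are taken among all possible labelled subgraphs, independently of the random
  multigraph, so that the expectation becomes a sum over a fixed finite set.\<close>

definition copies :: "nat \<Rightarrow> nat \<Rightarrow> bool \<Rightarrow> multigraph \<Rightarrow> multigraph set" where
  "copies n m ori T = {H. multigraph H \<and> vertices H \<subseteq> {1..int n} \<and>
     label ` edges H \<subseteq> {1..int m} \<and> isomorphic ori H T}"

text \<open>The derivative of order \<open>j\<close> of \<open>degree_gf \<delta>\<close>:
  differentiating an exponential generating function shifts its weights.\<close>

definition shifted_gf :: "(nat \<Rightarrow> real) \<Rightarrow> nat \<Rightarrow> 'a::real_normed_field fps" where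
  "shifted_gf \<delta> j = Abs_fps (\<lambda>d. of_real (\<delta> (d + j) / fact d))"

lemma shifted_gf_0: "shifted_gf \<delta> 0 = degree_gf \<delta>"
  by (simp add: shifted_gf_def degree_gf_def)

lemma deg_eq_sum:
  assumes "finite (edges G)"
  shows "deg G v = (\<Sum>a\<in>edges G. of_bool (source a = v) + of_bool (target a = v))"
  using assms by (simp add: deg_def sum.distrib of_bool_def sum.If_cases Int_def)

text \<open>Reversing an edge exchanges its two summands in \<open>deg_eq_sum\<close>, so degrees
  agree for both values of \<open>ori\<close>.\<close>

lemma isomorphic_deg:
  assumes H: "multigraph H" and T: "multigraph T"
    and f: "bij_betw f (vertices H) (vertices T)" and g: "bij_betw g (edges H) (edges T)"
    and fg: "\<And>a. a \<in> edges H \<Longrightarrow> (source (g a) = f (source a) \<and> target (g a) = f (target a)) \<or>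
           (\<not> ori \<and> source (g a) = f (target a) \<and> target (g a) = f (source a))"
    and v: "v \<in> vertices H"
  shows "deg T (f v) = deg H v"
proof -
  have eq: "f w = f v \<longleftrightarrow> w = v" if "w \<in> vertices H" for w
    using f v that by (auto simp: bij_betw_def inj_on_def)
  have st: "source a \<in> vertices H" "target a \<in> vertices H" if "a \<in> edges H" for a
    using H that by (auto simp: multigraph_def)
  have "deg T (f v) = (\<Sum>a\<in>edges T. of_bool (source a = f v) + of_bool (target a = f v))"
    using T by (intro deg_eq_sum) (simp add: multigraph_def)
  also have "\<dots> = (\<Sum>a\<in>edges H. of_bool (source (g a) = f v) + of_bool (target (g a) = f v))"
    by (rule sum.reindex_bij_betw[OF g, symmetric])
  also have "\<dots> = (\<Sum>a\<in>edges H. of_bool (source a = v) + of_bool (target a = v))"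
  proof (rule sum.cong[OF refl])
    fix a assume "a \<in> edges H"
    from fg[OF this] eq[OF st(1)[OF this]] eq[OF st(2)[OF this]]
    show "(of_bool (source (g a) = f v) + of_bool (target (g a) = f v) :: nat) =
        of_bool (source a = v) + of_bool (target a = v)" by auto
  qed
  also have "\<dots> = deg H v"
    using H by (intro deg_eq_sum[symmetric]) (simp add: multigraph_def)
  finally show ?thesis .
qed

lemma deg_outside:
  assumes "multigraph H" and "v \<notin> vertices H"
  shows "deg H v = 0"
proof -
  have "{a \<in> edges H. source a = v} = {}" "{a \<in> edges H. target a = v} = {}"
    using assms unfolding multigraph_def by blast+
  then show ?thesis unfolding deg_def by (simp only: card.empty)
qed

lemma card_copy:
  assumes "H \<in> copies n m ori T"
  shows "card (vertices H) = card (vertices T)" and "card (edges H) = card (edges T)"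
  using assms unfolding copies_def isomorphic_def by (blast intro: bij_betw_same_card)+

text \<open>Vertices outside \<open>H\<close> have degree 0 in \<open>H\<close> and the others
  repeat the degrees of \<open>T\<close>, so all copies contribute the same product.\<close>

lemma prod_deg_copy:
  fixes F :: "nat \<Rightarrow> 'a::comm_monoid_mult"
  assumes H: "H \<in> copies n m ori T" and T: "multigraph T"
  shows "(\<Prod>v\<in>{1..int n}. F (deg H v)) =
    (\<Prod>t\<in>vertices T. F (deg T t)) * F 0 ^ (n - card (vertices T))"
proof -
  have mH: "multigraph H" and V: "vertices H \<subseteq> {1..int n}" and "isomorphic ori H T"
    using H by (auto simp: copies_def)
  then obtain f g where f: "bij_betw f (vertices H) (vertices T)" and g: "bij_betw g (edges H) (edges T)"
    and fg: "\<And>a. a \<in> edges H \<Longrightarrow> (source (g a) = f (source a) \<and> target (g a) = f (target a)) \<or>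
           (\<not> ori \<and> source (g a) = f (target a) \<and> target (g a) = f (source a))"
    unfolding isomorphic_def by blast
  have fin: "finite (vertices H)" using mH by (simp add: multigraph_def)
  have "(\<Prod>v\<in>{1..int n}. F (deg H v)) =
      (\<Prod>v\<in>{1..int n} - vertices H. F (deg H v)) * (\<Prod>v\<in>vertices H. F (deg H v))"
    by (rule prod.subset_diff[OF V]) simp
  also have "(\<Prod>v\<in>{1..int n} - vertices H. F (deg H v)) = (\<Prod>v\<in>{1..int n} - vertices H. F 0)"
    by (intro prod.cong refl) (simp add: deg_outside[OF mH])
  also have "\<dots> = F 0 ^ (n - card (vertices T))"
    using V fin by (simp add: card_Diff_subset card_copy(1)[OF H])
  also have "(\<Prod>v\<in>vertices H. F (deg H v)) = (\<Prod>v\<in>vertices H. F (deg T (f v)))"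
    by (intro prod.cong refl) (simp add: isomorphic_deg[OF mH T f g fg])
  also have "\<dots> = (\<Prod>t\<in>vertices T. F (deg T t))"
    by (rule prod.reindex_bij_betw[OF f])
  finally show ?thesis by (simp add: mult.commute)
qed

lemma edges_subset_Times:
  assumes "multigraph H" and "label ` edges H \<subseteq> L"
  shows "edges H \<subseteq> vertices H \<times> vertices H \<times> L"
proof
  fix a assume a: "a \<in> edges H"
  obtain u v e where "a = (u, v, e)" by (cases a)
  moreover have "source a \<in> vertices H" "target a \<in> vertices H" "label a \<in> L"
    using a assms unfolding multigraph_def by blast+
  ultimately show "a \<in> vertices H \<times> vertices H \<times> L"
    by (simp add: source_def target_def label_def)
qed

lemma copies_subset:
  "copies n m ori T \<subseteq> (SIGMA V:{V. V \<subseteq> {1..int n} \<and> card V = card (vertices T)}.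
     {E. E \<subseteq> V \<times> V \<times> {1..int m} \<and> card E = card (edges T)})"
proof
  fix H assume H: "H \<in> copies n m ori T"
  then have "multigraph H" "vertices H \<subseteq> {1..int n}" "label ` edges H \<subseteq> {1..int m}"
    by (auto simp: copies_def)
  then have "edges H \<subseteq> vertices H \<times> vertices H \<times> {1..int m}" "vertices H \<subseteq> {1..int n}"
    using edges_subset_Times by blast+
  with card_copy[OF H] show "H \<in> (SIGMA V:{V. V \<subseteq> {1..int n} \<and> card V = card (vertices T)}.
     {E. E \<subseteq> V \<times> V \<times> {1..int m} \<and> card E = card (edges T)})"
    by (simp add: mem_Sigma_iff[of "fst H" "snd H", unfolded prod.collapse])
qed

lemma finite_edge_sets:
  assumes "finite V"
  shows "finite {E. E \<subseteq> V \<times> V \<times> {1..int m} \<and> card E = e}"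
proof (rule finite_subset)
  show "finite (Pow (V \<times> V \<times> {1..int m}))" using assms by simp
qed blast

lemma finite_Sigma_subsets:
  "finite (SIGMA V:{V. V \<subseteq> {1..int n} \<and> card V = k}. {E. E \<subseteq> V \<times> V \<times> {1..int m} \<and> card E = e})"
proof (rule finite_SigmaI)
  show "finite {V. V \<subseteq> {1..int n} \<and> card V = k}" by simp
  fix V assume "V \<in> {V. V \<subseteq> {1..int n} \<and> card V = k}"
  then show "finite {E. E \<subseteq> V \<times> V \<times> {1..int m} \<and> card E = e}"
    using finite_subset[of V "{1..int n}"] by (intro finite_edge_sets) simp
qed

lemma finite_copies: "finite (copies n m ori T)"
  by (rule finite_subset[OF copies_subset finite_Sigma_subsets])

text \<open>A copy consists of a vertex set and of edges among the
  \<open>card (vertices T) ^ 2 * m\<close> triples on it. For fixed \<open>T\<close> this generous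
  bound has the same order in \<open>n\<close> and \<open>m\<close> as the one in
  \<open>card_copies_ge\<close>.\<close>

lemma card_copies_le:
  "card (copies n m ori T) \<le>
    (n choose card (vertices T)) * ((card (vertices T) ^ 2 * m) choose card (edges T))"
proof -
  let ?k = "card (vertices T)" and ?e = "card (edges T)"
  let ?VV = "{V. V \<subseteq> {1..int n} \<and> card V = ?k}"
  have fin: "finite V" if "V \<in> ?VV" for V using that finite_subset[of V "{1..int n}"] by auto
  have "card (copies n m ori T) \<le> card (SIGMA V:?VV. {E. E \<subseteq> V \<times> V \<times> {1..int m} \<and> card E = ?e})"
    by (rule card_mono[OF finite_Sigma_subsets copies_subset])
  also have "\<dots> = (\<Sum>V\<in>?VV. card {E. E \<subseteq> V \<times> V \<times> {1..int m} \<and> card E = ?e})"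
    using finite_edge_sets[OF fin] by (intro card_SigmaI ballI) (simp, blast)
  also have "\<dots> = (\<Sum>V\<in>?VV. (?k ^ 2 * m) choose ?e)"
  proof (intro sum.cong refl)
    fix V assume V: "V \<in> ?VV"
    then show "card {E. E \<subseteq> V \<times> V \<times> {1..int m} \<and> card E = ?e} = (?k ^ 2 * m) choose ?e"
      using fin[OF V] n_subsets[of "V \<times> V \<times> {1..int m}" ?e]
      by (simp add: card_cartesian_product power2_eq_square mult.assoc)
  qed
  also have "\<dots> = (n choose ?k) * ((?k ^ 2 * m) choose ?e)"
    by (simp add: n_subsets)
  finally show ?thesis .
qed

text \<open>Transporting \<open>T\<close> along arbitrary bijections onto a vertex set and a label
  set produces a copy that determines both sets. Orientations are kept, so it is a copy for either
  value of \<open>ori\<close>.\<close>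

lemma card_copies_ge:
  assumes T: "multigraph T"
  shows "(n choose card (vertices T)) * (m choose card (edges T)) \<le> card (copies n m ori T)"
proof -
  let ?k = "card (vertices T)" and ?e = "card (edges T)"
  let ?VV = "{V. V \<subseteq> {1..int n} \<and> card V = ?k}" and ?LL = "{L. L \<subseteq> {1..int m} \<and> card L = ?e}"
  have fin: "finite (vertices T)" "finite (edges T)" using T by (auto simp: multigraph_def)
  have "?VV \<times> ?LL \<subseteq> (\<lambda>H. (vertices H, label ` edges H)) ` copies n m ori T"
  proof
    fix x assume "x \<in> ?VV \<times> ?LL"
    then obtain V L where x: "x = (V, L)" and V: "V \<subseteq> {1..int n}" "card V = ?k"
      and L: "L \<subseteq> {1..int m}" "card L = ?e" by auto
    have "finite V" "finite L" using V L finite_subset by blast+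
    then obtain f g where f: "bij_betw f (vertices T) V" and g: "bij_betw g (edges T) L"
      using finite_same_card_bij[OF fin(1), of V] finite_same_card_bij[OF fin(2), of L] V L by auto
    define \<psi> where "\<psi> a = (f (source a), f (target a), g a)" for a
    have \<psi>: "source (\<psi> a) = f (source a)" "target (\<psi> a) = f (target a)" "label (\<psi> a) = g a" for a
      by (simp_all add: \<psi>_def source_def target_def label_def)
    define H :: multigraph where "H = (V, \<psi> ` edges T)"
    have inj: "inj_on \<psi> (edges T)"
      using bij_betw_imp_inj_on[OF g] \<psi>(3) by (metis inj_onI inj_onD)
    have st: "source a \<in> vertices T" "target a \<in> vertices T" if "a \<in> edges T" for a
      using T that by (auto simp: multigraph_def)
    have mH: "multigraph H"
      unfolding multigraph_def
    proof (intro conjI)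
      show "finite (vertices H)" "finite (edges H)" using \<open>finite V\<close> fin by (auto simp: H_def)
      show "source ` edges H \<subseteq> vertices H" "target ` edges H \<subseteq> vertices H"
        using st bij_betw_imp_surj_on[OF f] by (auto simp: H_def \<psi> image_image)
      show "inj_on label (edges H)"
        using bij_betw_imp_inj_on[OF g] by (auto simp: H_def \<psi> inj_on_def)
    qed
    have lab: "label ` edges H = L"
      using bij_betw_imp_surj_on[OF g] by (simp add: H_def image_image \<psi>)
    have "isomorphic ori H T"
      unfolding isomorphic_def
    proof (intro exI conjI ballI)
      show "bij_betw (inv_into (vertices T) f) (vertices H) (vertices T)"
        using bij_betw_inv_into[OF f] by (simp add: H_def)
      show "bij_betw (inv_into (edges T) \<psi>) (edges H) (edges T)"
        using bij_betw_inv_into[OF inj_on_imp_bij_betw[OF inj]] by (simp add: H_def)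
      fix a assume "a \<in> edges H"
      then obtain b where b: "b \<in> edges T" "a = \<psi> b" by (auto simp: H_def)
      show "source (inv_into (edges T) \<psi> a) = inv_into (vertices T) f (source a) \<and>
            target (inv_into (edges T) \<psi> a) = inv_into (vertices T) f (target a) \<or>
            \<not> ori \<and> source (inv_into (edges T) \<psi> a) = inv_into (vertices T) f (target a) \<and>
            target (inv_into (edges T) \<psi> a) = inv_into (vertices T) f (source a)"
        using b inj st[OF b(1)] bij_betw_imp_inj_on[OF f] by (simp add: \<psi>)
    qed
    then have "H \<in> copies n m ori T" using mH lab V L by (simp add: copies_def H_def)
    moreover have "x = (vertices H, label ` edges H)" by (simp only: lab x) (simp add: H_def)
    ultimately show "x \<in> (\<lambda>H. (vertices H, label ` edges H)) ` copies n m ori T" by blast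
  qed
  then have "card (?VV \<times> ?LL) \<le> card (copies n m ori T)"
    using finite_copies by (meson card_image_le card_mono finite_imageI le_trans)
  then show ?thesis by (simp add: card_cartesian_product n_subsets)
qed

section \<open>Exact formula for the expected count\<close>

lemma total_weight_eq_fps_nth:
  "of_real (total_weight \<delta> n m) =
    (fact (2 * m) :: 'a::real_normed_field) * fps_nth (degree_gf \<delta> ^ n) (2 * m)"
proof -
  \<comment> \<open>The empty multigraph is contained in every multigraph, so its supergraphs carry
    the total weight.\<close>
  have empty: "multigraph ({}, {})" by (simp add: multigraph_def)
  then have "{G \<in> nm_multigraphs n m. subgraph ({}, {}) G} = nm_multigraphs n m"
    by (simp add: subgraph_def)
  moreover have "deg ({}, {}) v = 0" for v by (simp add: deg_def)
  ultimately show ?thesis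
    using sum_weight_supergraphs[OF empty, of n m \<delta>, where 'a='a]
    by (simp add: total_weight_def degree_gf_def)
qed

text \<open>Linearity of expectation: the count in a fixed \<open>G\<close> is a sum of indicators
  over \<open>copies\<close>, and the two sums are exchanged.\<close>

lemma expected_count_eq_sum:
  assumes "\<And>d. \<delta> d \<ge> 0" and "total_weight \<delta> n m > 0"
  shows "expected_count \<delta> n m ori T = (\<Sum>H\<in>copies n m ori T.
    \<Sum>G | G \<in> nm_multigraphs n m \<and> subgraph H G. weight \<delta> G) / total_weight \<delta> n m"
proof -
  let ?N = "nm_multigraphs n m" and ?C = "copies n m ori T"
  note pmf = pmf_random_multigraph[OF assms]
  have cnt: "real (subgraph_count ori G T) = (\<Sum>H\<in>?C. of_bool (subgraph H G))" if G: "G \<in> ?N" for G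
  proof -
    have "{H. subgraph H G \<and> isomorphic ori H T} = {H \<in> ?C. subgraph H G}"
    proof (rule Collect_cong)
      fix H
      have "vertices G = {1..int n}" "label ` edges G = {1..int m}"
        using G by (auto simp: nm_multigraphs_def)
      then show "(subgraph H G \<and> isomorphic ori H T) = (H \<in> ?C \<and> subgraph H G)"
        unfolding copies_def subgraph_def mem_Collect_eq by (metis image_mono)
    qed
    then show ?thesis
      using finite_copies by (simp add: subgraph_count_def of_bool_def sum.If_cases Int_def)
  qed
  have "expected_count \<delta> n m ori T =
      (\<Sum>G\<in>?N. pmf (random_multigraph \<delta> n m) G * real (subgraph_count ori G T))"
    unfolding expected_count_def
    by (subst integral_measure_pmf[OF finite_nm_multigraphs])
      (auto simp: pmf set_pmf_iff split: if_splits)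
  also have "\<dots> = (\<Sum>G\<in>?N. \<Sum>H\<in>?C. of_bool (subgraph H G) * weight \<delta> G / total_weight \<delta> n m)"
    by (intro sum.cong refl) (simp add: pmf cnt sum_distrib_left sum_distrib_right mult.commute sum_divide_distrib)
  also have "\<dots> = (\<Sum>H\<in>?C. \<Sum>G\<in>?N. of_bool (subgraph H G) * weight \<delta> G / total_weight \<delta> n m)"
    by (rule sum.swap)
  also have "\<dots> = (\<Sum>H\<in>?C. (\<Sum>G | G \<in> ?N \<and> subgraph H G. weight \<delta> G) / total_weight \<delta> n m)"
  proof (intro sum.cong refl)
    fix H
    have "(\<Sum>G\<in>?N. of_bool (subgraph H G) * weight \<delta> G / total_weight \<delta> n m) =
        (\<Sum>G\<in>?N. if subgraph H G then weight \<delta> G / total_weight \<delta> n m else 0)"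
      by (intro sum.cong) auto
    also have "\<dots> = (\<Sum>G | G \<in> ?N \<and> subgraph H G. weight \<delta> G / total_weight \<delta> n m)"
      by (rule sum.inter_filter[OF finite_nm_multigraphs, symmetric])
    finally show "(\<Sum>G\<in>?N. of_bool (subgraph H G) * weight \<delta> G / total_weight \<delta> n m) =
        (\<Sum>G | G \<in> ?N \<and> subgraph H G. weight \<delta> G) / total_weight \<delta> n m"
      by (simp add: sum_divide_distrib)
  qed
  finally show ?thesis by (simp add: sum_divide_distrib)
qed

lemma expected_count_eq_fps_nth:
  assumes "\<And>d. \<delta> d \<ge> 0" and "total_weight \<delta> n m > 0" and T: "multigraph T"
  defines "k \<equiv> card (vertices T)" and "e \<equiv> card (edges T)"
  shows "of_real (expected_count \<delta> n m ori T * total_weight \<delta> n m) =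
    (of_nat (card (copies n m ori T)) * fact (2 * m - 2 * e) :: 'a::real_normed_field) *
    fps_nth ((\<Prod>t\<in>vertices T. shifted_gf \<delta> (deg T t)) * degree_gf \<delta> ^ (n - k)) (2 * m - 2 * e)"
proof -
  have "(of_real (\<Sum>G | G \<in> nm_multigraphs n m \<and> subgraph H G. weight \<delta> G) :: 'a) =
      fact (2 * m - 2 * e) *
      fps_nth ((\<Prod>t\<in>vertices T. shifted_gf \<delta> (deg T t)) * degree_gf \<delta> ^ (n - k)) (2 * m - 2 * e)"
    if H: "H \<in> copies n m ori T" for H
  proof -
    have "multigraph H" "vertices H \<subseteq> {1..int n}" "label ` edges H \<subseteq> {1..int m}"
      using H by (auto simp: copies_def)
    from sum_weight_supergraphs[OF this, of \<delta>, where 'a='a]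
    show ?thesis
      using prod_deg_copy[OF H T, of "shifted_gf \<delta> :: nat \<Rightarrow> 'a fps"]
      by (simp add: card_copy(2)[OF H] e_def k_def shifted_gf_0) (simp add: shifted_gf_def)
  qed
  then show ?thesis
    using assms(2) by (simp add: expected_count_eq_sum[OF assms(1,2)])
qed

section \<open>Integrals over the circle\<close>

text \<open>From \<open>1 - cos x = 2 * (sin (x / 2))\<^sup>2\<close> and
  \<open>sin y \<ge> y / 3\<close> for \<open>0 \<le> y \<le> 2\<close> the constant is
  \<open>2 / 36 = 1 / 18\<close>. The range contains a full period \<open>{-pi..pi}\<close>, as
  \<open>pi < 4\<close>.\<close>

lemma one_minus_cos_ge:
  fixes x :: real
  assumes "\<bar>x\<bar> \<le> 4"
  shows "x\<^sup>2 / 18 \<le> 1 - cos x"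
proof -
  \<comment> \<open>Taylor's bound gives \<open>sin y \<ge> y - y ^ 3 / 6\<close>, and
    \<open>y ^ 3 \<le> 4 * y\<close>.\<close>
  have *: "y / 3 \<le> sin y" if "0 \<le> y" "y \<le> 2" for y :: real
  proof -
    have "\<bar>sin y - y\<bar> \<le> y ^ 3 / 6"
      using Maclaurin_sin_bound[of y 3] that
      by (simp add: numeral_3_eq_3 sin_coeff_def fact_numeral power_abs)
    moreover have "y ^ 3 \<le> y * 4"
      using that mult_mono[of y 2 y 2] mult_left_mono[of "y * y" 4 y] by (simp add: power3_eq_cube)
    ultimately show ?thesis by linarith
  qed
  define y where "y = \<bar>x\<bar> / 2"
  have "(y / 3)\<^sup>2 \<le> (sin y)\<^sup>2"
    using *[of y] assms by (intro power_mono) (auto simp: y_def)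
  moreover have "cos x = 1 - 2 * (sin y)\<^sup>2"
    using cos_double_sin[of y] by (simp add: y_def)
  moreover have "(y / 3)\<^sup>2 = x\<^sup>2 / 36" by (simp add: y_def power_divide)
  ultimately show ?thesis by linarith
qed

lemma has_bochner_integral_gaussian:
  fixes a b :: real
  assumes "a > 0"
  shows "has_bochner_integral lborel (\<lambda>x. exp (- a * (x - b)\<^sup>2)) (sqrt (pi / a))"
proof -
  define \<sigma> where "\<sigma> = 1 / sqrt (2 * a)"
  have \<sigma>: "\<sigma> > 0" "\<sigma>\<^sup>2 = 1 / (2 * a)" using assms by (simp_all add: \<sigma>_def power_divide)
  have eq: "normal_density b \<sigma> = (\<lambda>x. exp (- a * (x - b)\<^sup>2) / sqrt (pi / a))"
    using assms by (intro ext) (simp add: normal_density_def \<sigma> field_simps)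
  have "has_bochner_integral lborel (\<lambda>x. exp (- a * (x - b)\<^sup>2) / sqrt (pi / a)) 1"
    using integrable_normal_density[OF \<sigma>(1), of b] integral_normal_density[OF \<sigma>(1), of b]
    unfolding has_bochner_integral_iff eq by blast
  from has_bochner_integral_mult_left[OF this, of "sqrt (pi / a)"] show ?thesis
    using assms by simp
qed

lemma integral_circle_cis:
  fixes j :: int
  shows "integral {-pi..pi} (\<lambda>\<theta>. exp (of_int j * \<i> * of_real \<theta>)) = (if j = 0 then 2 * pi else 0)"
proof (cases "j = 0")
  case False
  define F where "F \<theta> = exp (of_int j * \<i> * of_real \<theta>) / (of_int j * \<i>)" for \<theta> :: real
  have "((\<lambda>\<theta>. exp (of_int j * \<i> * of_real \<theta>)) has_integral F pi - F (-pi)) {-pi..pi}"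
  proof (intro fundamental_theorem_of_calculus)
    fix \<theta> :: real
    have "((\<lambda>z. exp (of_int j * \<i> * z) / (of_int j * \<i>)) has_field_derivative
        exp (of_int j * \<i> * of_real \<theta>)) (at (of_real \<theta>))"
      using False by (auto intro!: derivative_eq_intros)
    then show "(F has_vector_derivative exp (of_int j * \<i> * of_real \<theta>)) (at \<theta> within {-pi..pi})"
      unfolding F_def by (rule has_vector_derivative_real_field)
  qed simp
  moreover have "exp (of_int j * \<i> * of_real pi) = exp (of_int j * \<i> * of_real (-pi))"
    by (subst exp_eq) (auto intro!: exI[of _ j] simp: algebra_simps)
  ultimately show ?thesis
    using False by (simp add: F_def integral_unique)
qed (simp add: scaleR_conv_of_real)

text \<open>The power series converges absolutely on the circle, so it can be integrated term by
  term, and orthogonality of the exponentials leaves the term of order \<open>N\<close>.\<close>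

lemma Cauchy_coefficient_formula:
  fixes f :: "complex fps"
  assumes x: "x > 0" "ereal x < fps_conv_radius f"
  shows "integral {-pi..pi}
      (\<lambda>\<theta>. eval_fps f (of_real x * exp (\<i> * of_real \<theta>)) / exp (of_int (int N) * \<i> * of_real \<theta>)) =
    of_real (2 * pi) * of_real x ^ N * fps_nth f N"
proof -
  define g where "g d \<theta> = fps_nth f d * of_real x ^ d * exp (of_int (int d - int N) * \<i> * of_real \<theta>)"
    for d and \<theta> :: real
  define h where "h d \<theta> = indicator {-pi..pi} \<theta> *\<^sub>R g d \<theta>" for d and \<theta> :: real
  have sint: "set_integrable lborel {-pi..pi} (g d)" for d
    unfolding g_def by (intro borel_integrable_atLeastAtMost' continuous_intros)
  then have int: "integrable lborel (h d)" for d
    by (simp add: h_def[abs_def] set_integrable_def)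
  have nh: "norm (h d \<theta>) = indicator {-pi..pi} \<theta> * (norm (fps_nth f d) * x ^ d)" for d \<theta>
    using x by (simp add: h_def g_def norm_mult norm_power)
  have sm: "summable (\<lambda>d. norm (fps_nth f d) * x ^ d)"
    using norm_summable_fps[of "of_real x" f] x by (simp add: norm_mult norm_power)
  have "summable (\<lambda>d. norm (h d \<theta>))" for \<theta>
    unfolding nh by (intro summable_mult sm)
  moreover have "summable (\<lambda>d. \<integral>\<theta>. norm (h d \<theta>) \<partial>lborel)"
    unfolding nh by (simp add: summable_mult sm)
  ultimately have "(\<lambda>d. integral\<^sup>L lborel (h d)) sums (\<integral>\<theta>. (\<Sum>d. h d \<theta>) \<partial>lborel)"
    using int by (intro sums_integral) auto
  moreover have "integral\<^sup>L lborel (h d) = (if d = N then of_real (2 * pi) * of_real x ^ N * fps_nth f N else 0)" for d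
  proof -
    have "integral\<^sup>L lborel (h d) = integral {-pi..pi} (g d)"
      using set_borel_integral_eq_integral(2)[OF sint] by (simp add: h_def[abs_def] set_lebesgue_integral_def)
    also have "\<dots> = fps_nth f d * of_real x ^ d * (if int d - int N = 0 then 2 * pi else 0)"
      unfolding g_def integral_mult_right integral_circle_cis ..
    finally show ?thesis by simp
  qed
  ultimately have "(\<integral>\<theta>. (\<Sum>d. h d \<theta>) \<partial>lborel) = of_real (2 * pi) * of_real x ^ N * fps_nth f N"
    using sums_unique2 sums_single[of N "\<lambda>_. of_real (2 * pi) * of_real x ^ N * fps_nth f N"] by fastforce
  moreover have "(\<Sum>d. h d \<theta>) = indicator {-pi..pi} \<theta> *\<^sub>R
      (eval_fps f (of_real x * exp (\<i> * of_real \<theta>)) / exp (of_int (int N) * \<i> * of_real \<theta>))" for \<theta>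
  proof -
    have "(\<lambda>d. fps_nth f d * (of_real x * exp (\<i> * of_real \<theta>)) ^ d) sums
        eval_fps f (of_real x * exp (\<i> * of_real \<theta>))"
      using x by (intro sums_eval_fps) (simp add: norm_mult)
    from sums_divide[OF this, of "exp (of_int (int N) * \<i> * of_real \<theta>)"]
    have "(\<lambda>d. g d \<theta>) sums
        (eval_fps f (of_real x * exp (\<i> * of_real \<theta>)) / exp (of_int (int N) * \<i> * of_real \<theta>))"
      by (simp add: g_def power_mult_distrib exp_of_nat_mult[symmetric] algebra_simps exp_diff)
    then show ?thesis
      unfolding h_def by (intro sums_unique[symmetric] sums_scaleR_right)
  qed
  moreover have "set_integrable lborel {-pi..pi}
      (\<lambda>\<theta>. eval_fps f (of_real x * exp (\<i> * of_real \<theta>)) / exp (of_int (int N) * \<i> * of_real \<theta>))"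
    using x by (intro borel_integrable_atLeastAtMost' continuous_intros) (auto simp: norm_mult)
  from set_borel_integral_eq_integral(2)[OF this]
  have "integral {-pi..pi}
      (\<lambda>\<theta>. eval_fps f (of_real x * exp (\<i> * of_real \<theta>)) / exp (of_int (int N) * \<i> * of_real \<theta>)) =
    (\<integral>\<theta>. indicator {-pi..pi} \<theta> *\<^sub>R (eval_fps f (of_real x * exp (\<i> * of_real \<theta>)) /
      exp (of_int (int N) * \<i> * of_real \<theta>)) \<partial>lborel)"
    by (simp add: set_lebesgue_integral_def)
  ultimately show ?thesis by simp
qed

section \<open>Characteristic functions of distributions on the natural numbers\<close>

locale nat_distribution =
  fixes p :: "nat \<Rightarrow> real"
  assumes nonneg: "\<And>d. p d \<ge> 0" and total: "(\<Sum>d. p d) = 1"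
    and summable_moments: "\<And>j. summable (\<lambda>d. real d ^ j * p d)"
begin

definition mom :: "nat \<Rightarrow> real" where "mom j = (\<Sum>d. real d ^ j * p d)"

definition cf :: "real \<Rightarrow> complex" where "cf \<theta> = (\<Sum>d. of_real (p d) * iexp (real d * \<theta>))"

lemma summable_p: "summable p"
  using summable_moments[of 0] by simp

lemma mom_nonneg: "mom j \<ge> 0"
  unfolding mom_def by (intro suminf_nonneg summable_moments) (simp add: nonneg)

lemma norm_term: "norm (of_real (p d) * iexp (real d * \<theta>)) = p d"
  by (simp add: norm_mult nonneg)

lemma summable_cf: "summable (\<lambda>d. of_real (p d) * iexp (real d * \<theta>))"
  by (rule summable_norm_cancel) (unfold norm_term, rule summable_p)

text \<open>The Taylor estimate of \<open>iexp\<close> is summed against \<open>p\<close>; finite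
  moments make all the series converge.\<close>

lemma cf_approx:
  "norm (cf \<theta> - (\<Sum>k\<le>n. (\<i> * \<theta>) ^ k / fact k * mom k)) \<le> \<bar>\<theta>\<bar> ^ Suc n / fact (Suc n) * mom (Suc n)"
proof -
  define r where "r d = of_real (p d) * (iexp (real d * \<theta>) - (\<Sum>k\<le>n. (\<i> * (real d * \<theta>)) ^ k / fact k))" for d
  have "(\<lambda>d. of_real (real d ^ k * p d)) sums (of_real (mom k) :: complex)" for k
    unfolding mom_def by (intro sums_of_real summable_sums summable_moments)
  then have "(\<lambda>d. \<Sum>k\<le>n. (\<i> * \<theta>) ^ k / fact k * of_real (real d ^ k * p d)) sums
      (\<Sum>k\<le>n. (\<i> * \<theta>) ^ k / fact k * mom k)"
    by (intro sums_sum sums_mult)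
  then have "(\<lambda>d. of_real (p d) * iexp (real d * \<theta>) -
      (\<Sum>k\<le>n. (\<i> * \<theta>) ^ k / fact k * of_real (real d ^ k * p d))) sums
      (cf \<theta> - (\<Sum>k\<le>n. (\<i> * \<theta>) ^ k / fact k * mom k))"
    unfolding cf_def by (intro sums_diff summable_sums summable_cf)
  also have "(\<lambda>d. of_real (p d) * iexp (real d * \<theta>) -
      (\<Sum>k\<le>n. (\<i> * \<theta>) ^ k / fact k * of_real (real d ^ k * p d))) = r"
    by (auto simp: r_def fun_eq_iff algebra_simps sum_distrib_left power_mult_distrib intro!: sum.cong)
  finally have r: "r sums (cf \<theta> - (\<Sum>k\<le>n. (\<i> * \<theta>) ^ k / fact k * mom k))" .
  have bound: "norm (r d) \<le> \<bar>\<theta>\<bar> ^ Suc n / fact (Suc n) * (real d ^ Suc n * p d)" for d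
  proof -
    have "norm (r d) \<le> p d * (\<bar>real d * \<theta>\<bar> ^ Suc n / fact (Suc n))"
      unfolding r_def norm_mult using iexp_approx1[of "real d * \<theta>" n]
      by (intro mult_mono) (auto simp: nonneg)
    then show ?thesis by (simp add: abs_mult power_mult_distrib mult_ac)
  qed
  have "norm (\<Sum>d. r d) \<le> (\<Sum>d. \<bar>\<theta>\<bar> ^ Suc n / fact (Suc n) * (real d ^ Suc n * p d))"
    by (rule norm_suminf_le[OF bound]) (intro summable_mult summable_moments)
  then show ?thesis
    unfolding sums_unique[OF r, symmetric] suminf_mult[OF summable_moments] mom_def[symmetric] .
qed

lemma norm_cf_le_1: "norm (cf \<theta>) \<le> 1"
  unfolding cf_def total[symmetric] using norm_term by (intro norm_suminf_le summable_p) simp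

text \<open>Only two values of the random variable are used: all the others contribute at most
  their total probability.\<close>

lemma norm_cf_le:
  assumes "M > 0"
  shows "norm (cf \<theta>) \<le> exp (- (p 0 * p M * (1 - cos (real M * \<theta>))))"
proof -
  define q where "q d = (if d \<in> {0, M} then 0 else p d)" for d
  have fin: "(\<lambda>d. if d \<in> {0, M} then g d else 0) sums (g 0 + g M)" for g :: "nat \<Rightarrow> 'a::real_normed_vector"
    using sums_If_finite_set[of "{0, M}" g] assms by simp
  have "(\<lambda>d. of_real (p d) * iexp (real d * \<theta>) -
      (if d \<in> {0, M} then of_real (p d) * iexp (real d * \<theta>) else 0)) sums
      (cf \<theta> - (of_real (p 0) * iexp (real 0 * \<theta>) + of_real (p M) * iexp (real M * \<theta>)))"
    unfolding cf_def by (intro sums_diff summable_sums summable_cf fin)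
  also have "(\<lambda>d. of_real (p d) * iexp (real d * \<theta>) -
      (if d \<in> {0, M} then of_real (p d) * iexp (real d * \<theta>) else 0)) =
      (\<lambda>d. of_real (q d) * iexp (real d * \<theta>))"
    by (auto simp: q_def)
  finally have 1: "(\<lambda>d. of_real (q d) * iexp (real d * \<theta>)) sums
      (cf \<theta> - (of_real (p 0) + of_real (p M) * iexp (real M * \<theta>)))"
    by simp
  have "(\<lambda>d. p d - (if d \<in> {0, M} then p d else 0)) sums (1 - (p 0 + p M))"
    unfolding total[symmetric] by (intro sums_diff summable_sums summable_p fin)
  also have "(\<lambda>d. p d - (if d \<in> {0, M} then p d else 0)) = q"
    by (auto simp: q_def)
  finally have 2: "q sums (1 - (p 0 + p M))" .
  have "norm (cf \<theta> - (of_real (p 0) + of_real (p M) * iexp (real M * \<theta>))) \<le> 1 - (p 0 + p M)"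
    unfolding sums_unique[OF 1] sums_unique[OF 2]
    by (intro norm_suminf_le sums_summable[OF 2]) (simp add: norm_mult q_def nonneg)
  moreover have "norm (of_real (p 0) + of_real (p M) * iexp (real M * \<theta>)) \<le>
      p 0 + p M - p 0 * p M * (1 - cos (real M * \<theta>))"
  proof (rule power2_le_imp_le)
    let ?c = "1 - cos (real M * \<theta>)"
    have s1: "p 0 + p M \<le> 1"
      using sums_le[OF _ sums_zero 2] nonneg by (auto simp: q_def)
    have c: "0 \<le> ?c" "?c \<le> 2" by (simp_all add: abs_le_D2 minus_le_iff)
    have pp: "0 \<le> p 0 * p M" using nonneg by simp
    have "p 0 * p M \<le> p 0 * 1" using s1 nonneg[of 0] by (intro mult_left_mono nonneg) simp
    moreover have "p 0 * p M \<le> 1 * p M" using s1 nonneg[of M] by (intro mult_right_mono nonneg) simp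
    moreover have "p 0 * p M * ?c \<le> p 0 * p M * 2" using c pp by (intro mult_left_mono) auto
    ultimately show "0 \<le> p 0 + p M - p 0 * p M * ?c" by linarith
    have "(norm (of_real (p 0) + of_real (p M) * iexp (real M * \<theta>)))\<^sup>2 =
        (p 0 + p M * cos (real M * \<theta>))\<^sup>2 + (p M * sin (real M * \<theta>))\<^sup>2"
      by (simp add: cmod_power2 Re_exp Im_exp)
    also have "\<dots> = (p 0)\<^sup>2 + 2 * p 0 * p M * cos (real M * \<theta>) +
        (p M)\<^sup>2 * ((sin (real M * \<theta>))\<^sup>2 + (cos (real M * \<theta>))\<^sup>2)"
      by algebra
    also have "\<dots> = (p 0 + p M)\<^sup>2 - 2 * (p 0 * p M * ?c)"
      unfolding sin_cos_squared_add by (simp add: power2_eq_square algebra_simps)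
    \<comment> \<open>The factor \<open>p 0 + p M \<le> 1\<close> is inserted so that only the
      square of \<open>p 0 * p M * (1 - cos (real M * \<theta>))\<close> is missing for a perfect
      square.\<close>
    also have "\<dots> \<le> (p 0 + p M)\<^sup>2 - 2 * (p 0 * p M * ?c) * (p 0 + p M)"
      using mult_left_mono[OF s1, of "2 * (p 0 * p M * ?c)"] pp c by simp
    also have "\<dots> \<le> (p 0 + p M - p 0 * p M * ?c)\<^sup>2"
    proof -
      have "X\<^sup>2 - 2 * Y * X \<le> (X - Y)\<^sup>2" for X Y :: real
        by (simp add: power2_eq_square algebra_simps)
      then show ?thesis .
    qed
    finally show "(norm (of_real (p 0) + of_real (p M) * iexp (real M * \<theta>)))\<^sup>2 \<le>
        (p 0 + p M - p 0 * p M * ?c)\<^sup>2" .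
  qed
  ultimately have "norm (cf \<theta>) \<le> 1 + (- (p 0 * p M * (1 - cos (real M * \<theta>))))"
    using norm_triangle_sub[of "cf \<theta>" "of_real (p 0) + of_real (p M) * iexp (real M * \<theta>)"] by linarith
  also have "\<dots> \<le> exp (- (p 0 * p M * (1 - cos (real M * \<theta>))))" by (rule exp_ge_add_one_self)
  finally show ?thesis .
qed

text \<open>Both bases have norm at most 1, so taking powers multiplies their distance by at most
  \<open>n\<close>. First order suffices on arcs so short that the integrand stays close to 1, see
  \<open>arc_near_length\<close>.\<close>

lemma norm_cf_power_linear:
  "norm (cf \<theta> ^ n - iexp (mom 1 * \<theta>) ^ n) \<le> real n * (\<theta>\<^sup>2 / 2 * (mom 2 + (mom 1)\<^sup>2))"
proof -
  have "norm (cf \<theta> - (1 + \<i> * \<theta> * mom 1)) \<le> \<theta>\<^sup>2 / 2 * mom 2"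
    using cf_approx[of \<theta> 1] total by (simp add: mom_def numeral_2_eq_2)
  moreover have "norm (iexp (mom 1 * \<theta>) - (1 + \<i> * \<theta> * mom 1)) \<le> \<theta>\<^sup>2 / 2 * (mom 1)\<^sup>2"
    using iexp_approx1[of "mom 1 * \<theta>" 1] by (simp add: numeral_2_eq_2 algebra_simps)
  ultimately have "norm (cf \<theta> - iexp (mom 1 * \<theta>)) \<le> \<theta>\<^sup>2 / 2 * (mom 2 + (mom 1)\<^sup>2)"
    unfolding ring_distribs
    using norm_triangle_ineq4[of "cf \<theta> - (1 + \<i> * \<theta> * mom 1)" "iexp (mom 1 * \<theta>) - (1 + \<i> * \<theta> * mom 1)"]
    by simp
  then have "real n * norm (cf \<theta> - iexp (mom 1 * \<theta>)) \<le> real n * (\<theta>\<^sup>2 / 2 * (mom 2 + (mom 1)\<^sup>2))"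
    by (intro mult_left_mono) auto
  moreover have "norm (cf \<theta> ^ n - iexp (mom 1 * \<theta>) ^ n) \<le> real n * norm (cf \<theta> - iexp (mom 1 * \<theta>))"
    by (intro norm_power_diff norm_cf_le_1) simp
  ultimately show ?thesis by linarith
qed

text \<open>The exponent carries the second moment in place of the variance, and the discrepancy of
  order \<open>(mom 1)\<^sup>2 * \<theta>\<^sup>2\<close> goes into the error. In the application
  \<open>mom 1\<close> is \<open>2 * m / n\<close> and \<open>\<theta>\<close> has order
  \<open>1 / sqrt m\<close>, so \<open>n\<close> times the discrepancy has the vanishing order
  \<open>m / n\<close>.\<close>

lemma norm_cf_power_quadratic:
  fixes \<theta> :: real
  defines "w \<equiv> \<i> * \<theta> * mom 1 - \<theta>\<^sup>2 / 2 * mom 2"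
  shows "norm (cf \<theta> ^ n - exp w ^ n) \<le>
    real n * (\<bar>\<theta>\<bar> ^ 3 / 6 * mom 3 + exp (\<theta>\<^sup>2 / 2 * mom 2) * (\<bar>\<theta>\<bar> * mom 1 + \<theta>\<^sup>2 / 2 * mom 2)\<^sup>2)"
proof -
  have "norm (cf \<theta> - (1 + w)) \<le> \<bar>\<theta>\<bar> ^ 3 / 6 * mom 3"
    using cf_approx[of \<theta> 2] total
    by (simp add: mom_def numeral_2_eq_2 numeral_3_eq_3 fact_numeral w_def algebra_simps)
  moreover have Re: "Re w = - (\<theta>\<^sup>2 / 2 * mom 2)" by (simp add: w_def power2_eq_square)
  have "norm w \<le> \<bar>\<theta>\<bar> * mom 1 + \<theta>\<^sup>2 / 2 * mom 2"
    unfolding w_def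
    by (rule order_trans[OF norm_triangle_ineq4]) (simp add: norm_mult norm_power norm_divide mom_nonneg)
  then have "exp \<bar>Re w\<bar> * (norm w)\<^sup>2 \<le> exp (\<theta>\<^sup>2 / 2 * mom 2) * (\<bar>\<theta>\<bar> * mom 1 + \<theta>\<^sup>2 / 2 * mom 2)\<^sup>2"
    unfolding Re by (intro mult_mono power_mono) (auto simp: mom_nonneg)
  then have "norm (exp w - (1 + w)) \<le> exp (\<theta>\<^sup>2 / 2 * mom 2) * (\<bar>\<theta>\<bar> * mom 1 + \<theta>\<^sup>2 / 2 * mom 2)\<^sup>2"
    using Taylor_exp[of w 1] by (simp add: numeral_2_eq_2)
  ultimately have "norm (cf \<theta> - exp w) \<le>
      \<bar>\<theta>\<bar> ^ 3 / 6 * mom 3 + exp (\<theta>\<^sup>2 / 2 * mom 2) * (\<bar>\<theta>\<bar> * mom 1 + \<theta>\<^sup>2 / 2 * mom 2)\<^sup>2"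
    using norm_triangle_ineq4[of "cf \<theta> - (1 + w)" "exp w - (1 + w)"] by simp
  then have "real n * norm (cf \<theta> - exp w) \<le>
    real n * (\<bar>\<theta>\<bar> ^ 3 / 6 * mom 3 + exp (\<theta>\<^sup>2 / 2 * mom 2) * (\<bar>\<theta>\<bar> * mom 1 + \<theta>\<^sup>2 / 2 * mom 2)\<^sup>2)"
    by (intro mult_left_mono) auto
  moreover have "norm (cf \<theta> ^ n - exp w ^ n) \<le> real n * norm (cf \<theta> - exp w)"
    using Re mom_nonneg[of 2] by (intro norm_power_diff norm_cf_le_1) simp
  ultimately show ?thesis by linarith
qed

end

section \<open>The saddle point\<close>

lemma fps_conv_radius_cong_norm:
  fixes f :: "'a :: {banach, real_normed_field} fps" and g :: "'b :: {banach, real_normed_field} fps"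
  assumes "\<And>d. norm (fps_nth f d) = norm (fps_nth g d)"
  shows "fps_conv_radius f = fps_conv_radius g"
  unfolding fps_conv_radius_norm[of f, symmetric] fps_conv_radius_norm[of g, symmetric] assms ..

lemma mu_properties:
  assumes "\<exists>d\<ge>j. \<delta> d > 0"
  shows "j \<le> \<mu> \<delta> j" and "\<delta> (\<mu> \<delta> j) > 0"
  using LeastI_ex[of "\<lambda>d. j \<le> d \<and> \<delta> d > 0"] assms by (auto simp: \<mu>_def)

lemma zero_below_mu:
  assumes "\<And>d. \<delta> d \<ge> (0::real)" and "j \<le> d" and "d < \<mu> \<delta> j"
  shows "\<delta> d = 0"
  using not_less_Least[of d "\<lambda>d. j \<le> d \<and> \<delta> d > 0"] assms by (simp add: \<mu>_def order.antisym not_less)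

locale degree_weights =
  fixes \<delta> :: "nat \<Rightarrow> real"
  assumes nonneg: "\<And>d. \<delta> d \<ge> 0" and pos0: "\<delta> 0 > 0" and ex_pos: "\<exists>d\<ge>1. \<delta> d > 0"
    and radius_pos: "fps_conv_radius (degree_gf \<delta> :: real fps) > 0"
begin

definition M :: nat where "M = \<mu> \<delta> 1"

abbreviation "R \<equiv> fps_conv_radius (degree_gf \<delta> :: real fps)"

text \<open>The operator \<open>x * d/dx\<close> applied \<open>j\<close> times to the generating
  function, see \<open>moment_gf_Suc\<close>.\<close>

definition moment_gf :: "nat \<Rightarrow> real fps" where
  "moment_gf j = Abs_fps (\<lambda>d. real d ^ j * (\<delta> d / fact d))"

definition S :: "nat \<Rightarrow> real \<Rightarrow> real" where "S j = eval_fps (moment_gf j)"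

text \<open>The Boltzmann distribution of a degree with parameter \<open>x\<close>. Its moments are
  \<open>S j x / S 0 x\<close>, so the saddle point equation prescribes its mean.\<close>

definition law :: "real \<Rightarrow> nat \<Rightarrow> real" where "law x d = \<delta> d / fact d * x ^ d / S 0 x"

lemma M_pos: "M > 0" and delta_M_pos: "\<delta> M > 0"
  using mu_properties[OF ex_pos] by (auto simp: M_def)

lemma moment_gf_0: "moment_gf 0 = degree_gf \<delta>"
  by (simp add: moment_gf_def degree_gf_def)

lemma moment_gf_Suc: "moment_gf (Suc j) = fps_X * fps_deriv (moment_gf j)"
proof (rule fps_ext)
  fix d show "fps_nth (moment_gf (Suc j)) d = fps_nth (fps_X * fps_deriv (moment_gf j)) d"
    by (cases d) (simp_all add: moment_gf_def)
qed

lemma radius_moment_gf: "R \<le> fps_conv_radius (moment_gf j)"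
proof (induction j)
  case (Suc j)
  have "R \<le> fps_conv_radius (fps_deriv (moment_gf j))"
    using Suc fps_conv_radius_deriv order.trans by blast
  then show ?case
    unfolding moment_gf_Suc using fps_conv_radius_mult[of "fps_X :: real fps" "fps_deriv (moment_gf j)"]
    by (simp add: min_def split: if_splits)
qed (simp add: moment_gf_0)

lemma radius_complex: "fps_conv_radius (degree_gf \<delta> :: complex fps) = R"
  by (rule fps_conv_radius_cong_norm) (simp add: degree_gf_def norm_divide)

lemma S_sums:
  assumes "0 \<le> x" and "ereal x < R"
  shows "(\<lambda>d. real d ^ j * (\<delta> d / fact d) * x ^ d) sums S j x"
  using sums_eval_fps[of x "moment_gf j"] radius_moment_gf[of j] assms
  unfolding S_def by (simp add: moment_gf_def order.strict_trans2)

lemma S0_ge: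
  assumes "0 \<le> x" and "ereal x < R"
  shows "\<delta> 0 + \<delta> M / fact M * x ^ M \<le> S 0 x"
proof -
  have "(\<Sum>d\<in>{0, M}. \<delta> d / fact d * x ^ d) \<le> (\<Sum>d. \<delta> d / fact d * x ^ d)"
    using S_sums[OF assms, of 0] nonneg assms(1)
    by (intro sum_le_suminf) (auto simp: sums_iff)
  then show ?thesis using S_sums[OF assms, of 0] M_pos by (simp add: sums_iff)
qed

lemma S0_pos: "0 \<le> x \<Longrightarrow> ereal x < R \<Longrightarrow> S 0 x > 0"
  using S0_ge[of x] pos0 nonneg[of M]
  by (meson add_pos_nonneg divide_nonneg_pos fact_gt_zero less_le_trans mult_nonneg_nonneg zero_le_power)

text \<open>All terms except the constant one carry a factor \<open>real d \<ge> 1\<close> in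
  \<open>S 1\<close>. This controls \<open>S 0\<close> before anything is known about the size of
  \<open>x\<close>.\<close>

lemma S1_ge:
  assumes "0 \<le> x" and "ereal x < R"
  shows "S 0 x - \<delta> 0 \<le> S 1 x"
proof -
  have 1: "(\<lambda>d. \<delta> d / fact d * x ^ d - (if d = 0 then \<delta> 0 else 0)) sums (S 0 x - \<delta> 0)"
    using S_sums[OF assms, of 0] sums_single[of 0 "\<lambda>_. \<delta> 0"] by (intro sums_diff) auto
  have 2: "\<delta> d / fact d * x ^ d - (if d = 0 then \<delta> 0 else 0) \<le> real d ^ 1 * (\<delta> d / fact d) * x ^ d" for d
  proof (cases d)
    case (Suc d')
    have "1 * (\<delta> d / fact d * x ^ d) \<le> real d * (\<delta> d / fact d * x ^ d)"
      using Suc nonneg[of d] assms(1) by (intro mult_right_mono) auto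
    then show ?thesis using Suc by simp
  qed simp
  show ?thesis by (rule sums_le[OF 2 1 S_sums[OF assms, of 1]])
qed

lemma nat_distribution_law:
  assumes "0 < x" and "ereal x < R"
  shows "nat_distribution (law x)"
proof
  have x: "0 \<le> x" using assms by simp
  show "law x d \<ge> 0" for d
    using S0_pos[OF x assms(2)] nonneg[of d] x by (simp add: law_def)
  have *: "(\<lambda>d. real d ^ j * law x d) sums (S j x / S 0 x)" for j
    using sums_divide[OF S_sums[OF x assms(2), of j], of "S 0 x"] by (simp add: law_def mult_ac)
  show "summable (\<lambda>d. real d ^ j * law x d)" for j using * by (rule sums_summable)
  show "suminf (law x) = 1"
    using *[of 0] S0_pos[OF x assms(2)] by (simp add: sums_iff)
qed

lemma mom_law:
  assumes "0 < x" and "ereal x < R"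
  shows "nat_distribution.mom (law x) j = S j x / S 0 x"
  unfolding nat_distribution.mom_def[OF nat_distribution_law[OF assms]]
  using sums_divide[OF S_sums[of x j], of "S 0 x"] assms by (simp add: law_def sums_iff mult_ac)

lemma cf_law:
  assumes "0 < x" and "ereal x < R"
  shows "nat_distribution.cf (law x) \<theta> =
    eval_fps (degree_gf \<delta>) (of_real x * exp (\<i> * of_real \<theta>)) / of_real (S 0 x)"
proof -
  have "(\<lambda>d. fps_nth (degree_gf \<delta>) d * (of_real x * exp (\<i> * of_real \<theta>)) ^ d) sums
      eval_fps (degree_gf \<delta>) (of_real x * exp (\<i> * of_real \<theta>))"
    using assms by (intro sums_eval_fps) (simp add: norm_mult radius_complex)
  from sums_divide[OF this, of "of_real (S 0 x)"] show ?thesis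
    unfolding nat_distribution.cf_def[OF nat_distribution_law[OF assms]]
    by (simp add: law_def degree_gf_def power_mult_distrib exp_of_nat_mult[symmetric] sums_iff mult_ac)
qed

lemma tendsto_S0: "(S 0 \<longlongrightarrow> \<delta> 0) (at_right 0)"
proof -
  have "continuous (at 0 within {0<..}) (eval_fps (moment_gf 0))"
    using radius_pos by (intro continuous_eval_fps) (simp add: moment_gf_0 zero_ereal_def)
  then show ?thesis by (simp add: continuous_within S_def eval_fps_at_0 moment_gf_def)
qed

lemma eventually_less_R: "\<forall>\<^sub>F x in at_right (0::real). ereal x < R"
proof -
  obtain r where r: "0 < r" "ereal r < R"
    using radius_pos ereal_dense2[of 0 R] by (auto simp: zero_ereal_def)
  have "\<forall>\<^sub>F x in at_right 0. x < r" using r(1) by (rule eventually_at_right_real[THEN eventually_mono]) auto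
  then show ?thesis
    by eventually_elim (use r(2) in \<open>meson ereal_less_eq(3) le_less_trans less_imp_le\<close>)
qed

text \<open>For \<open>j > 0\<close> the factor \<open>real d ^ j\<close> removes the constant term,
  so the leading exponent is \<open>M\<close>; dividing by \<open>x ^ M\<close> leaves a power
  series that is continuous at 0.\<close>

lemma tendsto_S:
  assumes "j > 0"
  shows "((\<lambda>x. S j x / x ^ M) \<longlongrightarrow> real M ^ j * (\<delta> M / fact M)) (at_right 0)"
proof -
  have ne: "fps_nth (moment_gf j) M \<noteq> 0"
    using M_pos delta_M_pos by (simp add: moment_gf_def)
  have "fps_nth (moment_gf j) d = 0" if "d < M" for d
    using zero_below_mu[of \<delta> 1 d] that assms nonneg by (cases d) (auto simp: moment_gf_def M_def)
  then have sub: "M \<le> subdegree (moment_gf j)"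
    using ne by (intro subdegree_geI) (auto simp: fps_eq_iff)
  have R0: "0 < fps_conv_radius (moment_gf j)" using radius_pos radius_moment_gf[of j] by simp
  then have "continuous (at 0 within {0<..}) (eval_fps (fps_shift M (moment_gf j)))"
    by (intro continuous_eval_fps) (simp add: zero_ereal_def)
  then have "(eval_fps (fps_shift M (moment_gf j)) \<longlongrightarrow> real M ^ j * (\<delta> M / fact M)) (at_right 0)"
    by (simp add: continuous_within eval_fps_at_0 moment_gf_def)
  moreover have "\<forall>\<^sub>F x in at_right 0. eval_fps (fps_shift M (moment_gf j)) x = S j x / x ^ M"
    using eventually_less_R eventually_at_right_less
  proof eventually_elim
    case (elim x)
    then have "ereal (norm x) < fps_conv_radius (moment_gf j)"
      using radius_moment_gf[of j] by (auto intro: less_le_trans)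
    then show ?case using eval_fps_shift[OF sub] elim by (simp add: S_def)
  qed
  ultimately show ?thesis by (simp add: tendsto_cong)
qed

end

section \<open>Size of the saddle point and moments of the degree law\<close>

locale saddle_point = degree_weights +
  fixes \<rho> :: "nat \<Rightarrow> real" and m :: "nat \<Rightarrow> nat"
  assumes rho: "\<forall>\<^sub>F n in sequentially. \<rho> n > 0 \<and> ereal (\<rho> n) < R"
    and saddle: "\<forall>\<^sub>F n in sequentially. real n * (S 1 (\<rho> n) / S 0 (\<rho> n)) = 2 * real (m n)"
    and m_pos: "\<forall>\<^sub>F n in sequentially. m n > 0"
    and m_small: "(\<lambda>n. real (m n) / real n) \<longlonglongrightarrow> 0"
begin

text \<open>An a priori bound, from which the convergence of \<open>\<rho>\<close> to 0 is deduced.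
  Once \<open>m / n < 1 / 4\<close>, the saddle point equation makes \<open>S 1\<close> at most half
  of \<open>S 0\<close>. With \<open>S1_ge\<close> this gives
  \<open>S 0 \<le> 2 * \<delta> 0\<close>, and the term of degree \<open>M\<close> is at most
  \<open>S 0 - \<delta> 0 \<le> S 1\<close>.\<close>

lemma rho_power_le:
  "\<forall>\<^sub>F n in sequentially. \<delta> M / fact M * \<rho> n ^ M \<le> 4 * \<delta> 0 * (real (m n) / real n)"
proof -
  have "\<forall>\<^sub>F n in sequentially. real (m n) / real n < 1 / 4"
    by (rule order_tendstoD(2)[OF m_small]) simp
  with rho saddle show ?thesis
    using eventually_gt_at_top[of 0]
  proof eventually_elim
    case (elim n)
    let ?y = "real (m n) / real n"
    have x: "0 \<le> \<rho> n" "ereal (\<rho> n) < R" using elim by auto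
    note S0 = S0_pos[OF x]
    have S1: "S 1 (\<rho> n) = 2 * ?y * S 0 (\<rho> n)" using elim(2,4) S0 by (simp add: field_simps)
    have "?y * S 0 (\<rho> n) \<le> 1 / 4 * S 0 (\<rho> n)" using elim S0 by (intro mult_right_mono) auto
    then have "S 0 (\<rho> n) \<le> 2 * \<delta> 0" using S1_ge[OF x] S1 by linarith
    then have "2 * ?y * S 0 (\<rho> n) \<le> 2 * ?y * (2 * \<delta> 0)" by (intro mult_left_mono) auto
    moreover have "2 * ?y * (2 * \<delta> 0) = 4 * \<delta> 0 * ?y" by simp
    ultimately show ?case using S0_ge[OF x] S1_ge[OF x] S1 by linarith
  qed
qed

lemma rho_tendsto_0: "\<rho> \<longlonglongrightarrow> 0"
proof -
  have lim: "(\<lambda>n. 4 * \<delta> 0 * (real (m n) / real n) / (\<delta> M / fact M)) \<longlonglongrightarrow> 0"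
    by (rule tendsto_eq_intros m_small | simp)+ (use delta_M_pos in auto)
  have upper: "\<forall>\<^sub>F n in sequentially. \<rho> n ^ M \<le> 4 * \<delta> 0 * (real (m n) / real n) / (\<delta> M / fact M)"
    using rho_power_le
  proof eventually_elim
    case (elim n)
    have "0 < \<delta> M / fact M" using delta_M_pos by simp
    with elim show ?case by (simp only: pos_le_divide_eq mult.commute)
  qed
  have lower: "\<forall>\<^sub>F n in sequentially. 0 \<le> \<rho> n ^ M" using rho by eventually_elim simp
  have "(\<lambda>n. \<rho> n ^ M) \<longlonglongrightarrow> 0" by (rule tendsto_sandwich[OF lower upper tendsto_const lim])
  then have "(\<lambda>n. root M (\<rho> n ^ M)) \<longlonglongrightarrow> root M 0" by (rule tendsto_real_root)
  moreover have "\<forall>\<^sub>F n in sequentially. root M (\<rho> n ^ M) = \<rho> n"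
    using rho by eventually_elim (use M_pos in \<open>simp add: real_root_power_cancel\<close>)
  ultimately show ?thesis by (simp add: tendsto_cong)
qed

lemma rho_at_right: "filterlim \<rho> (at_right 0) sequentially"
  unfolding filterlim_at using rho_tendsto_0 rho by (auto elim: eventually_mono)

lemma tendsto_S0_rho: "(\<lambda>n. S 0 (\<rho> n)) \<longlonglongrightarrow> \<delta> 0"
  using filterlim_compose[OF tendsto_S0 rho_at_right] .

lemma tendsto_S_rho: "j > 0 \<Longrightarrow> (\<lambda>n. S j (\<rho> n) / \<rho> n ^ M) \<longlonglongrightarrow> real M ^ j * (\<delta> M / fact M)"
  using filterlim_compose[OF tendsto_S rho_at_right] .

text \<open>By the saddle point equation, \<open>n / (m * S 0) = 2 / S 1\<close>.\<close>

lemma tendsto_scaled: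
  assumes "(\<lambda>n. f n / \<rho> n ^ M) \<longlonglongrightarrow> L"
  shows "(\<lambda>n. real n * (f n / S 0 (\<rho> n)) / real (m n)) \<longlonglongrightarrow> 2 * L / (real M * (\<delta> M / fact M))"
proof -
  have "(\<lambda>n. 2 * (f n / \<rho> n ^ M) / (S 1 (\<rho> n) / \<rho> n ^ M)) \<longlonglongrightarrow> 2 * L / (real M ^ 1 * (\<delta> M / fact M))"
    using M_pos delta_M_pos by (intro tendsto_intros assms tendsto_S_rho) auto
  moreover have "\<forall>\<^sub>F n in sequentially. 2 * (f n / \<rho> n ^ M) / (S 1 (\<rho> n) / \<rho> n ^ M) =
      real n * (f n / S 0 (\<rho> n)) / real (m n)"
    using rho saddle m_pos
  proof eventually_elim
    case (elim n)
    then have S0: "S 0 (\<rho> n) > 0" by (intro S0_pos) auto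
    have n: "real n \<noteq> 0" using elim by (cases "n = 0") auto
    then have S1: "S (Suc 0) (\<rho> n) = 2 * real (m n) * S 0 (\<rho> n) / real n"
      using elim S0 by (simp add: field_simps)
    show ?case using elim S0 n by (simp add: S1 field_simps)
  qed
  ultimately show ?thesis by (simp add: tendsto_cong)
qed

text \<open>The moments of a degree at the saddle point: for large \<open>n\<close>,
  \<open>A 1 n\<close> is the mean \<open>2 * m n / n\<close>, and by \<open>tendsto_A\<close> all
  \<open>A j n\<close> with \<open>j > 0\<close> have this order.\<close>

definition A :: "nat \<Rightarrow> nat \<Rightarrow> real" where "A j n = S j (\<rho> n) / S 0 (\<rho> n)"

lemma tendsto_A: "j > 0 \<Longrightarrow> (\<lambda>n. real n * A j n / real (m n)) \<longlonglongrightarrow> 2 * real M ^ (j - 1)"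
  using tendsto_scaled[OF tendsto_S_rho, of j] M_pos delta_M_pos
  by (cases j) (auto simp: A_def)

text \<open>The characteristic function of \<open>law (\<rho> n)\<close>, see
  \<open>good_cf\<close>. It is given by a formula since \<open>law (\<rho> n)\<close> is known to
  be a distribution only for large \<open>n\<close>.\<close>

definition cf :: "nat \<Rightarrow> real \<Rightarrow> complex" where
  "cf n \<theta> = eval_fps (degree_gf \<delta>) (of_real (\<rho> n) * exp (\<i> * of_real \<theta>)) / of_real (S 0 (\<rho> n))"

text \<open>What holds for all large \<open>n\<close> is collected here, so that later estimates can
  be stated for a single \<open>n\<close>. The constants \<open>1 / M\<close> and
  \<open>3 * M\<close> leave room around the limits \<open>2 / M\<close> and \<open>2 * M\<close> of
  the quotients by \<open>m n\<close>.\<close>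

definition good :: "nat \<Rightarrow> bool" where
  "good n \<longleftrightarrow> \<rho> n > 0 \<and> ereal (\<rho> n) < R \<and> real n * A 1 n = 2 * real (m n) \<and> m n > 0 \<and>
     real (m n) / real M \<le> real n * (law (\<rho> n) 0 * law (\<rho> n) M) \<and>
     real n * A 2 n \<le> 3 * real M * real (m n) \<and> 4 * real (m n) \<le> real n"

lemma eventually_good: "\<forall>\<^sub>F n in sequentially. good n"
proof -
  have "(\<lambda>n. \<delta> 0 / S 0 (\<rho> n) * (real n * (\<delta> M / fact M * \<rho> n ^ M / S 0 (\<rho> n)) / real (m n)))
      \<longlonglongrightarrow> \<delta> 0 / \<delta> 0 * (2 * (\<delta> M / fact M) / (real M * (\<delta> M / fact M)))"
  proof (rule tendsto_mult)
    show "(\<lambda>n. \<delta> 0 / S 0 (\<rho> n)) \<longlonglongrightarrow> \<delta> 0 / \<delta> 0"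
      using pos0 by (intro tendsto_divide tendsto_const tendsto_S0_rho) simp
    have "\<forall>\<^sub>F n in sequentially. \<delta> M / fact M * \<rho> n ^ M / \<rho> n ^ M = \<delta> M / fact M"
      using rho by eventually_elim simp
    then show "(\<lambda>n. real n * (\<delta> M / fact M * \<rho> n ^ M / S 0 (\<rho> n)) / real (m n))
        \<longlonglongrightarrow> 2 * (\<delta> M / fact M) / (real M * (\<delta> M / fact M))"
      by (intro tendsto_scaled tendsto_eventually)
  qed
  then have "(\<lambda>n. \<delta> 0 / S 0 (\<rho> n) * (real n * (\<delta> M / fact M * \<rho> n ^ M / S 0 (\<rho> n)) / real (m n)))
      \<longlonglongrightarrow> 2 / real M"
    using pos0 delta_M_pos by simp
  moreover have "1 / real M < 2 / real M" using M_pos by (simp add: divide_strict_right_mono)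
  ultimately have 1: "\<forall>\<^sub>F n in sequentially. 1 / real M <
      \<delta> 0 / S 0 (\<rho> n) * (real n * (\<delta> M / fact M * \<rho> n ^ M / S 0 (\<rho> n)) / real (m n))"
    by (rule order_tendstoD(1))
  have "2 * real M ^ (2 - 1) < 3 * real M" using M_pos by simp
  then have 2: "\<forall>\<^sub>F n in sequentially. real n * A 2 n / real (m n) < 3 * real M"
    using tendsto_A[of 2] by (intro order_tendstoD(2)) auto
  have 3: "\<forall>\<^sub>F n in sequentially. real (m n) / real n < 1 / 4"
    by (rule order_tendstoD(2)[OF m_small]) simp
  show ?thesis
    using 1 2 3 rho saddle m_pos eventually_gt_at_top[of 0]
  proof eventually_elim
    case (elim n)
    have "1 / real M < real n * (law (\<rho> n) 0 * law (\<rho> n) M) / real (m n)"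
      using elim(1) by (simp add: law_def mult_ac)
    then have "real (m n) / real M \<le> real n * (law (\<rho> n) 0 * law (\<rho> n) M)"
      using elim(6) by (simp add: pos_less_divide_eq)
    moreover have "real n * A 2 n \<le> 3 * real M * real (m n)"
      using elim(2,6) by (simp add: pos_divide_less_eq)
    moreover have "4 * real (m n) \<le> real n"
      using elim(3,7) by (simp add: pos_divide_less_eq)
    ultimately show ?case using elim(4-6) by (simp add: good_def A_def)
  qed
qed

lemma
  assumes "good n"
  shows good_law: "nat_distribution (law (\<rho> n))"
    and good_cf: "cf n = nat_distribution.cf (law (\<rho> n))"
    and good_mom: "nat_distribution.mom (law (\<rho> n)) j = A j n"
  using assms nat_distribution_law[of "\<rho> n"] cf_law[of "\<rho> n"] mom_law[of "\<rho> n"]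
  by (auto simp: good_def cf_def A_def fun_eq_iff)

lemma norm_cf_power_le:
  assumes "good n"
  shows "norm (cf n \<theta> ^ n) \<le> exp (- (real (m n) / real M * (1 - cos (real M * \<theta>))))"
proof -
  have "norm (cf n \<theta> ^ n) \<le> exp (- (law (\<rho> n) 0 * law (\<rho> n) M * (1 - cos (real M * \<theta>)))) ^ n"
    unfolding norm_power good_cf[OF assms]
    by (intro power_mono nat_distribution.norm_cf_le[OF good_law[OF assms] M_pos]) simp
  also have "\<dots> = exp (- (real n * (law (\<rho> n) 0 * law (\<rho> n) M) * (1 - cos (real M * \<theta>))))"
    by (simp add: exp_of_nat_mult[symmetric] algebra_simps)
  also have "\<dots> \<le> exp (- (real (m n) / real M * (1 - cos (real M * \<theta>))))"
  proof -
    have "real (m n) / real M * (1 - cos (real M * \<theta>)) \<le>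
        real n * (law (\<rho> n) 0 * law (\<rho> n) M) * (1 - cos (real M * \<theta>))"
      by (rule mult_right_mono) (use assms in \<open>simp_all add: good_def\<close>)
    then show ?thesis by simp
  qed
  finally show ?thesis .
qed

lemma continuous_on_cf:
  assumes "good n"
  shows "continuous_on X (cf n)"
proof -
  have "S 0 (\<rho> n) \<noteq> 0" using assms S0_pos[of "\<rho> n"] by (auto simp: good_def)
  then show ?thesis
    unfolding cf_def[abs_def] using assms
    by (intro continuous_intros) (auto simp: good_def norm_mult radius_complex)
qed

section \<open>Integrals over arcs\<close>

text \<open>This is \<open>arc_integral\<close> divided by \<open>S 0 (\<rho> n) ^ n\<close>, so
  that for good \<open>n\<close> the integrand has norm at most 1.\<close>

definition arc :: "nat \<Rightarrow> int \<Rightarrow> real \<Rightarrow> complex" where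
  "arc n N r = integral {-r..r} (\<lambda>\<theta>. cf n \<theta> ^ n / exp (of_int N * \<i> * of_real \<theta>))"

lemma norm_exp_int [simp]: "norm (exp (of_int N * \<i> * of_real \<theta>)) = 1"
  by (simp add: norm_exp_eq_Re)

lemma continuous_on_arc:
  "good n \<Longrightarrow> continuous_on X (\<lambda>\<theta>. cf n \<theta> ^ n / exp (of_int N * \<i> * of_real \<theta>))"
  by (intro continuous_intros continuous_on_cf) auto

lemma arc_integral_eq:
  assumes "good n"
  shows "arc_integral \<delta> n N (\<rho> n) r = of_real (S 0 (\<rho> n) ^ n) * arc n N r"
proof -
  have "S 0 (\<rho> n) \<noteq> 0" using assms S0_pos[of "\<rho> n"] by (auto simp: good_def)
  then show ?thesis
    unfolding arc_integral_def arc_def integral_mult_right[symmetric]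
    by (simp add: cf_def power_divide)
qed

lemma norm_cf_power_le_1: "good n \<Longrightarrow> norm (cf n \<theta> ^ n) \<le> 1"
  using nat_distribution.norm_cf_le_1[OF good_law] by (simp add: good_cf norm_power power_le_one)

lemma norm_arc_le:
  assumes "good n" and "0 \<le> r"
  shows "norm (arc n N r) \<le> 2 * r"
proof -
  have "norm (arc n N r) \<le> 1 * (r - (-r))"
    unfolding arc_def
    by (rule integral_bound)
      (use assms norm_cf_power_le_1 in \<open>auto simp: norm_divide intro!: continuous_on_arc\<close>)
  then show ?thesis using assms(2) by simp
qed

text \<open>The saddle point equation \<open>n * A 1 n = 2 * m n\<close> makes the kernel cancel the
  linear phase exactly, and the remaining second order error is proportional to
  \<open>m n * r\<^sup>2\<close>.\<close>

lemma arc_near_length: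
  assumes "good n" and "0 \<le> r"
  shows "norm (arc n (2 * int (m n)) r - 2 * r) \<le> 2 * r * (2 * real M * real (m n) * r\<^sup>2)"
proof -
  let ?N = "2 * int (m n)"
  have *: "norm (cf n \<theta> ^ n / exp (of_int ?N * \<i> * of_real \<theta>) - 1) \<le> 2 * real M * real (m n) * r\<^sup>2"
    if "\<theta> \<in> {-r..r}" for \<theta>
  proof -
    have A1: "real n * A 1 n = 2 * real (m n)" and A2: "real n * A 2 n \<le> 3 * real M * real (m n)"
      and mn: "4 * real (m n) \<le> real n" "m n > 0" using assms by (auto simp: good_def)
    have eq: "iexp (A 1 n * \<theta>) ^ n = exp (of_int ?N * \<i> * of_real \<theta>)"
    proof -
      have "iexp (A 1 n * \<theta>) ^ n = exp (\<i> * of_real (real n * A 1 n * \<theta>))"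
        by (simp add: exp_of_nat_mult[symmetric] mult_ac)
      then show ?thesis unfolding A1 by (simp add: mult_ac)
    qed
    have "cf n \<theta> ^ n / exp (of_int ?N * \<i> * of_real \<theta>) - 1 =
        (cf n \<theta> ^ n - iexp (A 1 n * \<theta>) ^ n) / exp (of_int ?N * \<i> * of_real \<theta>)"
      unfolding eq by (simp add: field_simps)
    then have "norm (cf n \<theta> ^ n / exp (of_int ?N * \<i> * of_real \<theta>) - 1) =
        norm (cf n \<theta> ^ n - iexp (A 1 n * \<theta>) ^ n)"
      by (simp only: norm_divide norm_exp_int div_by_1)
    also have "\<dots> \<le> real n * (\<theta>\<^sup>2 / 2 * (A 2 n + (A 1 n)\<^sup>2))"
      using nat_distribution.norm_cf_power_linear[OF good_law[OF assms(1)], of \<theta> n]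
      by (simp add: good_cf[OF assms(1)] good_mom[OF assms(1)])
    also have "\<dots> = \<theta>\<^sup>2 / 2 * (real n * A 2 n + real n * A 1 n * A 1 n)"
      by (simp add: power2_eq_square algebra_simps)
    \<comment> \<open>Here \<open>n * A 2 n \<le> 3 * M * m n\<close>, while
      \<open>n * (A 1 n)\<^sup>2 = 2 * m n * A 1 n\<close> is at most
      \<open>m n \<le> M * m n\<close> because \<open>A 1 n \<le> 1 / 2\<close>.\<close>
    also have "\<dots> \<le> r\<^sup>2 / 2 * (4 * real M * real (m n))"
    proof (rule mult_mono)
      have "\<bar>\<theta>\<bar> \<le> r" using that by auto
      then show "\<theta>\<^sup>2 / 2 \<le> r\<^sup>2 / 2" using power_mono[of "\<bar>\<theta>\<bar>" r 2] by simp
      have n: "real n > 0" using mn by simp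
      then have A1': "A 1 n = 2 * real (m n) / real n" using A1 by (simp add: field_simps)
      have "A 1 n \<le> 1 / 2" "0 \<le> A 1 n" unfolding A1' using mn n by (simp_all add: field_simps)
      then have "real n * A 1 n * A 1 n \<le> real (m n)"
        unfolding A1 using mult_left_mono[of "A 1 n" "1 / 2" "2 * real (m n)"] by simp
      moreover have "1 * real (m n) \<le> real M * real (m n)"
        using M_pos by (intro mult_right_mono) auto
      ultimately show "real n * A 2 n + real n * A 1 n * A 1 n \<le> 4 * real M * real (m n)"
        using A2 by linarith
      have "A 2 n \<ge> 0"
        using nat_distribution.mom_nonneg[OF good_law[OF assms(1)], of 2] by (simp add: good_mom[OF assms(1)])
      then show "0 \<le> real n * A 2 n + real n * A 1 n * A 1 n" using \<open>0 \<le> A 1 n\<close> by simp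
    qed auto
    finally show ?thesis by simp
  qed
  have int: "(\<lambda>\<theta>. cf n \<theta> ^ n / exp (of_int ?N * \<i> * of_real \<theta>)) integrable_on {-r..r}"
    by (intro integrable_continuous_interval continuous_on_arc assms)
  have "arc n ?N r - 2 * r = integral {-r..r} (\<lambda>\<theta>. cf n \<theta> ^ n / exp (of_int ?N * \<i> * of_real \<theta>) - 1)"
    using Henstock_Kurzweil_Integration.integral_diff[OF int integrable_const_ivl[of 1]] assms(2)
    by (simp add: arc_def scaleR_conv_of_real)
  also have "norm \<dots> \<le> (2 * real M * real (m n) * r\<^sup>2) * (r - (-r))"
    by (rule integral_bound)
      (use assms * in \<open>auto intro!: continuous_intros continuous_on_cf\<close>)
  finally show ?thesis using assms(2) by (simp add: mult_ac)
qed

lemma concentrated_arc: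
  assumes "concentrated \<delta> N \<rho>" and "0 < r" and "r < pi / 2"
  shows "(\<lambda>n. arc n (N n) pi) \<sim>[sequentially] (\<lambda>n. arc n (N n) r)"
proof -
  let ?s = "\<lambda>n. complex_of_real (S 0 (\<rho> n) ^ n)"
  have "(\<lambda>n. arc_integral \<delta> n (N n) (\<rho> n) pi / ?s n) \<sim>[sequentially]
      (\<lambda>n. arc_integral \<delta> n (N n) (\<rho> n) r / ?s n)"
    using assms by (intro asymp_equiv_intros) (simp add: concentrated_def)
  moreover have "\<forall>\<^sub>F n in sequentially. \<forall>r. arc_integral \<delta> n (N n) (\<rho> n) r / ?s n = arc n (N n) r"
    using eventually_good
  proof eventually_elim
    case (elim n)
    then have "S 0 (\<rho> n) > 0" using S0_pos[of "\<rho> n"] by (auto simp: good_def)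
    then show ?case using elim by (simp add: arc_integral_eq)
  qed
  ultimately show ?thesis
    by (rule_tac asymp_equiv_cong[THEN iffD1, rotated 2]) (auto elim: eventually_mono)
qed

text \<open>If \<open>m\<close> stayed bounded along a subsequence, the integrand would be close to 1 on a short arc,
  so that the integrals over arcs of different lengths would not be equivalent.\<close>

lemma m_at_top:
  assumes "concentrated \<delta> (\<lambda>n. 2 * int (m n)) \<rho>"
  shows "filterlim m at_top sequentially"
proof (rule ccontr)
  assume "\<not> filterlim m at_top sequentially"
  then obtain Z where "\<not> (\<forall>\<^sub>F n in sequentially. Z \<le> m n)" by (auto simp: filterlim_at_top)
  then have freq: "\<exists>\<^sub>F n in sequentially. m n < Z" by (simp add: not_eventually not_le)
  \<comment> \<open>For \<open>m n < Z\<close> this choice makes the error in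
    \<open>arc_near_length\<close> at most half of the length \<open>2 * r\<close>. So the integral
    over the arc of radius \<open>r\<close> has norm at least \<open>r\<close>, that of radius
    \<open>r / 4\<close> at most \<open>r / 2\<close>, and they cannot both be equivalent to the
    full integral.\<close>
  define r where "r = 1 / (4 * (real M * real Z + 1))"
  have r: "0 < r" "r \<le> 1 / 4" "2 * real M * real Z * r \<le> 1 / 2"
    by (auto simp: r_def field_simps add_pos_nonneg)
  have r2: "r < pi / 2" using r pi_gt3 by linarith
  let ?N = "\<lambda>n. 2 * int (m n)"
  have "(\<lambda>n. arc n (?N n) r) \<sim>[sequentially] (\<lambda>n. arc n (?N n) (r / 4))"
  proof (rule asymp_equiv_trans)
    show "(\<lambda>n. arc n (?N n) r) \<sim>[sequentially] (\<lambda>n. arc n (?N n) pi)"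
      using concentrated_arc[OF assms r(1) r2] by (rule asymp_equiv_symI)
    show "(\<lambda>n. arc n (?N n) pi) \<sim>[sequentially] (\<lambda>n. arc n (?N n) (r / 4))"
      using r r2 by (intro concentrated_arc[OF assms]) auto
  qed
  then have "(\<lambda>n. arc n (?N n) r - arc n (?N n) (r / 4)) \<in> o(\<lambda>n. arc n (?N n) (r / 4))"
    by (rule asymp_equiv_imp_diff_smallo)
  then have "\<forall>\<^sub>F n in sequentially. norm (arc n (?N n) r - arc n (?N n) (r / 4)) \<le>
      1 / 2 * norm (arc n (?N n) (r / 4))"
    by (rule landau_o.smallD) simp
  with eventually_good have "\<forall>\<^sub>F n in sequentially. \<not> m n < Z"
  proof eventually_elim
    case (elim n)
    show ?case
    proof
      assume "m n < Z"
      then have "2 * real M * real (m n) * r\<^sup>2 \<le> 2 * real M * real Z * (r * 1)"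
        unfolding power2_eq_square using r by (intro mult_mono) auto
      then have "2 * r * (2 * real M * real (m n) * r\<^sup>2) \<le> 2 * r * (1 / 2)"
        using r by (intro mult_left_mono) auto
      then have "norm (arc n (?N n) r - 2 * r) \<le> r"
        using arc_near_length[OF elim(1) less_imp_le[OF r(1)]] by linarith
      moreover have "norm (2 * complex_of_real r) = 2 * r" using r by (simp add: norm_mult)
      ultimately have "r \<le> norm (arc n (?N n) r)"
        using norm_triangle_sub[of "2 * complex_of_real r" "arc n (?N n) r"]
        by (simp add: norm_minus_commute)
      moreover have "norm (arc n (?N n) (r / 4)) \<le> r / 2"
        using norm_arc_le[OF elim(1), of "r / 4"] r by simp
      moreover have "norm (arc n (?N n) r) \<le> norm (arc n (?N n) (r / 4)) +
          norm (arc n (?N n) r - arc n (?N n) (r / 4))"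
        by (rule norm_triangle_sub)
      ultimately show False using elim(2) r by linarith
    qed
  qed
  with freq show False by (simp add: frequently_def)
qed

section \<open>Gaussian limit on a short arc\<close>

text \<open>On the scale \<open>\<theta> = u / sqrt m\<close> the quantity
  \<open>n * A 2 n * \<theta>\<^sup>2 / 2\<close> converges, namely to \<open>M * u\<^sup>2\<close>.
  A fixed shift \<open>c\<close> of the frequency contributes only the phase
  \<open>c * u / sqrt m\<close>, which tends to 0.\<close>

lemma tendsto_integrand:
  fixes u :: real
  assumes "filterlim m at_top sequentially"
  defines "t \<equiv> \<lambda>n. u / sqrt (real (m n))"
  shows "(\<lambda>n. cf n (t n) ^ n / exp (of_int (2 * int (m n) - c) * \<i> * of_real (t n)))
    \<longlonglongrightarrow> of_real (exp (- real M * u\<^sup>2))"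
proof -
  define w where "w n = \<i> * t n * A 1 n - (t n)\<^sup>2 / 2 * A 2 n" for n
  define B where "B n = real n * (\<bar>t n\<bar> ^ 3 / 6 * A 3 n +
      exp ((t n)\<^sup>2 / 2 * A 2 n) * (\<bar>t n\<bar> * A 1 n + (t n)\<^sup>2 / 2 * A 2 n)\<^sup>2)" for n
  have mlim: "filterlim (\<lambda>n. real (m n)) at_top sequentially"
    using assms(1) by (rule filterlim_compose[OF filterlim_real_sequentially])
  then have sm: "filterlim (\<lambda>n. sqrt (real (m n))) at_top sequentially"
    by (rule filterlim_compose[OF sqrt_at_top])
  have nlim: "filterlim (\<lambda>n. sqrt (real n)) at_top sequentially"
    by (rule filterlim_compose[OF sqrt_at_top filterlim_real_sequentially])
  have t0: "t \<longlonglongrightarrow> 0"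
    unfolding t_def by (rule tendsto_divide_0[OF tendsto_const filterlim_at_top_imp_at_infinity[OF sm]])
  have A2: "(\<lambda>n. real n * A 2 n / real (m n)) \<longlonglongrightarrow> 2 * real M" using tendsto_A[of 2] by simp
  have A3: "(\<lambda>n. real n * A 3 n / real (m n)) \<longlonglongrightarrow> 2 * (real M)\<^sup>2" using tendsto_A[of 3] by simp
  have quad: "\<forall>\<^sub>F n in sequentially. (t n)\<^sup>2 = u\<^sup>2 / real (m n)"
    using m_pos by eventually_elim (simp add: t_def power_divide)
  \<comment> \<open>The error \<open>B\<close> is rewritten through quantities with known limits.
    Its cubic part vanishes with \<open>t n\<close>; with the factor \<open>n\<close> moved inside,
    the square vanishes as \<open>sqrt (m n / n)\<close> and \<open>1 / sqrt n\<close> do.\<close>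
  have "(\<lambda>n. (real n * A 3 n / real (m n)) * u\<^sup>2 * \<bar>t n\<bar> / 6 +
      exp (u\<^sup>2 / 2 * ((real n * A 2 n / real (m n)) / real n)) *
      (2 * \<bar>u\<bar> * sqrt (real (m n) / real n) +
        u\<^sup>2 / 2 * ((real n * A 2 n / real (m n)) / sqrt (real n)))\<^sup>2)
      \<longlonglongrightarrow> 2 * (real M)\<^sup>2 * u\<^sup>2 * \<bar>0\<bar> / 6 + exp (u\<^sup>2 / 2 * 0) * (2 * \<bar>u\<bar> * sqrt 0 + u\<^sup>2 / 2 * 0)\<^sup>2"
    by (intro tendsto_intros A2 A3 t0 m_small tendsto_divide_0[OF A2]
        filterlim_at_top_imp_at_infinity nlim filterlim_real_sequentially) auto
  moreover have "\<forall>\<^sub>F n in sequentially. (real n * A 3 n / real (m n)) * u\<^sup>2 * \<bar>t n\<bar> / 6 +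
      exp (u\<^sup>2 / 2 * ((real n * A 2 n / real (m n)) / real n)) *
      (2 * \<bar>u\<bar> * sqrt (real (m n) / real n) +
        u\<^sup>2 / 2 * ((real n * A 2 n / real (m n)) / sqrt (real n)))\<^sup>2 = B n"
    using eventually_good quad eventually_gt_at_top[of 0]
  proof eventually_elim
    case (elim n)
    have mn: "real (m n) > 0" "real n > 0" using elim by (auto simp: good_def)
    have A1: "A 1 n = 2 * real (m n) / real n"
      using elim mn by (simp add: good_def field_simps)
    have cube: "\<bar>t n\<bar> ^ 3 = (u\<^sup>2 / real (m n)) * \<bar>t n\<bar>"
      using elim(2) by (simp add: numeral_3_eq_3 power2_eq_square)
    have lin: "sqrt (real n) * (\<bar>t n\<bar> * A 1 n) = 2 * \<bar>u\<bar> * sqrt (real (m n) / real n)"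
    proof -
      have "sqrt (real n) * (\<bar>t n\<bar> * A 1 n) =
          2 * \<bar>u\<bar> * (real (m n) / sqrt (real (m n))) * (sqrt (real n) / real n)"
        unfolding t_def A1 by (simp add: abs_divide mult_ac)
      also have "\<dots> = 2 * \<bar>u\<bar> * sqrt (real (m n) / real n)"
        using mn by (simp add: real_sqrt_divide real_div_sqrt field_simps)
      finally show ?thesis .
    qed
    have qu: "sqrt (real n) * ((t n)\<^sup>2 / 2 * A 2 n) =
        u\<^sup>2 / 2 * ((real n * A 2 n / real (m n)) / sqrt (real n))"
      using mn by (simp add: elim(2) field_simps)
    have c: "real n * A 3 n * \<bar>t n\<bar> ^ 3 / 6 = (real n * A 3 n / real (m n)) * u\<^sup>2 * \<bar>t n\<bar> / 6"
      unfolding cube by simp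
    have ex: "(t n)\<^sup>2 / 2 * A 2 n = u\<^sup>2 / 2 * ((real n * A 2 n / real (m n)) / real n)"
      unfolding elim(2) using mn by simp
    have eqB: "B n = real n * A 3 n * \<bar>t n\<bar> ^ 3 / 6 + exp ((t n)\<^sup>2 / 2 * A 2 n) *
        (sqrt (real n) * (\<bar>t n\<bar> * A 1 n) + sqrt (real n) * ((t n)\<^sup>2 / 2 * A 2 n))\<^sup>2"
      unfolding distrib_left[symmetric] power_mult_distrib
      using mn by (simp add: B_def algebra_simps)
    show ?case unfolding eqB lin qu c unfolding ex ..
  qed
  ultimately have B0: "B \<longlonglongrightarrow> 0" by (simp add: tendsto_cong)
  have e: "(\<lambda>n. (cf n (t n) ^ n - exp (w n) ^ n) / exp (of_int (2 * int (m n) - c) * \<i> * of_real (t n)))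
      \<longlonglongrightarrow> 0"
  proof (rule Lim_null_comparison[OF _ B0])
    show "\<forall>\<^sub>F n in sequentially. norm ((cf n (t n) ^ n - exp (w n) ^ n) /
        exp (of_int (2 * int (m n) - c) * \<i> * of_real (t n))) \<le> B n"
      using eventually_good
    proof eventually_elim
      case (elim n)
      have "norm (cf n (t n) ^ n - exp (w n) ^ n) \<le> B n"
        using nat_distribution.norm_cf_power_quadratic[OF good_law[OF elim], of "t n" n]
        by (simp add: good_cf[OF elim] good_mom[OF elim] w_def B_def)
      then show ?case by (simp only: norm_divide norm_exp_int div_by_1)
    qed
  qed
  have "(\<lambda>n. exp (of_real (- (real n * A 2 n / real (m n)) * u\<^sup>2 / 2) + of_int c * \<i> * of_real (t n)))
      \<longlonglongrightarrow> exp (of_real (- (2 * real M) * u\<^sup>2 / 2) + of_int c * \<i> * of_real 0)"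
    by (intro tendsto_intros A2 t0) auto
  moreover have "\<forall>\<^sub>F n in sequentially.
      exp (of_real (- (real n * A 2 n / real (m n)) * u\<^sup>2 / 2) + of_int c * \<i> * of_real (t n)) =
      exp (w n) ^ n / exp (of_int (2 * int (m n) - c) * \<i> * of_real (t n))"
    using eventually_good quad
  proof eventually_elim
    case (elim n)
    have A1: "real n * A 1 n = 2 * real (m n)" using elim by (simp add: good_def)
    have "of_nat n * w n = \<i> * of_real (t n) * of_real (real n * A 1 n) -
        of_real (real n * A 2 n * (t n)\<^sup>2 / 2)"
      by (simp add: w_def algebra_simps)
    also have "\<dots> = of_int (2 * int (m n)) * \<i> * of_real (t n) +
        of_real (- (real n * A 2 n / real (m n)) * u\<^sup>2 / 2)"
      unfolding A1 elim(2) by simp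
    finally have "of_nat n * w n - of_int (2 * int (m n) - c) * \<i> * of_real (t n) =
        of_real (- (real n * A 2 n / real (m n)) * u\<^sup>2 / 2) + of_int c * \<i> * of_real (t n)"
      by (simp add: algebra_simps)
    then show ?case unfolding exp_of_nat_mult[symmetric] exp_diff[symmetric] by (simp only:)
  qed
  ultimately have lim: "(\<lambda>n. exp (w n) ^ n / exp (of_int (2 * int (m n) - c) * \<i> * of_real (t n)))
      \<longlonglongrightarrow> exp (of_real (- (2 * real M) * u\<^sup>2 / 2) + of_int c * \<i> * of_real 0)"
    by (rule Lim_transform_eventually)
  have eq: "exp (of_real (- (2 * real M) * u\<^sup>2 / 2) + of_int c * \<i> * of_real 0) =
      complex_of_real (exp (- real M * u\<^sup>2))"
    by (simp flip: exp_of_real)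
  from tendsto_add[OF e lim] show ?thesis
    unfolding eq diff_divide_distrib diff_add_cancel add_0 .
qed

lemma set_integrable_arc:
  "good n \<Longrightarrow> set_integrable lborel {-r..r} (\<lambda>\<theta>. cf n \<theta> ^ n / exp (of_int N * \<i> * of_real \<theta>))"
  by (intro borel_integrable_atLeastAtMost' continuous_on_arc)

text \<open>For \<open>\<bar>\<theta>\<bar> \<le> 1 / M\<close> the argument
  \<open>M * \<theta>\<close> in \<open>norm_cf_power_le\<close> stays in the range of
  \<open>one_minus_cos_ge\<close>, so one Gaussian dominates the rescaled integrand and dominated
  convergence applies. The factor \<open>sqrt m\<close> is the Jacobian of the rescaling.\<close>

lemma tendsto_arc:
  assumes "filterlim m at_top sequentially"
  shows "(\<lambda>n. of_real (sqrt (real (m n))) * arc n (2 * int (m n) - c) (1 / real M))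
    \<longlonglongrightarrow> of_real (sqrt (pi / real M))"
proof -
  let ?r = "1 / real M"
  define t where "t u n = u / sqrt (real (m n))" for u n
  define f where "f n \<theta> = indicator {-?r..?r} \<theta> *\<^sub>R
    (cf n \<theta> ^ n / exp (of_int (2 * int (m n) - c) * \<i> * of_real \<theta>))" for n \<theta>
  \<comment> \<open>The value 0 at the finitely many other \<open>n\<close> makes the Gaussian bound
    hold for every \<open>n\<close>, as dominated convergence demands.\<close>
  define s where "s n u = (if good n then f n (t u n) else 0)" for n u
  have f_int: "integrable lborel (f n)" if "good n" for n
    using set_integrable_arc[OF that] unfolding f_def[abs_def] set_integrable_def .
  have eq: "of_real (sqrt (real (m n))) * arc n (2 * int (m n) - c) ?r = integral\<^sup>L lborel (s n)"
    if n: "good n" for n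
  proof -
    have m0: "sqrt (real (m n)) > 0" using n by (simp add: good_def)
    have "arc n (2 * int (m n) - c) ?r = integral\<^sup>L lborel (f n)"
      unfolding arc_def f_def[abs_def]
      by (rule set_borel_integral_eq_integral(2)[OF set_integrable_arc[OF n],
          unfolded set_lebesgue_integral_def, symmetric])
    also have "\<dots> = (1 / sqrt (real (m n))) *\<^sub>R (\<integral>u. f n (t u n) \<partial>lborel)"
      using lborel_integral_real_affine[of "1 / sqrt (real (m n))" "f n" 0] m0 by (simp add: t_def)
    also have "(\<lambda>u. f n (t u n)) = s n" using n by (simp add: s_def fun_eq_iff)
    finally show ?thesis using m0 by (simp add: scaleR_conv_of_real)
  qed
  have mlim: "filterlim (\<lambda>n. real (m n)) at_top sequentially"
    using assms by (rule filterlim_compose[OF filterlim_real_sequentially])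
  have sm: "filterlim (\<lambda>n. sqrt (real (m n))) at_top sequentially"
    using mlim by (rule filterlim_compose[OF sqrt_at_top])
  have "(\<lambda>n. integral\<^sup>L lborel (s n)) \<longlonglongrightarrow> (\<integral>u. of_real (exp (- real M * u\<^sup>2)) \<partial>lborel)"
  proof (rule integral_dominated_convergence[where w = "\<lambda>u. exp (- (real M / 18) * (u - 0)\<^sup>2)"])
    show "integrable lborel (\<lambda>u. exp (- (real M / 18) * (u - 0)\<^sup>2))"
      using has_bochner_integral_gaussian[of "real M / 18" 0] M_pos
      by (auto simp: has_bochner_integral_iff)
    show "s n \<in> borel_measurable lborel" for n
    proof (cases "good n")
      case True
      have "f n \<in> borel_measurable borel"
        using borel_measurable_integrable[OF f_int[OF True]] by simp
      moreover have "(\<lambda>u. t u n) \<in> borel_measurable borel" by (simp add: t_def)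
      ultimately have "(\<lambda>u. f n (t u n)) \<in> borel_measurable borel" by (rule measurable_compose[rotated])
      then show ?thesis using True by (simp add: s_def[abs_def])
    qed (simp add: s_def[abs_def])
    show "AE u in lborel. norm (s n u) \<le> exp (- (real M / 18) * (u - 0)\<^sup>2)" for n
    proof (intro AE_I2)
      fix u
      show "norm (s n u) \<le> exp (- (real M / 18) * (u - 0)\<^sup>2)"
      proof (cases "good n \<and> t u n \<in> {-?r..?r}")
        case True
        then have n: "good n" and mn: "real (m n) > 0" by (auto simp: good_def)
        have "\<bar>real M * t u n\<bar> \<le> 4"
          using True M_pos by (auto simp: abs_le_iff field_simps)
        then have "real (m n) / real M * ((real M * t u n)\<^sup>2 / 18) \<le>
            real (m n) / real M * (1 - cos (real M * t u n))"
          by (intro mult_left_mono one_minus_cos_ge) auto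
        moreover have "real (m n) / real M * ((real M * t u n)\<^sup>2 / 18) = real M / 18 * u\<^sup>2"
          using mn M_pos by (simp add: t_def power_mult_distrib power_divide power2_eq_square)
        ultimately have "norm (cf n (t u n) ^ n) \<le> exp (- (real M / 18 * u\<^sup>2))"
          using norm_cf_power_le[OF n, of "t u n"] by (smt (verit) exp_le_cancel_iff)
        moreover have "norm (s n u) = norm (cf n (t u n) ^ n)"
          using True by (simp only: s_def f_def if_True norm_scaleR norm_divide norm_exp_int indicator_simps)
        ultimately show ?thesis by simp
      qed (auto simp: s_def f_def)
    qed
    show "AE u in lborel. (\<lambda>n. s n u) \<longlonglongrightarrow> of_real (exp (- real M * u\<^sup>2))"
    proof (intro AE_I2)
      fix u
      have "(\<lambda>n. t u n) \<longlonglongrightarrow> 0"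
        unfolding t_def by (rule tendsto_divide_0[OF tendsto_const filterlim_at_top_imp_at_infinity[OF sm]])
      then have "\<forall>\<^sub>F n in sequentially. dist (t u n) 0 < ?r"
        using M_pos by (intro tendstoD) auto
      with eventually_good have "\<forall>\<^sub>F n in sequentially.
          cf n (t u n) ^ n / exp (of_int (2 * int (m n) - c) * \<i> * of_real (t u n)) = s n u"
      proof eventually_elim
        case (elim n)
        then have "t u n \<in> {-?r..?r}" by auto
        then show ?case using elim by (simp add: s_def f_def)
      qed
      with tendsto_integrand[OF assms, of u c] show "(\<lambda>n. s n u) \<longlonglongrightarrow> of_real (exp (- real M * u\<^sup>2))"
        unfolding t_def by (rule Lim_transform_eventually)
    qed
  qed auto
  moreover have "(\<integral>u. complex_of_real (exp (- real M * u\<^sup>2)) \<partial>lborel) = of_real (sqrt (pi / real M))"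
    using has_bochner_integral_gaussian[of "real M" 0] M_pos
    by (simp add: has_bochner_integral_iff)
  moreover have "\<forall>\<^sub>F n in sequentially. integral\<^sup>L lborel (s n) =
      of_real (sqrt (real (m n))) * arc n (2 * int (m n) - c) ?r"
    using eventually_good by eventually_elim (simp only: eq)
  ultimately show ?thesis using Lim_transform_eventually by fastforce
qed

section \<open>Bounds on the full circle\<close>

text \<open>Around each multiple of \<open>2 * pi / M\<close>, the integrand is bounded by a Gaussian.\<close>

lemma integral_norm_cf_le:
  obtains C where "C > 0" and
    "\<And>n. good n \<Longrightarrow> integral {-pi..pi} (\<lambda>\<theta>. norm (cf n \<theta> ^ n)) \<le> C / sqrt (real (m n))"
proof
  let ?J = "{- int M..int M}"
  \<comment> \<open>Each of the \<open>2 * M + 1\<close> Gaussians has integral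
    \<open>sqrt (pi / a)\<close> over the line, with \<open>a = M * m n / 18\<close>.\<close>
  define C where "C = real (card ?J) * sqrt (18 * pi / real M)"
  have "card ?J > 0" by simp
  then show "C > 0" using M_pos by (simp add: C_def del: card_atLeastAtMost_int)
  fix n assume n: "good n"
  define a where "a = real M * real (m n) / 18"
  have a: "a > 0" using n M_pos by (simp add: a_def good_def)
  let ?g = "\<lambda>j \<theta>. exp (- a * (\<theta> - 2 * pi * of_int j / real M)\<^sup>2)"
  have bound: "norm (cf n \<theta> ^ n) \<le> (\<Sum>j\<in>?J. ?g j \<theta>)" if "\<theta> \<in> {-pi..pi}" for \<theta>
  proof -
    \<comment> \<open>\<open>y\<close> measures \<open>\<theta>\<close> in units of the spacing
      \<open>2 * pi / M\<close> of the peaks, and \<open>j\<close> is the nearest peak. As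
      \<open>y\<close> is within half a unit of it, \<open>M * \<theta>\<close> is congruent modulo
      \<open>2 * pi\<close> to a number in \<open>{-pi..pi}\<close>.\<close>
    define y where "y = real M * \<theta> / (2 * pi)"
    define j where "j = round y"
    have j1: "\<bar>y - of_int j\<bar> \<le> 1 / 2" using of_int_round_abs_le[of y] by (simp add: j_def abs_minus_commute)
    have y: "\<bar>y\<bar> \<le> real M / 2"
    proof -
      have "real M * \<bar>\<theta>\<bar> \<le> real M * pi" using that by (intro mult_left_mono) auto
      then show ?thesis by (simp add: y_def abs_mult field_simps)
    qed
    have "\<bar>real_of_int j\<bar> \<le> real M / 2 + 1 / 2" using j1 y by linarith
    also have "\<dots> \<le> real M" using M_pos by linarith
    finally have jJ: "j \<in> ?J" by (auto simp: abs_le_iff)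
    have Mt: "real M * \<theta> = 2 * pi * (y - of_int j) + of_int j * (2 * pi)"
      by (simp add: y_def algebra_simps)
    have "cos (real M * \<theta>) = cos (2 * pi * (y - of_int j))"
      unfolding Mt cos_add using sin_int_2pin[of j] cos_int_2pin[of j] by (simp add: mult.commute)
    moreover have "\<bar>2 * pi * (y - of_int j)\<bar> \<le> 4"
    proof -
      have "2 * pi * \<bar>y - of_int j\<bar> \<le> 2 * pi * (1 / 2)" using j1 by (intro mult_left_mono) auto
      moreover have "\<bar>2 * pi * (y - of_int j)\<bar> = 2 * pi * \<bar>y - of_int j\<bar>" by (simp add: abs_mult)
      ultimately show ?thesis using pi_less_4 by linarith
    qed
    ultimately have "(2 * pi * (y - of_int j))\<^sup>2 / 18 \<le> 1 - cos (real M * \<theta>)"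
      using one_minus_cos_ge by metis
    then have "real (m n) / real M * ((2 * pi * (y - of_int j))\<^sup>2 / 18) \<le>
        real (m n) / real M * (1 - cos (real M * \<theta>))"
      by (intro mult_left_mono) auto
    moreover have "2 * pi * (y - of_int j) = real M * (\<theta> - 2 * pi * of_int j / real M)"
      using M_pos by (simp add: y_def field_simps)
    moreover have "real (m n) / real M * ((real M * Z)\<^sup>2 / 18) = a * Z\<^sup>2" for Z
      using M_pos by (simp add: a_def power2_eq_square)
    ultimately have "a * (\<theta> - 2 * pi * of_int j / real M)\<^sup>2 \<le> real (m n) / real M * (1 - cos (real M * \<theta>))"
      by (simp only:)
    then have "norm (cf n \<theta> ^ n) \<le> ?g j \<theta>"
      using norm_cf_power_le[OF n, of \<theta>] by (smt (verit) exp_le_cancel_iff mult_minus_left)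
    also have "\<dots> \<le> (\<Sum>j\<in>?J. ?g j \<theta>)"
      using jJ by (intro member_le_sum) auto
    finally show ?thesis .
  qed
  have "integral {-pi..pi} (?g j) \<le> sqrt (pi / a)" for j
  proof -
    note gauss = has_bochner_integral_gaussian[OF a, of "2 * pi * of_int j / real M"]
    have UNIV: "(?g j has_integral sqrt (pi / a)) UNIV"
      using has_integral_integral_lborel[of "?g j"] gauss by (simp add: has_bochner_integral_iff)
    have "integral {-pi..pi} (?g j) \<le> integral UNIV (?g j)"
    proof (rule integral_subset_le)
      show "?g j integrable_on {-pi..pi}"
        by (intro integrable_continuous_interval continuous_intros) (use M_pos in auto)
      show "?g j integrable_on UNIV" using UNIV by blast
    qed auto
    then show ?thesis using UNIV by (simp add: integral_unique)
  qed
  then have "(\<Sum>j\<in>?J. integral {-pi..pi} (?g j)) \<le> (\<Sum>j\<in>?J. sqrt (pi / a))" by (intro sum_mono)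
  moreover have "integral {-pi..pi} (\<lambda>\<theta>. norm (cf n \<theta> ^ n)) \<le> integral {-pi..pi} (\<lambda>\<theta>. \<Sum>j\<in>?J. ?g j \<theta>)"
    using bound M_pos n
    by (intro integral_le integrable_continuous_interval continuous_intros continuous_on_cf) auto
  moreover have "integral {-pi..pi} (\<lambda>\<theta>. \<Sum>j\<in>?J. ?g j \<theta>) = (\<Sum>j\<in>?J. integral {-pi..pi} (?g j))"
    using M_pos by (intro integral_sum integrable_continuous_interval continuous_intros) auto
  moreover have "(\<Sum>j\<in>?J. sqrt (pi / a)) = C / sqrt (real (m n))"
    by (simp add: C_def a_def real_sqrt_divide real_sqrt_mult field_simps)
  ultimately show "integral {-pi..pi} (\<lambda>\<theta>. norm (cf n \<theta> ^ n)) \<le> C / sqrt (real (m n))" by linarith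
qed

text \<open>Only norms enter, so the estimate is uniform in the frequency \<open>N\<close>. It
  serves to bound the integral itself, with \<open>g = 1\<close>, and to replace a nearly constant
  factor by its limit, with \<open>g\<close> the small difference.\<close>

lemma norm_integral_le_cf:
  assumes n: "good n" and C: "integral {-pi..pi} (\<lambda>\<theta>. norm (cf n \<theta> ^ n)) \<le> C / sqrt (real (m n))"
    and g: "continuous_on {-pi..pi} g" "\<And>\<theta>. norm (g \<theta>) \<le> \<epsilon>"
  shows "norm (of_real (sqrt (real (m n))) *
    integral {-pi..pi} (\<lambda>\<theta>. g \<theta> * (cf n \<theta> ^ n / exp (of_int N * \<i> * of_real \<theta>)))) \<le> \<epsilon> * C"
proof -
  have e: "\<epsilon> \<ge> 0" using g(2)[of 0] norm_ge_zero[of "g 0"] by linarith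
  have "norm (integral {-pi..pi} (\<lambda>\<theta>. g \<theta> * (cf n \<theta> ^ n / exp (of_int N * \<i> * of_real \<theta>)))) \<le>
      integral {-pi..pi} (\<lambda>\<theta>. \<epsilon> * norm (cf n \<theta> ^ n))"
  proof (rule integral_norm_bound_integral)
    show "(\<lambda>\<theta>. g \<theta> * (cf n \<theta> ^ n / exp (of_int N * \<i> * of_real \<theta>))) integrable_on {-pi..pi}"
      by (intro integrable_continuous_interval continuous_on_mult g(1) continuous_on_arc n)
    show "(\<lambda>\<theta>. \<epsilon> * norm (cf n \<theta> ^ n)) integrable_on {-pi..pi}"
      by (intro integrable_continuous_interval continuous_intros continuous_on_cf n)
    fix \<theta>
    show "norm (g \<theta> * (cf n \<theta> ^ n / exp (of_int N * \<i> * of_real \<theta>))) \<le> \<epsilon> * norm (cf n \<theta> ^ n)"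
      unfolding norm_mult norm_divide norm_exp_int div_by_1 by (intro mult_right_mono g(2)) auto
  qed
  also have "\<dots> = \<epsilon> * integral {-pi..pi} (\<lambda>\<theta>. norm (cf n \<theta> ^ n))" by simp
  also have "\<dots> \<le> \<epsilon> * (C / sqrt (real (m n)))" using C e by (intro mult_left_mono)
  finally have "sqrt (real (m n)) * norm (integral {-pi..pi} (\<lambda>\<theta>. g \<theta> * (cf n \<theta> ^ n /
      exp (of_int N * \<i> * of_real \<theta>)))) \<le> sqrt (real (m n)) * (\<epsilon> * (C / sqrt (real (m n))))"
    by (intro mult_left_mono) auto
  then show ?thesis using n by (simp add: norm_mult good_def)
qed

text \<open>Bounding the integrand by its value at 0 shows that the coefficient is at most a constant times
  \<open>\<rho> ^ s * S 0 ^ n / \<rho> ^ N\<close>; the factor \<open>sqrt m\<close> accounts for the decay of \<open>cf\<close> away from 0.\<close>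

definition normalized_coeff :: "complex fps \<Rightarrow> nat \<Rightarrow> nat \<Rightarrow> nat \<Rightarrow> nat \<Rightarrow> complex" where
  "normalized_coeff P s k N n = of_real (sqrt (real (m n))) *
     (of_real (2 * pi) * of_real (\<rho> n) ^ N * fps_nth (P * degree_gf \<delta> ^ (n - k)) N /
       (of_real (\<rho> n) ^ s * of_real (S 0 (\<rho> n)) ^ n))"

text \<open>Cauchy's formula after two rearrangements: \<open>P\<close> is split into
  \<open>z ^ s\<close> and a power series, where the phase of \<open>z ^ s\<close> lowers the
  frequency from \<open>N\<close> to \<open>N - s\<close>; and the power \<open>n - k\<close> of the
  generating function is written as a quotient, so that the full power \<open>n\<close> of
  \<open>cf\<close> appears.\<close>

lemma normalized_coeff_eq_integral:
  fixes P :: "complex fps"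
  assumes P: "R \<le> fps_conv_radius P" and s: "s \<le> subdegree P" and n: "good n" and k: "k \<le> n"
    and nz: "\<And>\<theta>. eval_fps (degree_gf \<delta>) (of_real (\<rho> n) * exp (\<i> * of_real \<theta>)) \<noteq> (0 :: complex)"
  shows "normalized_coeff P s k N n = of_real (sqrt (real (m n))) * integral {-pi..pi} (\<lambda>\<theta>.
    eval_fps (fps_shift s P) (of_real (\<rho> n) * exp (\<i> * of_real \<theta>)) /
      eval_fps (degree_gf \<delta>) (of_real (\<rho> n) * exp (\<i> * of_real \<theta>)) ^ k *
      (cf n \<theta> ^ n / exp (of_int (int N - int s) * \<i> * of_real \<theta>)))"
proof -
  let ?D = "degree_gf \<delta> :: complex fps"
  let ?S = "complex_of_real (S 0 (\<rho> n))" and ?x = "complex_of_real (\<rho> n)"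
  let ?f = "\<lambda>\<theta>. eval_fps (fps_shift s P) (?x * exp (\<i> * of_real \<theta>)) /
      eval_fps ?D (?x * exp (\<i> * of_real \<theta>)) ^ k *
      (cf n \<theta> ^ n / exp (of_int (int N - int s) * \<i> * of_real \<theta>))"
  have x: "\<rho> n > 0" "ereal (\<rho> n) < R" using n by (auto simp: good_def)
  have S: "?S \<noteq> 0" using S0_pos[of "\<rho> n"] x by simp
  have rD: "R \<le> fps_conv_radius (?D ^ (n - k))"
    using fps_conv_radius_power[of ?D "n - k"] by (simp add: radius_complex)
  then have rf: "ereal (\<rho> n) < fps_conv_radius (P * ?D ^ (n - k))"
    using fps_conv_radius_mult[of P "?D ^ (n - k)"] P x(2)
    by (meson less_le_trans min.boundedI)
  have "eval_fps (P * ?D ^ (n - k)) (?x * exp (\<i> * of_real \<theta>)) / exp (of_int (int N) * \<i> * of_real \<theta>) =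
      (?x ^ s * ?S ^ n) * ?f \<theta>" for \<theta>
  proof -
    let ?z = "?x * exp (\<i> * of_real \<theta>)"
    have z: "norm ?z = \<rho> n" "?z \<noteq> 0" using x by (auto simp: norm_mult)
    have 1: "eval_fps (P * ?D ^ (n - k)) ?z = eval_fps P ?z * eval_fps ?D ?z ^ (n - k)"
      using z(1) x P rD
      by (subst eval_fps_mult) (auto simp: eval_fps_power radius_complex intro: less_le_trans)
    have 2: "eval_fps P ?z = ?z ^ s * eval_fps (fps_shift s P) ?z"
      using z x P eval_fps_shift[OF s, of ?z] by (simp add: less_le_trans)
    have 3: "eval_fps ?D ?z ^ (n - k) = ?S ^ n * cf n \<theta> ^ n / eval_fps ?D ?z ^ k"
      using nz[of \<theta>] k S by (simp add: cf_def power_divide power_diff)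
    have 4: "?z ^ s = ?x ^ s * exp (of_int (int s) * \<i> * of_real \<theta>)"
      by (simp add: power_mult_distrib exp_of_nat_mult[symmetric] mult_ac)
    have 5: "exp (of_int (int s) * \<i> * of_real \<theta>) / exp (of_int (int N) * \<i> * of_real \<theta>) =
        1 / exp (of_int (int N - int s) * \<i> * of_real \<theta>)"
      unfolding exp_diff[symmetric] exp_minus_inverse
      by (simp add: field_simps exp_diff[symmetric] exp_add[symmetric])
    have "eval_fps (P * ?D ^ (n - k)) ?z / exp (of_int (int N) * \<i> * of_real \<theta>) =
        ?x ^ s * ?S ^ n * (eval_fps (fps_shift s P) ?z / eval_fps ?D ?z ^ k * (cf n \<theta> ^ n *
        (exp (of_int (int s) * \<i> * of_real \<theta>) / exp (of_int (int N) * \<i> * of_real \<theta>))))"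
      unfolding 1 2 3 4 by simp
    then show ?thesis unfolding 5 by simp
  qed
  then have "integral {-pi..pi} (\<lambda>\<theta>. eval_fps (P * ?D ^ (n - k)) (?x * exp (\<i> * of_real \<theta>)) /
      exp (of_int (int N) * \<i> * of_real \<theta>)) = (?x ^ s * ?S ^ n) * integral {-pi..pi} ?f"
    by (simp only: integral_mult_right)
  then have "of_real (2 * pi) * ?x ^ N * fps_nth (P * ?D ^ (n - k)) N =
      (?x ^ s * ?S ^ n) * integral {-pi..pi} ?f"
    unfolding Cauchy_coefficient_formula[OF x(1) rf] .
  then show ?thesis
    using x S by (simp add: normalized_coeff_def)
qed

text \<open>The factor \<open>q\<close> in front of \<open>cf\<close> converges to its value at 0
  uniformly on the shrinking circles, and \<open>norm_integral_le_cf\<close> shows that the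
  difference contributes a negligible integral.\<close>

lemma normalized_coeff_minus_arc:
  fixes P :: "complex fps"
  assumes P: "R \<le> fps_conv_radius P" and s: "s \<le> subdegree P"
  shows "(\<lambda>n. normalized_coeff P s k (N n) n - fps_nth P s / of_real (\<delta> 0) ^ k *
    (of_real (sqrt (real (m n))) * arc n (int (N n) - int s) pi)) \<longlonglongrightarrow> 0"
proof (rule tendstoI)
  fix \<epsilon> :: real assume \<epsilon>: "\<epsilon> > 0"
  let ?D = "degree_gf \<delta> :: complex fps"
  define L where "L = fps_nth P s / of_real (\<delta> 0) ^ k"
  define q where "q z = eval_fps (fps_shift s P) z / eval_fps ?D z ^ k" for z
  obtain C where C: "C > 0"
    "\<And>n. good n \<Longrightarrow> integral {-pi..pi} (\<lambda>\<theta>. norm (cf n \<theta> ^ n)) \<le> C / sqrt (real (m n))"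
    using integral_norm_cf_le by blast
  have D0: "eval_fps ?D 0 = of_real (\<delta> 0)" by (simp add: eval_fps_at_0 degree_gf_def)
  have R0: "0 < fps_conv_radius P" "0 < fps_conv_radius ?D"
    using radius_pos P by (auto simp: radius_complex)
  have contD: "continuous (at 0) (eval_fps ?D)"
    using R0(2) by (intro continuous_eval_fps) (simp add: zero_ereal_def)
  have "continuous (at 0) (eval_fps (fps_shift s P))"
    using R0(1) by (intro continuous_eval_fps) (simp add: zero_ereal_def)
  then have "continuous (at 0) q"
    unfolding q_def[abs_def] using pos0 D0
    by (intro continuous_divide continuous_power contD) (auto simp: D0)
  moreover have "q 0 = L" using s by (simp add: q_def L_def eval_fps_at_0 degree_gf_def)
  ultimately have "(q \<longlongrightarrow> L) (nhds 0)"
    using tendsto_at_iff_tendsto_nhds[of q 0] by (simp add: continuous_at)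
  then have "\<forall>\<^sub>F z in nhds 0. dist (q z) L < \<epsilon> / (2 * C)"
    using \<epsilon> C(1) by (intro tendstoD) auto
  moreover have "\<forall>\<^sub>F z in nhds 0. eval_fps ?D z \<noteq> 0"
  proof -
    have "(eval_fps ?D \<longlongrightarrow> eval_fps ?D 0) (nhds 0)"
      using contD tendsto_at_iff_tendsto_nhds[of "eval_fps ?D" 0] by (simp add: continuous_at)
    then show ?thesis by (rule tendsto_imp_eventually_ne) (use pos0 D0 in simp)
  qed
  ultimately have "\<forall>\<^sub>F z in nhds 0. dist (q z) L < \<epsilon> / (2 * C) \<and> eval_fps ?D z \<noteq> 0"
    by (rule eventually_conj)
  then obtain d where d: "d > 0" "\<And>z. norm z < d \<Longrightarrow> dist (q z) L < \<epsilon> / (2 * C) \<and> eval_fps ?D z \<noteq> 0"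
    unfolding eventually_nhds_metric by (auto simp: dist_norm)
  have "\<forall>\<^sub>F n in sequentially. \<rho> n < d" using rho_tendsto_0 d(1) by (rule order_tendstoD(2))
  with eventually_good show "\<forall>\<^sub>F n in sequentially. dist (normalized_coeff P s k (N n) n -
      fps_nth P s / of_real (\<delta> 0) ^ k * (of_real (sqrt (real (m n))) * arc n (int (N n) - int s) pi)) 0 < \<epsilon>"
    using eventually_ge_at_top[of k]
  proof eventually_elim
    case (elim n)
    let ?z = "\<lambda>\<theta>. of_real (\<rho> n) * exp (\<i> * of_real \<theta>)"
    let ?F = "\<lambda>\<theta>. cf n \<theta> ^ n / exp (of_int (int (N n) - int s) * \<i> * of_real \<theta>)"
    have x: "\<rho> n > 0" "ereal (\<rho> n) < R" using elim(1) by (auto simp: good_def)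
    have z: "norm (?z \<theta>) = \<rho> n" for \<theta> using x by (simp add: norm_mult)
    have zd: "norm (?z \<theta>) < d" for \<theta> using z elim(2) by simp
    have contq: "continuous_on {-pi..pi} (\<lambda>\<theta>. q (?z \<theta>))"
      unfolding q_def using d(2)[OF zd] z x P
      by (intro continuous_intros) (auto simp: radius_complex intro: less_le_trans)
    have "normalized_coeff P s k (N n) n - L * (of_real (sqrt (real (m n))) * arc n (int (N n) - int s) pi) =
        of_real (sqrt (real (m n))) * (integral {-pi..pi} (\<lambda>\<theta>. q (?z \<theta>) * ?F \<theta>) -
          integral {-pi..pi} (\<lambda>\<theta>. L * ?F \<theta>))"
      unfolding normalized_coeff_eq_integral[OF P s elim(1,3) d(2)[OF zd, THEN conjunct2]] arc_def
        integral_mult_right q_def by (simp add: algebra_simps)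
    also have "integral {-pi..pi} (\<lambda>\<theta>. q (?z \<theta>) * ?F \<theta>) - integral {-pi..pi} (\<lambda>\<theta>. L * ?F \<theta>) =
        integral {-pi..pi} (\<lambda>\<theta>. q (?z \<theta>) * ?F \<theta> - L * ?F \<theta>)"
      by (intro Henstock_Kurzweil_Integration.integral_diff[symmetric] integrable_continuous_interval
          continuous_on_mult contq continuous_on_const continuous_on_arc elim(1))
    also have "(\<lambda>\<theta>. q (?z \<theta>) * ?F \<theta> - L * ?F \<theta>) = (\<lambda>\<theta>. (q (?z \<theta>) - L) * ?F \<theta>)"
      by (simp only: left_diff_distrib)
    also have "norm (of_real (sqrt (real (m n))) * integral {-pi..pi} (\<lambda>\<theta>. (q (?z \<theta>) - L) * ?F \<theta>)) \<le>
        \<epsilon> / (2 * C) * C"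
    proof (rule norm_integral_le_cf[OF elim(1) C(2)[OF elim(1)]])
      show "continuous_on {-pi..pi} (\<lambda>\<theta>. q (?z \<theta>) - L)" by (intro continuous_intros contq)
      show "norm (q (?z \<theta>) - L) \<le> \<epsilon> / (2 * C)" for \<theta>
        using d(2)[OF zd[of \<theta>]] by (simp add: dist_norm)
    qed
    also have "\<dots> < \<epsilon>" using \<epsilon> C(1) by simp
    finally show ?case by (simp add: L_def)
  qed
qed

lemma arc_bounded:
  obtains C where "\<And>n N. good n \<Longrightarrow> norm (of_real (sqrt (real (m n))) * arc n N pi) \<le> C"
proof -
  obtain C where C: "C > 0"
    "\<And>n. good n \<Longrightarrow> integral {-pi..pi} (\<lambda>\<theta>. norm (cf n \<theta> ^ n)) \<le> C / sqrt (real (m n))"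
    using integral_norm_cf_le by blast
  have "norm (of_real (sqrt (real (m n))) * arc n N pi) \<le> 1 * C" if "good n" for n N
    using norm_integral_le_cf[OF that C(2)[OF that], of "\<lambda>_. 1" 1 N] by (simp add: arc_def)
  then show ?thesis using that by auto
qed

lemma tendsto_full_circle:
  assumes "filterlim m at_top sequentially" and "concentrated \<delta> (\<lambda>n. 2 * int (m n) - c) \<rho>"
  shows "(\<lambda>n. of_real (sqrt (real (m n))) * arc n (2 * int (m n) - c) pi)
    \<longlonglongrightarrow> of_real (sqrt (pi / real M))"
proof -
  have "1 / real M \<le> 1" using M_pos by simp
  then have "1 / real M < pi / 2" using pi_gt3 by linarith
  then have "(\<lambda>n. of_real (sqrt (real (m n))) * arc n (2 * int (m n) - c) pi) \<sim>[sequentially]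
      (\<lambda>n. of_real (sqrt (real (m n))) * arc n (2 * int (m n) - c) (1 / real M))"
    using M_pos by (intro asymp_equiv_intros concentrated_arc[OF assms(2)]) auto
  then show ?thesis using tendsto_arc[OF assms(1)] tendsto_asymp_equiv_cong by blast
qed

text \<open>Both coefficients are normalized with the same \<open>sqrt m\<close> and
  \<open>S 0 ^ n\<close>, which cancel. The denominator \<open>Y\<close> has a nonzero limit by
  concentration at \<open>2 * m\<close>. The numerator \<open>X\<close> is bounded by
  \<open>arc_bounded\<close>, and it has a nonzero limit if concentration holds at its own frequency
  \<open>2 * m - (s + 2 * e)\<close>.\<close>

lemma coeff_ratio:
  fixes P :: "complex fps" and s e k :: nat
  assumes P: "R \<le> fps_conv_radius P" and s: "s \<le> subdegree P" and nz: "fps_nth P s \<noteq> 0"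
    and conc: "concentrated \<delta> (\<lambda>n. 2 * int (m n)) \<rho>"
  defines "a \<equiv> \<lambda>n. fps_nth (P * degree_gf \<delta> ^ (n - k)) (2 * m n - 2 * e)"
    and "b \<equiv> \<lambda>n. fps_nth (degree_gf \<delta> ^ n :: complex fps) (2 * m n)"
  shows "\<forall>\<^sub>F n in sequentially. b n \<noteq> 0"
    and "(\<lambda>n. norm (a n / b n)) \<in> O(\<lambda>n. \<rho> n ^ (s + 2 * e))"
    and "concentrated \<delta> (\<lambda>n. 2 * int (m n) - int (s + 2 * e)) \<rho> \<Longrightarrow>
      (\<lambda>n. norm (a n / b n)) \<in> \<Theta>(\<lambda>n. \<rho> n ^ (s + 2 * e))"
proof -
  let ?m = "\<lambda>n. complex_of_real (sqrt (real (m n)))"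
  have mtop: "filterlim m at_top sequentially" by (rule m_at_top[OF conc])
  \<comment> \<open>For such \<open>n\<close> the truncated difference
    \<open>2 * m n - 2 * e\<close> is a true one.\<close>
  have me: "\<forall>\<^sub>F n in sequentially. e \<le> m n" using mtop by (simp add: filterlim_at_top)
  define y where "y = complex_of_real (sqrt (pi / real M))"
  have y: "y \<noteq> 0" using M_pos by (simp add: y_def)
  define X where "X n = normalized_coeff P s k (2 * m n - 2 * e) n" for n
  define Y where "Y n = normalized_coeff 1 0 0 (2 * m n) n" for n
  define L where "L = fps_nth P s / of_real (\<delta> 0) ^ k"
  have L: "L \<noteq> 0" using nz pos0 by (simp add: L_def)
  have Y: "Y \<longlonglongrightarrow> y"
  proof -
    have "(\<lambda>n. (Y n - ?m n * arc n (2 * int (m n)) pi) + ?m n * arc n (2 * int (m n)) pi) \<longlonglongrightarrow> 0 + y"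
    proof (rule tendsto_add)
      show "(\<lambda>n. Y n - ?m n * arc n (2 * int (m n)) pi) \<longlonglongrightarrow> 0"
        using normalized_coeff_minus_arc[of 1 0 0 "\<lambda>n. 2 * m n"] by (simp add: Y_def)
      show "(\<lambda>n. ?m n * arc n (2 * int (m n)) pi) \<longlonglongrightarrow> y"
        using tendsto_full_circle[OF mtop, of 0] conc by (simp add: y_def)
    qed
    then show ?thesis by simp
  qed
  then have Ynz: "\<forall>\<^sub>F n in sequentially. Y n \<noteq> 0" using y by (rule tendsto_imp_eventually_ne)
  then show "\<forall>\<^sub>F n in sequentially. b n \<noteq> 0"
    by eventually_elim (auto simp: Y_def normalized_coeff_def b_def)
  have ratio: "\<forall>\<^sub>F n in sequentially. norm (a n / b n) = norm (X n) / norm (Y n) * \<rho> n ^ (s + 2 * e)"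
    using eventually_good me
  proof eventually_elim
    case (elim n)
    have x: "\<rho> n > 0" "ereal (\<rho> n) < R" and mn: "real (m n) > 0" using elim by (auto simp: good_def)
    have S: "S 0 (\<rho> n) > 0" using S0_pos[of "\<rho> n"] x by simp
    have "X n = a n * (?m n * (of_real (2 * pi)) * of_real (\<rho> n) ^ (2 * m n - 2 * e) /
        (of_real (\<rho> n) ^ s * of_real (S 0 (\<rho> n)) ^ n))"
      by (simp add: X_def normalized_coeff_def a_def)
    moreover have "Y n = b n * (?m n * (of_real (2 * pi)) * of_real (\<rho> n) ^ (2 * m n) / of_real (S 0 (\<rho> n)) ^ n)"
      by (simp add: Y_def normalized_coeff_def b_def)
    \<comment> \<open>The orders of the two coefficients differ by \<open>2 * e\<close>, which
      leaves \<open>\<rho> n ^ (2 * e)\<close> besides the \<open>\<rho> n ^ s\<close> of the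
      normalization.\<close>
    moreover have "complex_of_real (\<rho> n) ^ (2 * m n) =
        of_real (\<rho> n) ^ (2 * m n - 2 * e) * of_real (\<rho> n) ^ (2 * e)"
      using elim(2) by (simp flip: power_add)
    ultimately have "X n / Y n * of_real (\<rho> n) ^ (s + 2 * e) = a n / b n"
      using x S mn by (simp add: power_add)
    then have "norm (a n / b n) = norm (X n / Y n * of_real (\<rho> n) ^ (s + 2 * e))" by simp
    then show ?case using x by (simp add: norm_mult norm_divide norm_power)
  qed
  have \<rho>: "\<forall>\<^sub>F n in sequentially. \<rho> n ^ (s + 2 * e) > 0"
    using rho by eventually_elim simp
  have XL: "(\<lambda>n. X n - L * (?m n * arc n (int (2 * m n - 2 * e) - int s) pi)) \<longlonglongrightarrow> 0"
    using normalized_coeff_minus_arc[OF P s, of k "\<lambda>n. 2 * m n - 2 * e"] by (simp add: X_def L_def)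
  obtain C where C: "\<And>n N. good n \<Longrightarrow> norm (?m n * arc n N pi) \<le> C"
    using arc_bounded by blast
  have "\<forall>\<^sub>F n in sequentially. norm (X n) \<le> 1 + norm L * C"
    using tendstoD[OF XL zero_less_one] eventually_good
  proof eventually_elim
    case (elim n)
    have "norm (L * (?m n * arc n (int (2 * m n - 2 * e) - int s) pi)) \<le> norm L * C"
      unfolding norm_mult[of L] by (intro mult_left_mono C elim) auto
    then show ?case
      using elim(1) norm_triangle_sub[of "X n" "L * (?m n * arc n (int (2 * m n - 2 * e) - int s) pi)"]
      by (simp add: dist_norm)
  qed
  then have XO: "(\<lambda>n. norm (X n)) \<in> O(\<lambda>_. 1)" by (intro bigoI[of _ "1 + norm L * C"]) simp
  have YT: "(\<lambda>n. norm (Y n)) \<in> \<Theta>(\<lambda>_. 1)"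
    using tendsto_norm[OF Y] y by (intro bigthetaI_tendsto[of "norm y"]) auto
  have cong: "(\<lambda>n. norm (a n / b n)) \<in> \<Theta>(\<lambda>n. norm (X n) / norm (Y n) * \<rho> n ^ (s + 2 * e))"
    using ratio by (rule bigthetaI_cong)
  have "(\<lambda>n. norm (X n) / norm (Y n) * \<rho> n ^ (s + 2 * e)) \<in> O(\<lambda>n. 1 / 1 * \<rho> n ^ (s + 2 * e))"
    using YT Ynz by (intro landau_o.big.mult XO landau_o.big.divide) (auto simp: bigtheta_def bigomega_iff_bigo)
  then have "(\<lambda>n. norm (X n) / norm (Y n) * \<rho> n ^ (s + 2 * e)) \<in> O(\<lambda>n. \<rho> n ^ (s + 2 * e))"
    by (simp only: div_by_1 mult_1_left)
  with bigthetaD1[OF cong] show "(\<lambda>n. norm (a n / b n)) \<in> O(\<lambda>n. \<rho> n ^ (s + 2 * e))"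
    by (rule landau_o.big_trans)
  assume shifted: "concentrated \<delta> (\<lambda>n. 2 * int (m n) - int (s + 2 * e)) \<rho>"
  have "(\<lambda>n. ?m n * arc n (int (2 * m n - 2 * e) - int s) pi) \<longlonglongrightarrow> y"
  proof (rule Lim_transform_eventually)
    show "(\<lambda>n. ?m n * arc n (2 * int (m n) - int (s + 2 * e)) pi) \<longlonglongrightarrow> y"
      using tendsto_full_circle[OF mtop shifted] by (simp add: y_def)
    show "\<forall>\<^sub>F n in sequentially. ?m n * arc n (2 * int (m n) - int (s + 2 * e)) pi =
        ?m n * arc n (int (2 * m n - 2 * e) - int s) pi"
      using me
    proof eventually_elim
      case (elim n)
      have "2 * int (m n) - int (s + 2 * e) = int (2 * m n - 2 * e) - int s" using elim by simp
      then show ?case by (simp only:)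
    qed
  qed
  from tendsto_add[OF XL tendsto_mult[OF tendsto_const this, of L]]
  have "X \<longlonglongrightarrow> L * y" by simp
  then have "(\<lambda>n. norm (X n) / norm (Y n)) \<longlonglongrightarrow> norm (L * y) / norm y"
    using Y y by (intro tendsto_intros) auto
  then have "(\<lambda>n. norm (X n) / norm (Y n)) \<in> \<Theta>(\<lambda>_. 1)"
    using L y by (intro bigthetaI_tendsto[of "norm (L * y) / norm y"]) auto
  then have "(\<lambda>n. norm (X n) / norm (Y n) * \<rho> n ^ (s + 2 * e)) \<in> \<Theta>(\<lambda>n. 1 * \<rho> n ^ (s + 2 * e))"
    by (intro landau_theta.mult) auto
  then have "(\<lambda>n. norm (X n) / norm (Y n) * \<rho> n ^ (s + 2 * e)) \<in> \<Theta>(\<lambda>n. \<rho> n ^ (s + 2 * e))"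
    by (simp only: mult_1_left)
  with cong show "(\<lambda>n. norm (a n / b n)) \<in> \<Theta>(\<lambda>n. \<rho> n ^ (s + 2 * e))"
    by (rule landau_theta.bigtheta_trans1)
qed

text \<open>This is \<open>tendsto_scaled\<close> for \<open>\<rho> n ^ M\<close> itself, freed from
  \<open>S 0\<close>, which tends to \<open>\<delta> 0 > 0\<close>.\<close>

lemma rho_power_bigtheta: "(\<lambda>n. \<rho> n ^ M) \<in> \<Theta>(\<lambda>n. real (m n) / real n)"
proof -
  have "(\<lambda>n. real n * (\<rho> n ^ M / S 0 (\<rho> n)) / real (m n)) \<longlonglongrightarrow> 2 * 1 / (real M * (\<delta> M / fact M))"
  proof (intro tendsto_scaled tendsto_eventually)
    show "\<forall>\<^sub>F n in sequentially. \<rho> n ^ M / \<rho> n ^ M = 1"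
      using rho by eventually_elim simp
  qed
  from tendsto_mult[OF this tendsto_S0_rho]
  have "(\<lambda>n. \<rho> n ^ M / (real (m n) / real n)) \<longlonglongrightarrow> 2 * 1 / (real M * (\<delta> M / fact M)) * \<delta> 0"
  proof (rule Lim_transform_eventually)
    show "\<forall>\<^sub>F n in sequentially. real n * (\<rho> n ^ M / S 0 (\<rho> n)) / real (m n) * S 0 (\<rho> n) =
        \<rho> n ^ M / (real (m n) / real n)"
      using rho
    proof eventually_elim
      case (elim n)
      then have "S 0 (\<rho> n) \<noteq> 0" using S0_pos[of "\<rho> n"] by simp
      then show ?case by simp
    qed
  qed
  then show ?thesis
    using M_pos delta_M_pos pos0 m_pos eventually_gt_at_top[of 0]
    by (intro bigthetaI_tendsto[of "2 * 1 / (real M * (\<delta> M / fact M)) * \<delta> 0"]) (auto elim: eventually_elim2)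
qed

end

section \<open>The expected number of copies of a tree\<close>

lemma choose_bigtheta:
  assumes "filterlim f at_top F"
  shows "(\<lambda>n. real (f n choose r)) \<in> \<Theta>[F](\<lambda>n. real (f n) ^ r)"
proof (rule bigthetaI')
  have "\<forall>\<^sub>F n in F. r \<le> f n" using assms by (simp add: filterlim_at_top)
  then show "\<forall>\<^sub>F n in F. 1 / real r ^ r * norm (real (f n) ^ r) \<le> norm (real (f n choose r)) \<and>
      norm (real (f n choose r)) \<le> 1 * norm (real (f n) ^ r)"
  proof eventually_elim
    case (elim n)
    have "(real (f n) / real r) ^ r \<le> real (f n choose r)"
      using binomial_ge_n_over_k_pow_k[OF elim, where 'a=real] by simp
    moreover have "real (f n choose r) \<le> real (f n) ^ r"
      using binomial_le_pow[OF elim] by (metis of_nat_le_iff of_nat_power)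
    ultimately show ?case by (simp add: power_divide)
  qed
  \<comment> \<open>For \<open>r = 0\<close> the constant is \<open>1 / 0 ^ 0 = 1\<close>.\<close>
  show "0 < 1 / real r ^ r" by (cases "r = 0") auto
qed simp

lemma card_copies_bigtheta:
  assumes T: "multigraph T" "vertices T \<noteq> {}" and m: "filterlim m at_top sequentially"
  shows "(\<lambda>n. real (card (copies n (m n) ori T))) \<in>
    \<Theta>(\<lambda>n. real n ^ card (vertices T) * real (m n) ^ card (edges T))"
proof -
  let ?k = "card (vertices T)" and ?e = "card (edges T)"
  have k: "?k > 0" using T by (simp add: multigraph_def card_gt_0_iff)
  have "filterlim (\<lambda>n. ?k ^ 2 * m n) at_top sequentially"
    using m k by (intro filterlim_at_top_mono[OF m]) auto
  from choose_bigtheta[OF this, of ?e]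
  have "(\<lambda>n. real ((?k ^ 2 * m n) choose ?e)) \<in> \<Theta>(\<lambda>n. (real ?k ^ 2) ^ ?e * real (m n) ^ ?e)"
    by (simp add: power_mult_distrib)
  then have "(\<lambda>n. real ((?k ^ 2 * m n) choose ?e)) \<in> \<Theta>(\<lambda>n. real (m n) ^ ?e)"
    using k by simp
  then have U: "(\<lambda>n. real (n choose ?k) * real ((?k ^ 2 * m n) choose ?e)) \<in>
      \<Theta>(\<lambda>n. real n ^ ?k * real (m n) ^ ?e)"
    by (intro landau_theta.mult choose_bigtheta filterlim_ident)
  have L: "(\<lambda>n. real (n choose ?k) * real (m n choose ?e)) \<in> \<Theta>(\<lambda>n. real n ^ ?k * real (m n) ^ ?e)"
    by (intro landau_theta.mult choose_bigtheta filterlim_ident m)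
  show ?thesis
  proof (rule bigthetaI)
    have "(\<lambda>n. real (card (copies n (m n) ori T))) \<in>
        O(\<lambda>n. real (n choose ?k) * real ((?k ^ 2 * m n) choose ?e))"
      using card_copies_le[of _ "m _" ori T]
      by (intro landau_o.big_mono always_eventually allI) (simp flip: of_nat_mult)
    then show "(\<lambda>n. real (card (copies n (m n) ori T))) \<in> O(\<lambda>n. real n ^ ?k * real (m n) ^ ?e)"
      using U by (rule landau_o.big.bigtheta_trans1)
    have "(\<lambda>n. real (card (copies n (m n) ori T))) \<in>
        \<Omega>(\<lambda>n. real (n choose ?k) * real (m n choose ?e))"
      using card_copies_ge[OF T(1), of _ "m _" ori]
      by (intro landau_omega.big_mono always_eventually allI) (simp flip: of_nat_mult)
    then show "(\<lambda>n. real (card (copies n (m n) ori T))) \<in> \<Omega>(\<lambda>n. real n ^ ?k * real (m n) ^ ?e)"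
      using L by (rule landau_omega.big.bigtheta_trans1)
  qed
qed

lemma shifted_gf_Suc: "shifted_gf \<delta> (Suc j) = fps_deriv (shifted_gf \<delta> j)"
proof (rule fps_ext)
  fix d show "fps_nth (shifted_gf \<delta> (Suc j)) d = fps_nth (fps_deriv (shifted_gf \<delta> j) :: 'a fps) d"
    by (simp add: shifted_gf_def field_simps del: of_nat_Suc)
qed

lemma prod_fps_conv_radius:
  fixes f :: "'v \<Rightarrow> 'a::{banach, real_normed_field} fps"
  assumes "\<And>v. v \<in> V \<Longrightarrow> r \<le> fps_conv_radius (f v)"
  shows "r \<le> fps_conv_radius (\<Prod>v\<in>V. f v)"
  using assms
proof (induction V rule: infinite_finite_induct)
  case (insert x V)
  then have "r \<le> min (fps_conv_radius (f x)) (fps_conv_radius (\<Prod>v\<in>V. f v))" by simp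
  also have "\<dots> \<le> fps_conv_radius (f x * (\<Prod>v\<in>V. f v))" by (rule fps_conv_radius_mult)
  finally show ?case using insert.hyps by simp
qed auto

lemma subdegree_prod_fps:
  fixes f :: "'v \<Rightarrow> 'a::field fps"
  assumes "finite V" and "\<And>v. v \<in> V \<Longrightarrow> f v \<noteq> 0"
  shows "subdegree (\<Prod>v\<in>V. f v) = (\<Sum>v\<in>V. subdegree (f v))"
  using assms by (induction V) (auto simp: subdegree_mult)

lemma subdegree_shifted_gf:
  assumes "\<And>d. \<delta> d \<ge> 0" and "\<exists>d\<ge>j. \<delta> d > 0"
  shows "subdegree (shifted_gf \<delta> j :: 'a::real_normed_field fps) = \<mu> \<delta> j - j"
    and "shifted_gf \<delta> j \<noteq> (0 :: 'a fps)"
proof -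
  have nz: "fps_nth (shifted_gf \<delta> j :: 'a fps) (\<mu> \<delta> j - j) \<noteq> 0"
    using mu_properties[OF assms(2)] by (simp add: shifted_gf_def)
  then show "shifted_gf \<delta> j \<noteq> (0 :: 'a fps)" by auto
  show "subdegree (shifted_gf \<delta> j :: 'a fps) = \<mu> \<delta> j - j"
    using nz zero_below_mu[of \<delta> j, OF assms(1)] by (intro subdegreeI) (auto simp: shifted_gf_def)
qed

text \<open>First moment method: the count is at least 1 wherever it is not 0, so its expectation
  bounds the probability of that event.\<close>

lemma prob_subgraph_count_0_ge:
  assumes "\<And>d. \<delta> d \<ge> 0" and "total_weight \<delta> n m > 0"
  shows "1 - expected_count \<delta> n m ori T \<le>
    measure_pmf.prob (random_multigraph \<delta> n m) {G. subgraph_count ori G T = 0}"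
proof -
  let ?p = "random_multigraph \<delta> n m" and ?A = "{G. subgraph_count ori G T = 0}"
  have "set_pmf ?p \<subseteq> nm_multigraphs n m"
    by (auto simp: set_pmf_iff pmf_random_multigraph[OF assms] split: if_splits)
  then have fin: "finite (set_pmf ?p)" by (rule finite_subset) (rule finite_nm_multigraphs)
  have "1 - measure_pmf.prob ?p ?A = measure_pmf.prob ?p (UNIV - ?A)"
    using measure_pmf.prob_compl[of ?A ?p] by simp
  also have "\<dots> = measure_pmf.expectation ?p (indicator (UNIV - ?A))" by simp
  also have "\<dots> \<le> expected_count \<delta> n m ori T"
    unfolding expected_count_def
    by (intro integral_mono integrable_measure_pmf_finite fin) (auto simp: indicator_def)
  finally show ?thesis by simp
qed

lemma mu_one_le_mu:
  assumes "j > 0" and "\<exists>d\<ge>j. \<delta> d > (0::real)"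
  shows "\<mu> \<delta> 1 \<le> \<mu> \<delta> j"
  using mu_properties[OF assms(2)] assms(1) unfolding \<mu>_def[of \<delta> 1] by (intro Least_le) auto

context saddle_point
begin

lemma radius_shifted_gf: "R \<le> fps_conv_radius (shifted_gf \<delta> j :: complex fps)"
proof (induction j)
  case (Suc j)
  then show ?case unfolding shifted_gf_Suc using fps_conv_radius_deriv order.trans by blast
qed (simp add: shifted_gf_0 radius_complex)

text \<open>With \<open>e = k - 1\<close>, the number of copies contributes
  \<open>n ^ k * m ^ e\<close> and the quotient of the factorials \<open>1 / m ^ (2 * e)\<close>,
  together \<open>n * (n / m) ^ e\<close>. The ratio of the coefficients contributes
  \<open>\<rho> ^ \<gamma> \<delta> T\<close>, and \<open>\<rho> ^ M\<close> has order
  \<open>m / n\<close>.\<close>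

lemma expected_count_asymptotics:
  assumes T: "tree T" and ex_degs: "\<forall>v\<in>vertices T. \<exists>d\<ge>deg T v. \<delta> d > 0"
    and conc: "concentrated \<delta> (\<lambda>n. 2 * int (m n)) \<rho>"
  defines "p \<equiv> - (real (card (vertices T)) - 1) + real (\<gamma> \<delta> T) / real M"
  shows "\<forall>\<^sub>F n in sequentially. total_weight \<delta> n (m n) > 0"
    and "(\<lambda>n. expected_count \<delta> n (m n) ori T) \<in> O(\<lambda>n. real n * (real (m n) / real n) powr p)"
    and "concentrated \<delta> (\<lambda>n. 2 * int (m n) - int (\<gamma> \<delta> T)) \<rho> \<Longrightarrow>
      (\<lambda>n. expected_count \<delta> n (m n) ori T) \<in> \<Theta>(\<lambda>n. real n * (real (m n) / real n) powr p)"
proof -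
  note degs = bspec[OF ex_degs]
  define k where "k = card (vertices T)"
  define e where "e = card (edges T)"
  define P where "P = (\<Prod>t\<in>vertices T. shifted_gf \<delta> (deg T t) :: complex fps)"
  define s where "s = subdegree P"
  have mT: "multigraph T" "vertices T \<noteq> {}" using T by (auto simp: tree_def)
  then have fin: "finite (vertices T)" by (simp add: multigraph_def)
  have k: "k = Suc e" using tree_card_edges[OF T] by (simp add: k_def e_def)
  have P: "R \<le> fps_conv_radius P"
    unfolding P_def by (intro prod_fps_conv_radius radius_shifted_gf)
  have "P \<noteq> 0"
    unfolding P_def using fin subdegree_shifted_gf(2)[OF nonneg degs, where 'a=complex] by simp
  then have nz: "fps_nth P s \<noteq> 0" by (simp add: s_def)
  have "s = (\<Sum>t\<in>vertices T. \<mu> \<delta> (deg T t) - deg T t)"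
    unfolding s_def P_def using subdegree_shifted_gf[OF nonneg degs, where 'a=complex]
    by (simp add: subdegree_prod_fps[OF fin])
  \<comment> \<open>The subdegrees fall short of the values of \<open>\<mu>\<close> by the degrees,
    whose sum is \<open>2 * e\<close>. So the exponent \<open>s + 2 * e\<close> of
    \<open>coeff_ratio\<close> is \<open>\<gamma> \<delta> T\<close>.\<close>
  then have "s + (\<Sum>t\<in>vertices T. deg T t) = \<gamma> \<delta> T"
    unfolding \<gamma>_def using mu_properties(1)[OF degs]
    by (simp flip: sum.distrib)
  then have s: "s + 2 * e = \<gamma> \<delta> T" by (simp add: sum_deg[OF mT(1)] e_def)
  have mtop: "filterlim m at_top sequentially" by (rule m_at_top[OF conc])
  have me: "\<forall>\<^sub>F n in sequentially. e \<le> m n" using mtop by (simp add: filterlim_at_top)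
  define a where "a n = fps_nth (P * degree_gf \<delta> ^ (n - k)) (2 * m n - 2 * e)" for n
  define b where "b n = fps_nth (degree_gf \<delta> ^ n :: complex fps) (2 * m n)" for n
  have sP: "s \<le> subdegree P" by (simp add: s_def)
  note ratio = coeff_ratio(1)[OF P sP nz conc, folded b_def]
    coeff_ratio(2,3)[OF P sP nz conc, where k = k and e = e, folded a_def b_def, unfolded s]
  show total: "\<forall>\<^sub>F n in sequentially. total_weight \<delta> n (m n) > 0"
    using ratio(1)
  proof eventually_elim
    case (elim n)
    have "of_real (total_weight \<delta> n (m n)) = fact (2 * m n) * b n"
      unfolding b_def by (rule total_weight_eq_fps_nth)
    then have "total_weight \<delta> n (m n) \<noteq> 0" using elim by auto
    moreover have "total_weight \<delta> n (m n) \<ge> 0"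
      unfolding total_weight_def by (intro sum_nonneg weight_nonneg nonneg)
    ultimately show ?case by simp
  qed
  define c where "c n = real (card (copies n (m n) ori T))" for n
  \<comment> \<open>The quotient \<open>fact (2 * m n - 2 * e) / fact (2 * m n)\<close> is
    \<open>1 / (fact (2 * e) * f n)\<close>, a form to which \<open>choose_bigtheta\<close>
    applies.\<close>
  define f where "f n = real ((2 * m n) choose (2 * e))" for n
  have E: "\<forall>\<^sub>F n in sequentially. norm (expected_count \<delta> n (m n) ori T) =
      c n * (1 / fact (2 * e)) / f n * norm (a n / b n)"
    using total ratio(1) me
  proof eventually_elim
    case (elim n)
    have "complex_of_real (expected_count \<delta> n (m n) ori T) * (fact (2 * m n) * b n) =
        of_nat (card (copies n (m n) ori T)) * fact (2 * m n - 2 * e) * a n"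
      using expected_count_eq_fps_nth[OF nonneg elim(1) mT(1), of ori, where 'a=complex]
        total_weight_eq_fps_nth[of \<delta> n "m n", where 'a=complex]
      by (simp add: a_def b_def P_def k_def e_def)
    then have "complex_of_real (expected_count \<delta> n (m n) ori T) =
        of_nat (card (copies n (m n) ori T)) * (fact (2 * m n - 2 * e) / fact (2 * m n)) * (a n / b n)"
      using elim(2) by (simp add: field_simps)
    then have "norm (expected_count \<delta> n (m n) ori T) =
        norm (of_nat (card (copies n (m n) ori T)) * (fact (2 * m n - 2 * e) / fact (2 * m n)) * (a n / b n))"
      by (metis norm_of_real real_norm_def)
    also have "\<dots> = c n * (fact (2 * m n - 2 * e) / fact (2 * m n)) * norm (a n / b n)"
      by (simp add: norm_mult norm_divide c_def)
    also have "fact (2 * m n - 2 * e) / fact (2 * m n) = (1 / fact (2 * e)) / f n"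
      using elim(3) binomial_fact[of "2 * e" "2 * m n", where 'a=real] by (simp add: f_def)
    finally show ?case by simp
  qed
  have f: "f \<in> \<Theta>(\<lambda>n. real (m n) ^ (2 * e))"
  proof -
    have "filterlim (\<lambda>n. 2 * m n) at_top sequentially" by (rule filterlim_at_top_mono[OF mtop]) simp
    from choose_bigtheta[OF this, of "2 * e"] show ?thesis
      by (simp add: f_def[abs_def] power_mult_distrib)
  qed
  have f_pos: "\<forall>\<^sub>F n in sequentially. f n \<noteq> 0" "\<forall>\<^sub>F n in sequentially. real (m n) ^ (2 * e) \<noteq> 0"
    using me m_pos by (auto elim!: eventually_mono simp: f_def)
  have cf: "(\<lambda>n. c n * (1 / fact (2 * e)) / f n) \<in>
      \<Theta>(\<lambda>n. real n ^ k * real (m n) ^ e / real (m n) ^ (2 * e))"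
  proof (rule landau_theta.divide[OF f_pos])
    have "(\<lambda>n. c n * (1 / fact (2 * e))) \<in> \<Theta>(\<lambda>n. real n ^ k * real (m n) ^ e * 1)"
      unfolding c_def k_def e_def
      by (intro landau_theta.mult card_copies_bigtheta mT mtop) simp
    then show "(\<lambda>n. c n * (1 / fact (2 * e))) \<in> \<Theta>(\<lambda>n. real n ^ k * real (m n) ^ e)" by simp
    show "(\<lambda>n. real (m n) ^ (2 * e)) \<in> \<Theta>(f)" using f by (simp add: bigtheta_sym)
  qed
  have \<rho>: "(\<lambda>n. \<rho> n ^ \<gamma> \<delta> T) \<in> \<Theta>(\<lambda>n. (real (m n) / real n) powr (real (\<gamma> \<delta> T) / real M))"
  proof -
    have powr: "(\<lambda>n. \<bar>\<rho> n ^ M\<bar> powr (real (\<gamma> \<delta> T) / real M)) \<in>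
        \<Theta>(\<lambda>n. \<bar>real (m n) / real n\<bar> powr (real (\<gamma> \<delta> T) / real M))"
      by (rule bigtheta_powr[OF rho_power_bigtheta])
    have eq: "\<forall>\<^sub>F n in sequentially. \<rho> n ^ \<gamma> \<delta> T = \<bar>\<rho> n ^ M\<bar> powr (real (\<gamma> \<delta> T) / real M)"
      using rho
    proof eventually_elim
      case (elim n)
      then have "\<bar>\<rho> n ^ M\<bar> powr (real (\<gamma> \<delta> T) / real M) = (\<rho> n powr real M) powr (real (\<gamma> \<delta> T) / real M)"
        by (simp add: powr_realpow)
      also have "\<dots> = \<rho> n powr real (\<gamma> \<delta> T)" using M_pos by (simp add: powr_powr)
      finally show ?case using elim by (simp add: powr_realpow)
    qed
    have "(\<lambda>n. \<rho> n ^ \<gamma> \<delta> T) \<in>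
        \<Theta>(\<lambda>n. \<bar>real (m n) / real n\<bar> powr (real (\<gamma> \<delta> T) / real M))"
      using bigthetaI_cong[OF eq] powr by (rule landau_theta.bigtheta_trans2)
    then show ?thesis by simp
  qed
  have target: "\<forall>\<^sub>F n in sequentially. real n ^ k * real (m n) ^ e / real (m n) ^ (2 * e) *
      (real (m n) / real n) powr (real (\<gamma> \<delta> T) / real M) = real n * (real (m n) / real n) powr p"
    using m_pos eventually_gt_at_top[of 0]
  proof eventually_elim
    case (elim n)
    let ?y = "real (m n) / real n"
    have y: "?y > 0" using elim by simp
    have "real n ^ k * real (m n) ^ e / real (m n) ^ (2 * e) = real n * (1 / ?y ^ e)"
      using elim by (simp add: k power_divide mult_2 power_add)
    also have "1 / ?y ^ e = ?y powr (- real e)"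
      using y by (simp add: powr_minus powr_realpow field_simps)
    moreover have p: "p = - real e + real (\<gamma> \<delta> T) / real M"
      using k by (simp add: p_def k_def[symmetric])
    ultimately show ?case unfolding p powr_add by simp
  qed
  have final: "(\<lambda>n. real n ^ k * real (m n) ^ e / real (m n) ^ (2 * e) * \<rho> n ^ \<gamma> \<delta> T) \<in>
      \<Theta>(\<lambda>n. real n * (real (m n) / real n) powr p)"
    using landau_theta.mult[OF bigtheta_refl \<rho>] bigthetaI_cong[OF target]
    by (rule landau_theta.bigtheta_trans1)
  note Econg = bigthetaI_cong[OF E]
  have "(\<lambda>n. c n * (1 / fact (2 * e)) / f n * norm (a n / b n)) \<in>
      O(\<lambda>n. real n ^ k * real (m n) ^ e / real (m n) ^ (2 * e) * \<rho> n ^ \<gamma> \<delta> T)"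
    by (intro landau_o.big.mult bigthetaD1[OF cf] ratio(2))
  from landau_o.big.bigtheta_trans2[OF Econg landau_o.big.bigtheta_trans1[OF this final]]
  show "(\<lambda>n. expected_count \<delta> n (m n) ori T) \<in> O(\<lambda>n. real n * (real (m n) / real n) powr p)"
    by simp
  assume "concentrated \<delta> (\<lambda>n. 2 * int (m n) - int (\<gamma> \<delta> T)) \<rho>"
  then have "(\<lambda>n. c n * (1 / fact (2 * e)) / f n * norm (a n / b n)) \<in>
      \<Theta>(\<lambda>n. real n ^ k * real (m n) ^ e / real (m n) ^ (2 * e) * \<rho> n ^ \<gamma> \<delta> T)"
    by (intro landau_theta.mult cf ratio(3))
  from landau_theta.bigtheta_trans2[OF Econg landau_theta.bigtheta_trans1[OF this final]]
  show "(\<lambda>n. expected_count \<delta> n (m n) ori T) \<in> \<Theta>(\<lambda>n. real n * (real (m n) / real n) powr p)"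
    by simp
qed

end

theorem theorem7p1:
  fixes \<delta> :: "nat \<Rightarrow> real" and T :: multigraph and k :: nat and ori :: bool
    and \<epsilon> \<rho> :: "nat \<Rightarrow> real" and m :: "nat \<Rightarrow> nat"
  assumes "\<And>d. \<delta> d \<ge> 0" and "\<delta> 0 > 0"
    and "tree T" and "card (vertices T) = k"
    and "\<And>v. v \<in> vertices T \<Longrightarrow> \<exists>d\<ge>deg T v. \<delta> d > 0"
    and "\<epsilon> \<longlonglongrightarrow> 0" and "\<forall>\<^sub>F n in sequentially. \<epsilon> n > 0"
    and "(\<lambda>n. real (m n)) \<in> \<Theta>(\<lambda>n. real n * \<epsilon> n)"
    and "\<forall>\<^sub>F n in sequentially.
           \<rho> n > 0 \<and> ereal (\<rho> n) < fps_conv_radius (degree_gf \<delta> :: real fps) \<and>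
           \<rho> n * eval_fps (fps_deriv (degree_gf \<delta>)) (\<rho> n) / eval_fps (degree_gf \<delta>) (\<rho> n)
             = 2 * real (m n) / real n"
    and "concentrated \<delta> (\<lambda>n. 2 * int (m n)) \<rho>"
  shows "((\<lambda>n. expected_count \<delta> n (m n) ori T)
            \<in> O(\<lambda>n. real n * \<epsilon> n powr (- (real k - 1) + real (\<gamma> \<delta> T) / real (\<mu> \<delta> 1)))) \<and>
         (concentrated \<delta> (\<lambda>n. 2 * int (m n) - int (\<gamma> \<delta> T)) \<rho> \<longrightarrow>
          (\<lambda>n. expected_count \<delta> n (m n) ori T)
            \<in> \<Theta>(\<lambda>n. real n * \<epsilon> n powr (- (real k - 1) + real (\<gamma> \<delta> T) / real (\<mu> \<delta> 1)))) \<and>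
         ((real k - 1) * real (\<mu> \<delta> 1) - real (\<gamma> \<delta> T) \<noteq> 0 \<and>
          \<epsilon> \<in> o(\<lambda>n. real n powr (real (\<mu> \<delta> 1) / ((real k - 1) * real (\<mu> \<delta> 1) - real (\<gamma> \<delta> T)))) \<longrightarrow>
          (\<lambda>n. measure_pmf.prob (random_multigraph \<delta> n (m n)) {G. subgraph_count ori G T = 0})
            \<longlonglongrightarrow> 1)"
proof -
  let ?D = "degree_gf \<delta> :: real fps"
  note nonneg = assms(1) and T = assms(3) and degs = assms(5) and \<epsilon>_pos = assms(7)
  have rate: "(\<lambda>n. real (m n) / real n) \<in> \<Theta>(\<epsilon>)"
  proof -
    have "(\<lambda>n. real (m n) / real n) \<in> \<Theta>(\<lambda>n. real n * \<epsilon> n / real n)"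
      using eventually_gt_at_top[of 0]
      by (intro landau_theta.divide assms(8)) (auto elim!: eventually_mono)
    moreover have "\<forall>\<^sub>F n in sequentially. real n * \<epsilon> n / real n = \<epsilon> n"
      using eventually_gt_at_top[of 0] by eventually_elim simp
    ultimately show ?thesis using landau_theta.bigtheta_trans1[OF _ bigthetaI_cong] by blast
  qed
  have m_small: "(\<lambda>n. real (m n) / real n) \<longlonglongrightarrow> 0"
  proof -
    have "\<epsilon> \<in> o(\<lambda>_. 1)" using assms(6) by (intro smalloI_tendsto) auto
    with bigthetaD1[OF rate] have "(\<lambda>n. real (m n) / real n) \<in> o(\<lambda>_. 1)"
      by (rule landau_o.big_small_trans)
    then show ?thesis using smalloD_tendsto by fastforce
  qed
  have m_pos: "\<forall>\<^sub>F n in sequentially. m n > 0"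
  proof -
    obtain c where c: "c > 0" "\<forall>\<^sub>F n in sequentially. norm (real (m n)) \<ge> c * norm (real n * \<epsilon> n)"
      using bigthetaD2[OF assms(8)] by (elim landau_omega.bigE)
    from c(2) \<epsilon>_pos eventually_gt_at_top[of 0] show ?thesis
    proof eventually_elim
      case (elim n)
      then have "c * norm (real n * \<epsilon> n) > 0" using c(1) by simp
      with elim(1) show ?case by (metis norm_zero not_gr_zero not_le of_nat_0)
    qed
  qed
  have "\<forall>\<^sub>F n in sequentially. m n > 0 \<and> n > 0 \<and> \<rho> n > 0 \<and> ereal (\<rho> n) < fps_conv_radius ?D \<and>
      \<rho> n * eval_fps (fps_deriv ?D) (\<rho> n) / eval_fps ?D (\<rho> n) = 2 * real (m n) / real n"
    using m_pos assms(9) eventually_gt_at_top[of 0] by eventually_elim simp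
  \<comment> \<open>A single index with \<open>m N > 0\<close> shows that some positive degree has
    positive weight: otherwise the derivative would vanish and with it the left side of the saddle
    point equation. It also makes the radius of convergence positive.\<close>
  then obtain N where N: "m N > 0" "N > 0" "\<rho> N > 0" "ereal (\<rho> N) < fps_conv_radius ?D"
      "\<rho> N * eval_fps (fps_deriv ?D) (\<rho> N) / eval_fps ?D (\<rho> N) = 2 * real (m N) / real N"
    using eventually_happens'[OF sequentially_bot] by blast
  interpret degree_weights \<delta>
  proof
    show "\<exists>d\<ge>1. \<delta> d > 0"
    proof (rule ccontr)
      assume "\<not> (\<exists>d\<ge>1. \<delta> d > 0)"
      then have "\<delta> (Suc d) = 0" for d using nonneg[of "Suc d"] by (metis One_nat_def Suc_le_mono
            le0 less_eq_real_def)
      then have deriv: "fps_deriv ?D = 0" by (simp add: fps_eq_iff degree_gf_def)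
      show False using N(1,2,5) unfolding deriv by simp
    qed
    show "0 < fps_conv_radius ?D" using N(3,4) by (metis ereal_less(2) less_trans)
  qed (use assms in auto)
  interpret saddle_point \<delta> \<rho> m
  proof
    show "\<forall>\<^sub>F n in sequentially. 0 < \<rho> n \<and> ereal (\<rho> n) < R" using assms(9) by eventually_elim simp
    show "\<forall>\<^sub>F n in sequentially. real n * (S 1 (\<rho> n) / S 0 (\<rho> n)) = 2 * real (m n)"
      using assms(9) eventually_gt_at_top[of 0]
    proof eventually_elim
      case (elim n)
      have "ereal (norm (\<rho> n)) < R" using elim by simp
      then have "S 1 (\<rho> n) = \<rho> n * eval_fps (fps_deriv ?D) (\<rho> n)"
        using fps_conv_radius_deriv[of ?D]
        by (simp add: S_def moment_gf_Suc moment_gf_0 eval_fps_mult less_le_trans)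
      moreover have "S 0 (\<rho> n) = eval_fps ?D (\<rho> n)" by (simp add: S_def moment_gf_0)
      ultimately show ?case using elim by (simp add: field_simps)
    qed
  qed (use m_pos m_small in auto)
  define p where "p = - (real k - 1) + real (\<gamma> \<delta> T) / real (\<mu> \<delta> 1)"
  have ex_degs: "\<forall>v\<in>vertices T. \<exists>d\<ge>deg T v. \<delta> d > 0" using degs by blast
  note asymp = expected_count_asymptotics(1)[OF T ex_degs assms(10)]
    expected_count_asymptotics(2,3)[OF T ex_degs assms(10), where ori = ori,
      unfolded assms(4), unfolded M_def, folded p_def]
  have powr: "(\<lambda>n. real n * (real (m n) / real n) powr p) \<in> \<Theta>(\<lambda>n. real n * \<epsilon> n powr p)"
  proof -
    have eq: "\<forall>\<^sub>F n in sequentially. \<bar>\<epsilon> n\<bar> powr p = \<epsilon> n powr p"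
      using \<epsilon>_pos by eventually_elim simp
    have "(\<lambda>n. \<bar>real (m n) / real n\<bar> powr p) \<in> \<Theta>(\<lambda>n. \<epsilon> n powr p)"
      using bigtheta_powr[OF rate] bigthetaI_cong[OF eq] by (rule landau_theta.bigtheta_trans1)
    then show ?thesis by (intro landau_theta.mult) auto
  qed
  have upper: "(\<lambda>n. expected_count \<delta> n (m n) ori T) \<in> O(\<lambda>n. real n * \<epsilon> n powr p)"
    using landau_o.big.bigtheta_trans1[OF asymp(2) powr] .
  moreover have "(\<lambda>n. expected_count \<delta> n (m n) ori T) \<in> \<Theta>(\<lambda>n. real n * \<epsilon> n powr p)"
    if "concentrated \<delta> (\<lambda>n. 2 * int (m n) - int (\<gamma> \<delta> T)) \<rho>"
    using landau_theta.bigtheta_trans1[OF asymp(3)[OF that] powr] .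
  moreover have "(\<lambda>n. measure_pmf.prob (random_multigraph \<delta> n (m n)) {G. subgraph_count ori G T = 0}) \<longlonglongrightarrow> 1"
    if ne: "(real k - 1) * real (\<mu> \<delta> 1) - real (\<gamma> \<delta> T) \<noteq> 0"
      and small: "\<epsilon> \<in> o(\<lambda>n. real n powr (real (\<mu> \<delta> 1) / ((real k - 1) * real (\<mu> \<delta> 1) - real (\<gamma> \<delta> T))))"
  proof -
    have mu: "\<mu> \<delta> 1 > 0" using M_pos by (simp add: M_def)
    have mT: "multigraph T" "finite (vertices T)" "vertices T \<noteq> {}"
      using T by (auto simp: tree_def multigraph_def)
    have k0: "k > 0" using mT assms(4) by auto
    \<comment> \<open>For a single vertex \<open>\<gamma> \<delta> T = \<mu> \<delta> 0 = 0\<close>,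
      and the denominator of the exponent \<open>\<lambda>\<close> vanishes, which \<open>ne\<close>
      excludes.\<close>
    have "k \<noteq> 1"
    proof
      assume k1: "k = 1"
      then have "card (edges T) = 0" using tree_card_edges[OF T] assms(4) by simp
      then have "(\<Sum>v\<in>vertices T. deg T v) = 0" using sum_deg[OF mT(1)] by simp
      then have "\<forall>v\<in>vertices T. deg T v = 0" using mT by simp
      moreover have "\<mu> \<delta> 0 = 0" unfolding \<mu>_def using assms(2) by (intro Least_equality) auto
      ultimately have "\<gamma> \<delta> T = 0" by (simp add: \<gamma>_def)
      then show False using ne k1 by simp
    qed
    then have k2: "k \<ge> 2" using k0 by simp
    \<comment> \<open>All degrees in a tree with at least two vertices are positive. Hence
      \<open>p \<ge> 1\<close> in spite of the summand \<open>- (k - 1)\<close>, and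
      \<open>l = - 1 / p\<close> is negative.\<close>
    have "k * \<mu> \<delta> 1 \<le> \<gamma> \<delta> T"
    proof -
      have "(\<Sum>v\<in>vertices T. \<mu> \<delta> 1) \<le> (\<Sum>v\<in>vertices T. \<mu> \<delta> (deg T v))"
        using tree_deg_pos[OF T] k2 degs by (intro sum_mono mu_one_le_mu) (auto simp: assms(4))
      then show ?thesis using assms(4) by (simp add: \<gamma>_def)
    qed
    then have "real k * real (\<mu> \<delta> 1) \<le> real (\<gamma> \<delta> T)" by (metis of_nat_le_iff of_nat_mult)
    then have "(real k - 1) * real (\<mu> \<delta> 1) < real (\<gamma> \<delta> T)" using mu by (simp add: algebra_simps)
    then have p: "p > 0" using mu by (simp add: p_def field_simps)
    \<comment> \<open>Since \<open>l * p = - 1\<close>, the power \<open>p\<close> of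
      \<open>\<epsilon> n / n powr l\<close> is \<open>n * \<epsilon> n powr p\<close>, so the
      assumption on \<open>\<epsilon>\<close> makes the upper bound of the expectation tend to
      0.\<close>
    define l where "l = real (\<mu> \<delta> 1) / ((real k - 1) * real (\<mu> \<delta> 1) - real (\<gamma> \<delta> T))"
    have pl: "l * p = - 1"
    proof -
      have "p = - ((real k - 1) * real (\<mu> \<delta> 1) - real (\<gamma> \<delta> T)) / real (\<mu> \<delta> 1)"
        using mu by (simp add: p_def field_simps)
      moreover have "x / q * (- q / x) = - 1" if "q \<noteq> 0" "x \<noteq> 0" for q x :: real
        using that by simp
      ultimately show ?thesis unfolding l_def using ne mu by (metis of_nat_0_less_iff less_irrefl)
    qed
    have "(\<lambda>n. \<epsilon> n / real n powr l) \<longlonglongrightarrow> 0" using small unfolding l_def by (rule smalloD_tendsto)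
    then have "(\<lambda>n. (\<epsilon> n / real n powr l) powr p) \<longlonglongrightarrow> 0"
      using \<epsilon>_pos p by (intro tendsto_zero_powrI[OF _ tendsto_const]) (auto elim!: eventually_mono)
    moreover have "\<forall>\<^sub>F n in sequentially. (\<epsilon> n / real n powr l) powr p = real n * \<epsilon> n powr p"
      using \<epsilon>_pos eventually_gt_at_top[of 0]
    proof eventually_elim
      case (elim n)
      have "(real n powr l) powr p = inverse (real n)"
        unfolding powr_powr pl using elim by (simp add: powr_minus)
      then have "\<epsilon> n powr p / (real n powr l) powr p = real n * \<epsilon> n powr p"
        by (simp add: divide_inverse)
      then show ?case using elim by (simp add: powr_divide)
    qed
    ultimately have "(\<lambda>n. real n * \<epsilon> n powr p) \<longlonglongrightarrow> 0" by (rule Lim_transform_eventually)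
    then have "(\<lambda>n. real n * \<epsilon> n powr p) \<in> o(\<lambda>_. 1)" by (intro smalloI_tendsto) auto
    then have "(\<lambda>n. expected_count \<delta> n (m n) ori T) \<in> o(\<lambda>_. 1)"
      by (rule landau_o.big_small_trans[OF upper])
    then have E0: "(\<lambda>n. expected_count \<delta> n (m n) ori T) \<longlonglongrightarrow> 0"
      using smalloD_tendsto by fastforce
    show ?thesis
    proof (rule tendsto_sandwich[OF _ _ _ tendsto_const])
      show "\<forall>\<^sub>F n in sequentially. 1 - expected_count \<delta> n (m n) ori T \<le>
          measure_pmf.prob (random_multigraph \<delta> n (m n)) {G. subgraph_count ori G T = 0}"
        using asymp(1) by eventually_elim (rule prob_subgraph_count_0_ge[OF nonneg])
      show "(\<lambda>n. 1 - expected_count \<delta> n (m n) ori T) \<longlonglongrightarrow> 1"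
        using tendsto_diff[OF tendsto_const E0, of 1] by simp
    qed simp
  qed
  ultimately show ?thesis unfolding p_def by blast
qed

end
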